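(* Let $\alpha,\beta>-1$ and let $h$ be a real function that is analytic and positive on $[-1,1]$ (i.e., analytic in a neighborhood of $[-1,1]$ and positive on $[-1,1]$). Let $w(x)=(1-x)^{\alpha}(1+x)^{\beta}h(x)$ on $[-1,1]$, and let $\{p_n\}_{n\ge 0}$ be the orthonormal polynomials with respect to $w(x)\,dx$ on $[-1,1]$ (with $p_n$ of degree $n$ and positive leading coefficient). For $n\in\mathbb{N}$ and $x\in(-1,1)$ let $\bm\Psi_n(x)=(\Psi_{n,1}(x),\dots,\Psi_{n,n}(x))$ with $\Psi_{n,j}(x)=\lambda_n(x)\,p_{j-1}^2(x)$, where $\lambda_n(x)=\big(\sum_{j=0}^{n-1}p_j^2(x)\big)^{-1}$, and let $$\mathcal D(\bm\Psi_n(x))=\log n-\mathcal S(\bm\Psi_n(x)),\qquad \mathcal S(\bm\Psi_n(x))=-\sum_{j=1}^n\Psi_{n,j}(x)\log\Psi_{n,j}(x).$$ Then for every $x=\cos\theta\in(-1,1)$, $\theta\in(0,\pi)$, the limit $\mathcal D_\infty(x)=\lim_{n\to\infty}\mathcal D(\bm\Psi_n(x))$ exists, and $$\mathcal D_\infty(x)=\begin{cases}1-\log 2, & \text{if } \theta/\pi\notin\mathbb{Q},\\[2mm] \log 2+2\,\widehat{\mathcal S}_{k,s}, & \text{if } \theta/\pi=s/k \text{ with } s,k\in\mathbb{N},\ s<k,\ \operatorname{GCD}(s,k)=1,\end{cases}$$ where $$\widehat{\mathcal S}_{k,s}=\frac1k\sum_{i=0}^{k-1}\mathcal F\!\left(\cos\!\Big(\big(i+\tfrac12\big)\frac{\pi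 s}{k}+\varphi\Big(\cos\frac{\pi s}{k}\Big)-\frac{\pi}{4}\Big)\right),$$ with $\mathcal F(y)=y^2\log(y^2)$ for $y\neq 0$ and $\mathcal F(0)=0$, and, for $x=\cos\theta\in(-1,1)$, $$\varphi(x)=\frac12\big((\alpha+\beta)\theta-\alpha\pi\big)+\frac{\sqrt{1-x^2}}{2\pi}\,\mathrm{p.v.}\!\int_{-1}^{1}\frac{\log h(t)}{\sqrt{1-t^2}}\,\frac{dt}{t-x},$$ the integral being a Cauchy principal value.
   Context: Throughout, whenever $x=\cos\theta\in(-1,1)$ it is understood that $\theta\in(0,\pi)$. The principal value integral is $\lim_{\varepsilon\to0}\big(\int_{-1}^{x-\varepsilon}+\int_{x+\varepsilon}^{1}\big)$. $\operatorname{GCD}$ denotes the greatest common divisor. *)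

theory Defs
  imports "HOL-Complex_Analysis.Complex_Analysis" "HOL-Computational_Algebra.Polynomial"
begin

definition analytic_near_interval :: "(real \<Rightarrow> real) \<Rightarrow> bool" where
  "analytic_near_interval h \<longleftrightarrow>
     (\<exists>U H. open U \<and> complex_of_real ` {-1..1} \<subseteq> U \<and> H holomorphic_on U \<and>
        (\<forall>t\<in>{-1..1}. H (complex_of_real t) = complex_of_real (h t)))"

definition jacobi_weight :: "real \<Rightarrow> real \<Rightarrow> (real \<Rightarrow> real) \<Rightarrow> real \<Rightarrow> real" where
  "jacobi_weight \<alpha> \<beta> h x = (1 - x) powr \<alpha> * (1 + x) powr \<beta> * h x"

definition orthonormal_polys :: "(real \<Rightarrow> real) \<Rightarrow> (nat \<Rightarrow> real poly) \<Rightarrow> bool" where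
  "orthonormal_polys w p \<longleftrightarrow>
     (\<forall>n. degree (p n) = n \<and> lead_coeff (p n) > 0) \<and>
     (\<forall>m n. ((\<lambda>x. poly (p m) x * poly (p n) x * w x) has_integral
                (if m = n then 1 else 0)) {-1..1})"

definition christoffel :: "(nat \<Rightarrow> real poly) \<Rightarrow> nat \<Rightarrow> real \<Rightarrow> real" where
  "christoffel p n x = inverse (\<Sum>j<n. (poly (p j) x)\<^sup>2)"

definition Psi :: "(nat \<Rightarrow> real poly) \<Rightarrow> nat \<Rightarrow> nat \<Rightarrow> real \<Rightarrow> real" where
  "Psi p n j x = christoffel p n x * (poly (p (j - 1)) x)\<^sup>2"

definition xlogx :: "real \<Rightarrow> real" where
  "xlogx y = (if y = 0 then 0 else y * ln y)"

definition shannon_entropy :: "(nat \<Rightarrow> real poly) \<Rightarrow> nat \<Rightarrow> real \<Rightarrow> real" where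
  "shannon_entropy p n x = - (\<Sum>j=1..n. xlogx (Psi p n j x))"

definition entropy_defect :: "(nat \<Rightarrow> real poly) \<Rightarrow> nat \<Rightarrow> real \<Rightarrow> real" where
  "entropy_defect p n x = ln (real n) - shannon_entropy p n x"

definition FF :: "real \<Rightarrow> real" where
  "FF y = (if y = 0 then 0 else y\<^sup>2 * ln (y\<^sup>2))"

definition pv_integral :: "(real \<Rightarrow> real) \<Rightarrow> real \<Rightarrow> real" where
  "pv_integral f x =
     Lim (at_right 0) (\<lambda>\<epsilon>. integral {-1..x - \<epsilon>} f + integral {x + \<epsilon>..1} f)"

definition phi :: "real \<Rightarrow> real \<Rightarrow> (real \<Rightarrow> real) \<Rightarrow> real \<Rightarrow> real" where
  "phi \<alpha> \<beta> h x =
     ((\<alpha> + \<beta>) * arccos x - \<alpha> * pi) / 2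
     + sqrt (1 - x\<^sup>2) / (2 * pi) *
       pv_integral (\<lambda>t. ln (h t) / sqrt (1 - t\<^sup>2) / (t - x)) x"

definition S_hat :: "real \<Rightarrow> real \<Rightarrow> (real \<Rightarrow> real) \<Rightarrow> nat \<Rightarrow> nat \<Rightarrow> real" where
  "S_hat \<alpha> \<beta> h k s =
     (1 / real k) * (\<Sum>i<k. FF (cos ((real i + 1/2) * (pi * real s / real k)
                                + phi \<alpha> \<beta> h (cos (pi * real s / real k)) - pi / 4)))"

end

(* The limit only depends on the pointwise asymptotics of p_n(cos t), which are obtained
   without Riemann-Hilbert analysis. Let f(t) = w(cos t) sin t and let D be the Szego function, so that
   |D(e^it)|^2 = f(t) with D explicit up to exp of an analytic function. The functions
   S_n(t) = Re(e^(-int) / D(e^it)) are exactly f-orthogonal to all polynomials in cos t of degree < n,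
   and they are close in L^2(f) to polynomials of degree n because D is outer; hence, with
   c_n = <S_n, p_n>, the error e_n = c_n p_n - S_n tends to 0 in L^2(f) and c_n^2 tends to pi/2.
   To pass from L^2 to a point, multiply e_n by a high power of sin t and pair it with the Chebyshev
   reproducing kernel at theta, replacing f by its value at theta (Korous): the difference
   f(t) - f(theta) absorbs the singularity of the Christoffel-Darboux formula, so e_n(theta) tends to 0.
   The phase of D is a conjugate function, i.e. the principal value integral in phi.
   It remains to average y ln y over y = cos^2 of an arithmetic progression, which is periodic for
   rational theta/pi and equidistributed otherwise. *)
theory Submission
  imports Defs "HOL-Real_Asymp.Real_Asymp"
begin

subsection \<open>Analytic functions on the disc and half-circle integrals\<close>

text \<open>Normalisations: \<open>Psi\<close> does not change when all p_n(x) are multiplied by one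
  constant, and only squares enter, so p_n(x)^2 is needed up to a common positive factor and the
  sign of c_n never has to be found. The limit pi/2 of c_n^2 is the length pi times the mean 1/2 of
  a squared cosine, about which S_n^2 f oscillates. The obstacle is at the end points. For general
  exponents above -1 the weight f may vanish or blow up at 0 and pi, and neither S_n nor (f(t) -
  f(\<theta>))^2 / f(t) is under control there. A factor sin^(2m) with m large cures both: sin^(2m)
  / D has an absolutely convergent Fourier series and sin^(4m) / f is bounded. The price is 2m
  additional degrees, a number independent of n. The half circle suffices because all analytic
  functions involved have real Taylor coefficients, so that real parts on the circle are cosine
  series. The Jacobian sin t turns the exponents of the weight into a = \<alpha> + 1/2 and b =
  \<beta> + 1/2 for D, and a, b > -1/2 is what makes |D|^2 integrable.\<close>

abbreviation half_circle :: "real measure" where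
  "half_circle \<equiv> lebesgue_on {0<..<pi}"

lemma integrable_half_circle_dominated:
  fixes g :: "real \<Rightarrow> 'a::{euclidean_space}" and B :: "real \<Rightarrow> real"
  assumes "continuous_on {0<..<pi} g" "integrable half_circle B"
    and "\<And>t. 0 < t \<Longrightarrow> t < pi \<Longrightarrow> norm (g t) \<le> B t"
  shows "integrable half_circle g"
proof (rule Bochner_Integration.integrable_bound[OF assms(2)])
  show "g \<in> borel_measurable half_circle"
    by (intro continuous_imp_measurable_on_sets_lebesgue assms) auto
  have "norm (g t) \<le> norm (B t)" if "0 < t" "t < pi" for t
    using assms(3)[OF that] by simp
  then show "AE x in half_circle. norm (g x) \<le> norm (B x)"
    by (intro AE_I2) (auto simp: space_restrict_space)
qed

lemma integrable_half_circle_const [simp]: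
  "integrable half_circle (\<lambda>t. c::'a::euclidean_space)"
  by (intro finite_measure.integrable_const finite_measure_lebesgue_on) auto

lemma integrable_half_circle_bounded:
  fixes g :: "real \<Rightarrow> 'a::euclidean_space"
  assumes "continuous_on {0<..<pi} g" "\<And>t. 0 < t \<Longrightarrow> t < pi \<Longrightarrow> norm (g t) \<le> B"
  shows "integrable half_circle g"
  by (rule integrable_half_circle_dominated[OF assms(1), of "\<lambda>_. B"]) (use assms in auto)

lemma integral_half_circle_cos:
  "integral\<^sup>L half_circle (\<lambda>t. cos (real k * t)) = (if k = 0 then pi else 0)"
proof -
  have "((\<lambda>t. cos (real k * t)) has_integral (if k = 0 then pi else 0)) {0..pi}"
  proof (cases "k = 0")
    case True
    then show ?thesis using has_integral_const_real[of "1::real" 0 pi] by simp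
  next
    case False
    have "((\<lambda>t. cos (real k * t)) has_integral (sin (real k * pi) / k - sin (real k * 0) / k)) {0..pi}"
      by (rule fundamental_theorem_of_calculus)
        (use False in \<open>auto intro!: derivative_eq_intros simp flip: has_real_derivative_iff_has_vector_derivative\<close>)
    then show ?thesis using False by (simp add: sin_npi)
  qed
  then have "((\<lambda>t. cos (real k * t)) has_integral (if k = 0 then pi else 0)) {0<..<pi}"
    by (simp add: has_integral_Icc_iff_Ioo)
  moreover have "integrable half_circle (\<lambda>t. cos (real k * t))"
    by (rule integrable_half_circle_bounded[where B=1]) (auto intro!: continuous_intros)
  ultimately show ?thesis
    by (simp add: lebesgue_integral_eq_integral integral_unique)
qed

text \<open>Real coefficients turn the real part on a circle of radius r < 1 into a cosine series,
  and over the half circle every term but the constant one integrates to 0. The majorant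
  \<open>B\<close> carries this to r = 1 by dominated convergence, so \<open>F\<close> may be
  singular at 1 and -1.\<close>

lemma half_circle_mean_value:
  fixes a :: "nat \<Rightarrow> real" and F :: "complex \<Rightarrow> complex"
  assumes sums: "\<And>z. norm z < 1 \<Longrightarrow> (\<lambda>k. of_real (a k) * z ^ k) sums F z"
    and B: "integrable half_circle B"
    and bound: "\<And>r t. 0 \<le> r \<Longrightarrow> r < 1 \<Longrightarrow> 0 < t \<Longrightarrow> t < pi \<Longrightarrow> norm (F (of_real r * cis t)) \<le> B t"
    and lim: "\<And>t. 0 < t \<Longrightarrow> t < pi \<Longrightarrow> ((\<lambda>r. F (of_real r * cis t)) \<longlongrightarrow> G t) (at_left 1)"
  shows "integrable half_circle (\<lambda>t. Re (G t))" (is ?th1)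
    and "integral\<^sup>L half_circle (\<lambda>t. Re (G t)) = pi * a 0" (is ?th2)
proof -
  have Re_sums: "(\<lambda>k. a k * r ^ k * cos (real k * t)) sums Re (F (of_real r * cis t))"
    if "0 \<le> r" "r < 1" for r t
  proof -
    have "(\<lambda>k. Re (of_real (a k) * (of_real r * cis t) ^ k)) sums Re (F (of_real r * cis t))"
      by (rule sums_Re[OF sums]) (use that in \<open>auto simp: norm_mult\<close>)
    moreover have "Re (of_real (a k) * (of_real r * cis t) ^ k) = a k * r ^ k * cos (real k * t)" for k
      by (simp add: power_mult_distrib Complex.DeMoivre flip: of_real_power)
    ultimately show ?thesis by (simp only:)
  qed
  have abs_summ: "summable (\<lambda>k. \<bar>a k\<bar> * r ^ k)" if "0 \<le> r" "r < 1" for r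
  proof -
    obtain s where s: "r < s" "s < 1" using dense \<open>r < 1\<close> by blast
    have "summable (\<lambda>k. of_real (a k) * (of_real s :: complex) ^ k)"
      using sums[of "of_real s"] s that by (auto simp: sums_iff)
    then have "summable (\<lambda>k. norm (of_real (a k) * (of_real r :: complex) ^ k))"
      by (rule powser_insidea) (use s that in auto)
    then show ?thesis using that by (simp add: norm_mult norm_power)
  qed
  have int: "integral\<^sup>L half_circle (\<lambda>t. Re (F (of_real r * cis t))) = pi * a 0"
    and meas: "(\<lambda>t. Re (F (of_real r * cis t))) \<in> borel_measurable half_circle"
    if r: "0 \<le> r" "r < 1" for r
  proof -
    let ?u = "\<lambda>k t. a k * r ^ k * cos (real k * t)"
    have i: "integrable half_circle (?u k)" for k
      by (rule integrable_half_circle_bounded[where B="\<bar>a k\<bar> * r^k"])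
        (use r in \<open>auto intro!: continuous_intros mult_left_le simp: abs_mult\<close>)
    have le: "\<bar>?u k t\<bar> \<le> \<bar>a k\<bar> * r ^ k" for k t
      using r by (auto intro!: mult_left_le simp: abs_mult)
    have sum1: "summable (\<lambda>k. norm (?u k t))" for t
      by (rule summable_comparison_test[OF _ abs_summ[OF r]]) (use le in auto)
    have "integral\<^sup>L half_circle (\<lambda>t. norm (?u k t)) \<le> pi * (\<bar>a k\<bar> * r ^ k)" for k
    proof -
      have "integral\<^sup>L half_circle (\<lambda>t. norm (?u k t)) \<le>
          integral\<^sup>L half_circle (\<lambda>t. \<bar>a k\<bar> * r ^ k)"
        by (rule integral_mono) (use i le in auto)
      also have "\<dots> = pi * (\<bar>a k\<bar> * r ^ k)"
        by (simp add: measure_restrict_space)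
      finally show ?thesis .
    qed
    then have sum2: "summable (\<lambda>k. integral\<^sup>L half_circle (\<lambda>t. norm (?u k t)))"
      by (intro summable_comparison_test[OF _ summable_mult[OF abs_summ[OF r], of pi]])
        (auto intro!: exI[of _ 0])
    have "(\<lambda>k. integral\<^sup>L half_circle (?u k)) sums
        integral\<^sup>L half_circle (\<lambda>t. \<Sum>k. ?u k t)"
      by (rule sums_integral[OF i AE_I2[OF sum1] sum2])
    moreover have "(\<lambda>k. integral\<^sup>L half_circle (?u k)) = (\<lambda>k. if k = 0 then pi * a 0 else 0)"
      by (auto simp: integral_half_circle_cos fun_eq_iff)
    ultimately have "integral\<^sup>L half_circle (\<lambda>t. \<Sum>k. ?u k t) = pi * a 0"
      using sums_single[of 0 "\<lambda>_. pi * a 0"] sums_unique2 by auto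
    moreover have eq: "(\<lambda>t. \<Sum>k. ?u k t) = (\<lambda>t. Re (F (of_real r * cis t)))"
      using Re_sums[OF r] by (simp add: sums_iff)
    ultimately show "integral\<^sup>L half_circle (\<lambda>t. Re (F (of_real r * cis t))) = pi * a 0"
      by simp
    show "(\<lambda>t. Re (F (of_real r * cis t))) \<in> borel_measurable half_circle"
      unfolding eq[symmetric] by (intro borel_measurable_suminf borel_measurable_integrable i)
  qed
  define r where "r n = 1 - 1 / real (n + 2)" for n
  have r: "0 \<le> r n" "r n < 1" for n by (auto simp: r_def field_simps)
  have r_lim: "filterlim r (at_left 1) sequentially"
  proof -
    have "r \<longlonglongrightarrow> 1" unfolding r_def by real_asymp
    moreover have "r n \<noteq> 1" for n using r(2)[of n] by simp
    ultimately show ?thesis using r by (auto simp: filterlim_at)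
  qed
  have conv: "(\<lambda>n. Re (F (of_real (r n) * cis t))) \<longlonglongrightarrow> Re (G t)" if "0 < t" "t < pi" for t
    by (intro tendsto_Re filterlim_compose[OF lim[OF that] r_lim])
  have Gm: "(\<lambda>t. Re (G t)) \<in> borel_measurable half_circle"
    by (rule borel_measurable_LIMSEQ_real[where u="\<lambda>n t. Re (F (of_real (r n) * cis t))"])
      (use conv meas[OF r] in \<open>auto simp: space_restrict_space\<close>)
  have bd: "norm (Re (F (of_real (r n) * cis t))) \<le> B t" if "0 < t" "t < pi" for n t
    using bound[OF r that] abs_Re_le_cmod order_trans by fastforce
  have ae1: "AE t in half_circle. (\<lambda>n. Re (F (of_real (r n) * cis t))) \<longlonglongrightarrow> Re (G t)"
    by (rule AE_I2) (use conv in \<open>auto simp: space_restrict_space\<close>)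
  have ae2: "AE t in half_circle. norm (Re (F (of_real (r n) * cis t))) \<le> B t" for n
    by (rule AE_I2) (use bd in \<open>auto simp: space_restrict_space\<close>)
  note dc = Gm meas[OF r] B ae1 ae2
  have "integrable half_circle (\<lambda>t. Re (G t))"
    by (rule integrable_dominated_convergence[OF dc])
  moreover have "(\<lambda>n. integral\<^sup>L half_circle (\<lambda>t. Re (F (of_real (r n) * cis t)))) \<longlonglongrightarrow>
      integral\<^sup>L half_circle (\<lambda>t. Re (G t))"
    by (rule integral_dominated_convergence[OF dc])
  ultimately show ?th1 ?th2 using int[OF r] by (auto simp: LIMSEQ_const_iff)
qed

text \<open>A complex derivative may be computed along real increments; the difference quotients are
  then real, and the reals are closed.\<close>

lemma higher_deriv_real:
  assumes F: "F holomorphic_on ball 0 R"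
    and re: "\<And>x. \<bar>x\<bar> < R \<Longrightarrow> F (of_real x) \<in> \<real>"
    and x: "\<bar>x\<bar> < R"
  shows "(deriv ^^ k) F (of_real x) \<in> \<real>"
  using x
proof (induction k arbitrary: x)
  case 0
  then show ?case using re by simp
next
  case (Suc k)
  let ?F = "(deriv ^^ k) F"
  have "?F holomorphic_on ball 0 R"
    by (rule holomorphic_higher_deriv[OF F]) auto
  then have "(?F has_field_derivative deriv ?F (of_real x)) (at (of_real x))"
    by (rule holomorphic_derivI) (use Suc.prems in auto)
  then have lim: "((\<lambda>h. (?F (of_real x + h) - ?F (of_real x)) / h) \<longlongrightarrow> deriv ?F (of_real x)) (at 0)"
    by (simp add: DERIV_def)
  have "filterlim (\<lambda>h::real. complex_of_real h) (at 0) (at 0)"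
    by (rule filterlim_atI) (auto intro!: tendsto_eq_intros eventually_at_filter[THEN iffD2])
  from filterlim_compose[OF lim this]
  have lim': "((\<lambda>h::real. (?F (of_real (x + h)) - ?F (of_real x)) / of_real h) \<longlongrightarrow> deriv ?F (of_real x)) (at 0)"
    by simp
  have "\<forall>\<^sub>F h in at (0::real). \<bar>h\<bar> < R - \<bar>x\<bar>"
    using Suc.prems by (auto simp: eventually_at intro!: exI[of _ "R - \<bar>x\<bar>"])
  then have "\<forall>\<^sub>F h in at (0::real). (?F (of_real (x + h)) - ?F (of_real x)) / of_real h \<in> \<real>"
  proof eventually_elim
    case (elim h)
    then have "\<bar>x + h\<bar> < R" by linarith
    then show ?case using Suc.IH[of x] Suc.IH[of "x + h"] Suc.prems by auto
  qed
  then have "deriv ?F (of_real x) \<in> \<real>"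
    using Lim_in_closed_set[OF closed_complex_Reals _ _ lim'] by auto
  then show ?case by simp
qed

text \<open>The coefficients are written as \<open>of_real (Re ...)\<close> to supply the real
  sequence that \<open>half_circle_mean_value\<close> expects.\<close>

lemma real_taylor:
  assumes F: "F holomorphic_on ball 0 1"
    and re: "\<And>x. \<bar>x\<bar> < 1 \<Longrightarrow> F (of_real x) \<in> \<real>"
    and z: "norm z < 1"
  shows "(\<lambda>k. of_real (Re ((deriv ^^ k) F 0 / fact k)) * z ^ k) sums F z"
proof -
  have "(deriv ^^ k) F 0 / fact k \<in> \<real>" for k
    using higher_deriv_real[OF F re, of 0 k] Reals_of_nat[of "fact k"]
    by (auto intro!: Reals_divide)
  then have "of_real (Re ((deriv ^^ k) F 0 / fact k)) = (deriv ^^ k) F 0 / fact k" for k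
    by simp
  then show ?thesis
    using holomorphic_power_series[OF F, of z] z by simp
qed

subsection \<open>The logarithm of the weight as a boundary value\<close>

text \<open>Laurent decomposition through Cauchy's formula on the circles of radius r and 1/r: the
  outer integral is analytic in z inside radius r, the inner one is analytic in 1/z. Only points of
  the unit circle are needed.\<close>

lemma annulus_split:
  fixes f :: "complex \<Rightarrow> complex"
  assumes R: "1 < R" and f: "f holomorphic_on {z. inverse R < norm z \<and> norm z < R}"
  obtains r f1 f2 where "1 < r" "f1 holomorphic_on ball 0 r" "f2 holomorphic_on ball 0 r"
    "\<And>z. norm z = 1 \<Longrightarrow> f z = f1 z + f2 (inverse z)"
proof -
  define A where "A = {z::complex. inverse R < norm z \<and> norm z < R}"
  have "A = ball 0 R - cball 0 (inverse R)" by (auto simp: A_def)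
  then have opA: "open A" by auto
  obtain r where r: "1 < r" "r < R" using dense R by blast
  define s where "s = inverse r"
  have s: "inverse R < s" "s < 1" "0 < s" "s * r = 1"
    using r by (auto simp: s_def field_simps)
  have Rr: "inverse R < 1" "inverse R > 0" using R by (auto simp: field_simps)
  define e where "e t = exp (2 * of_real pi * \<i> * of_real t)" for t :: real
  have ne: "norm (e t) = 1" for t
    by (simp add: e_def)
  have conte: "continuous_on X e" for X unfolding e_def by (intro continuous_intros)
  have contf: "continuous_on {0..1} (\<lambda>t. f (of_real q * e t))" if "inverse R < q" "q < R" for q
  proof -
    have q0: "0 < q" using that Rr by linarith
    have "continuous_on A f"
      using f holomorphic_on_imp_continuous_on by (auto simp: A_def)
    then show ?thesis
      by (rule continuous_on_compose2)
        (use that q0 in \<open>auto simp: A_def norm_mult ne intro!: continuous_intros conte\<close>)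
  qed
  define f1 where "f1 z = integral (cbox 0 1) (\<lambda>t. f (of_real r * e t) * (of_real r * e t) / (of_real r * e t - z))" for z
  \<comment> \<open>Minus the Cauchy integral over the inner circle, rewritten in u = 1/z: with w on
    that circle, - w / (w - z) = w u / (1 - w u). The factor w itself comes from dw = 2 pi i w
    dt.\<close>
  define f2 where "f2 u = integral (cbox 0 1) (\<lambda>t. f (of_real s * e t) * (of_real s * e t) * u / (1 - of_real s * e t * u))" for u
  have nz1: "of_real r * e t \<noteq> z" if "norm z < r" for z t
    using that r by (auto simp: norm_mult ne)
  have nz2: "of_real s * e t * z \<noteq> 1" if "norm z < r" for z t
  proof
    assume "of_real s * e t * z = 1"
    then have "norm (of_real s * e t * z) = 1" by simp
    then have "s * norm z = 1" using s by (simp add: norm_mult ne)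
    moreover have "s * norm z < s * r" using s that by (intro mult_strict_left_mono)
    ultimately show False using s by linarith
  qed
  have h1: "f1 holomorphic_on ball 0 r"
    unfolding f1_def
  proof (rule leibniz_rule_holomorphic[where fx="\<lambda>z t. f (of_real r * e t) * (of_real r * e t) / (of_real r * e t - z)^2"])
    fix x t assume "x \<in> ball (0::complex) r"
    then show "((\<lambda>x. f (of_real r * e t) * (of_real r * e t) / (of_real r * e t - x)) has_field_derivative
        f (of_real r * e t) * (of_real r * e t) / (of_real r * e t - x)\<^sup>2) (at x within ball 0 r)"
      using nz1[of x t] by (auto intro!: derivative_eq_intros simp: power2_eq_square)
  next
    fix x assume "x \<in> ball (0::complex) r"
    then show "(\<lambda>t. f (of_real r * e t) * (of_real r * e t) / (of_real r * e t - x)) integrable_on cbox 0 1"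
      using nz1[of x] r Rr by (intro integrable_continuous continuous_intros) (auto intro!: contf conte)
  next
    have "continuous_on (ball 0 r \<times> cbox 0 1) (\<lambda>p. f (of_real r * e (snd p)))"
      using contf[of r] r Rr by (auto intro!: continuous_on_compose2[OF contf[of r]] continuous_intros)
    moreover have "continuous_on (ball 0 r \<times> cbox 0 1) (\<lambda>p::complex \<times> real. e (snd p))"
      by (auto intro!: continuous_on_compose2[OF conte] continuous_intros)
    ultimately show "continuous_on (ball 0 r \<times> cbox 0 1)
        (\<lambda>(x, t). f (of_real r * e t) * (of_real r * e t) / (of_real r * e t - x)\<^sup>2)"
      unfolding case_prod_beta using nz1 by (intro continuous_intros) auto
  qed auto
  have h2: "f2 holomorphic_on ball 0 r"
    unfolding f2_def
  proof (rule leibniz_rule_holomorphic[where fx="\<lambda>u t. f (of_real s * e t) * (of_real s * e t) / (1 - of_real s * e t * u)^2"])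
    fix x t assume "x \<in> ball (0::complex) r"
    then show "((\<lambda>u. f (of_real s * e t) * (of_real s * e t) * u / (1 - of_real s * e t * u)) has_field_derivative
        f (of_real s * e t) * (of_real s * e t) / (1 - of_real s * e t * x)\<^sup>2) (at x within ball 0 r)"
      using nz2[of x t] by (auto intro!: derivative_eq_intros simp: power2_eq_square field_simps)
  next
    fix x assume "x \<in> ball (0::complex) r"
    then show "(\<lambda>t. f (of_real s * e t) * (of_real s * e t) * x / (1 - of_real s * e t * x)) integrable_on cbox 0 1"
      using nz2[of x] s r by (intro integrable_continuous continuous_intros) (auto intro!: contf conte)
  next
    have "continuous_on (ball 0 r \<times> cbox 0 1) (\<lambda>p. f (of_real s * e (snd p)))"
      using contf[of s] r s by (auto intro!: continuous_on_compose2[OF contf[of s]] continuous_intros)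
    moreover have "continuous_on (ball 0 r \<times> cbox 0 1) (\<lambda>p::complex \<times> real. e (snd p))"
      by (auto intro!: continuous_on_compose2[OF conte] continuous_intros)
    ultimately show "continuous_on (ball 0 r \<times> cbox 0 1)
        (\<lambda>(u, t). f (of_real s * e t) * (of_real s * e t) / (1 - of_real s * e t * u)\<^sup>2)"
      unfolding case_prod_beta using nz2 by (intro continuous_intros) auto
  qed auto
  have ci: "contour_integral (circlepath 0 q) g = 2 * pi * \<i> * integral {0..1} (\<lambda>t. g (of_real q * e t) * (of_real q * e t))"
    for q g
  proof -
    have "contour_integral (circlepath 0 q) g = integral {0..1} (\<lambda>t. (2 * pi * \<i>) * (g (of_real q * e t) * (of_real q * e t)))"
      unfolding contour_integral_integral vector_derivative_circlepath
      by (simp add: circlepath e_def mult_ac)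
    then show ?thesis by simp
  qed
  have eq: "f z = f1 z + f2 (inverse z)" if z: "norm z = 1" for z
  proof -
    \<comment> \<open>The difference quotient has a removable singularity at z, so its integrals
      over the two homotopic circles agree. Splitting it there leaves f(z) times the integral of
      1/(w - z), which is 2 pi i on the outer circle and 0 on the inner one.\<close>
    define g where "g = (\<lambda>w. if w = z then deriv f z else (f w - f z) / (w - z))"
    have zA: "z \<in> A" using z R Rr by (auto simp: A_def)
    have "g holomorphic_on A"
      unfolding g_def by (rule pole_lemma) (use f zA opA in \<open>auto simp: A_def interior_open\<close>)
    moreover have "homotopic_loops A (circlepath 0 r) (circlepath 0 s)"
    proof (rule homotopic_loops_linear)
      fix t :: real
      show "closed_segment (circlepath 0 r t) (circlepath 0 s t) \<subseteq> A"
      proof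
        fix x assume "x \<in> closed_segment (circlepath 0 r t) (circlepath 0 s t)"
        then obtain u where u: "0 \<le> u" "u \<le> 1" "x = (1 - u) *\<^sub>R (of_real r * e t) + u *\<^sub>R (of_real s * e t)"
          by (auto simp: closed_segment_def circlepath e_def)
        then have "x = of_real ((1 - u) * r + u * s) * e t"
          by (simp add: scaleR_conv_of_real algebra_simps)
        then have "norm x = \<bar>(1 - u) * r + u * s\<bar>"
          by (simp only: norm_mult ne norm_of_real mult_1_right)
        moreover have "(1 - u) * r + u * s \<le> r"
          using convex_bound_le[of r r s "1-u" u] u r s by auto
        moreover have "(1 - u) * r + u * s \<ge> s"
          using convex_bound_le[of "-r" "-s" "-s" "1-u" u] u r s by auto
        ultimately show "x \<in> A" using r s by (auto simp: A_def)
      qed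
    qed auto
    ultimately have cg: "contour_integral (circlepath 0 r) g = contour_integral (circlepath 0 s) g"
      by (intro Cauchy_theorem_homotopic_loops[of A]) (use opA in auto)
    have split: "contour_integral (circlepath 0 q) g =
       contour_integral (circlepath 0 q) (\<lambda>w. f w / (w - z)) - f z * contour_integral (circlepath 0 q) (\<lambda>w. 1 / (w - z))"
      if q: "inverse R < q" "q < R" "q \<noteq> 1" for q
    proof -
      have q0: "q > 0" using q Rr by linarith
      have sph: "path_image (circlepath 0 q) = sphere 0 q" using q0 by simp
      have nz: "w \<noteq> z" if "w \<in> sphere 0 q" for w using that q z by auto
      have "continuous_on (sphere 0 q) f"
        using f q by (auto simp: intro!: holomorphic_on_imp_continuous_on elim!: holomorphic_on_subset)
      then have c1: "(\<lambda>w. f w / (w - z)) contour_integrable_on circlepath 0 q"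
        by (intro contour_integrable_continuous_circlepath) (use nz q0 sph in \<open>auto intro!: continuous_intros\<close>)
      have c2: "(\<lambda>w. 1 / (w - z)) contour_integrable_on circlepath 0 q"
        by (intro contour_integrable_continuous_circlepath) (use nz q0 sph in \<open>auto intro!: continuous_intros\<close>)
      have "contour_integral (circlepath 0 q) g = contour_integral (circlepath 0 q) (\<lambda>w. f w / (w - z) - f z * (1 / (w - z)))"
        by (rule contour_integral_eq) (use nz[of z] q0 sph in \<open>auto simp: g_def diff_divide_distrib\<close>)
      also have "\<dots> = contour_integral (circlepath 0 q) (\<lambda>w. f w / (w - z)) - contour_integral (circlepath 0 q) (\<lambda>w. f z * (1 / (w - z)))"
        by (rule contour_integral_diff[OF c1 contour_integrable_lmul[OF c2]])
      also have "contour_integral (circlepath 0 q) (\<lambda>w. f z * (1 / (w - z))) = f z * contour_integral (circlepath 0 q) (\<lambda>w. 1 / (w - z))"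
        by (rule contour_integral_lmul[OF c2])
      finally show ?thesis .
    qed
    have o1: "contour_integral (circlepath 0 r) (\<lambda>w. 1 / (w - z)) = 2 * pi * \<i>"
      using Cauchy_integral_circlepath_simple[of "\<lambda>_. 1" 0 r z] z r
      by (intro contour_integral_unique) auto
    have o2: "contour_integral (circlepath 0 s) (\<lambda>w. 1 / (w - z)) = 0"
    proof (rule contour_integral_unique, rule Cauchy_theorem_disc_simple)
      show "(\<lambda>w. 1 / (w - z)) holomorphic_on ball 0 1"
        using z by (auto intro!: holomorphic_intros)
    qed (use s in auto)
    have "2 * pi * \<i> * f z = contour_integral (circlepath 0 r) (\<lambda>w. f w / (w - z)) - contour_integral (circlepath 0 s) (\<lambda>w. f w / (w - z))"
      using cg split[of r] split[of s] o1 o2 r s Rr by (simp add: algebra_simps)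
    also have "contour_integral (circlepath 0 r) (\<lambda>w. f w / (w - z)) = 2 * pi * \<i> * f1 z"
      unfolding ci f1_def by (simp add: algebra_simps)
    also have "contour_integral (circlepath 0 s) (\<lambda>w. f w / (w - z)) = - (2 * pi * \<i> * f2 (inverse z))"
    proof -
      have z0: "z \<noteq> 0" using z by auto
      have "f (of_real s * e t) / (of_real s * e t - z) * (of_real s * e t) =
          - (f (of_real s * e t) * (of_real s * e t) * inverse z / (1 - of_real s * e t * inverse z))" for t
      proof -
        have "of_real s * e t \<noteq> z" using z s by (auto simp: norm_mult ne)
        moreover have "1 - of_real s * e t * inverse z = (z - of_real s * e t) / z"
          using z0 by (simp add: field_simps)
        ultimately show ?thesis using z0 by (simp add: divide_simps) (simp add: algebra_simps)
      qed
      then show ?thesis unfolding ci f2_def by simp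
    qed
    finally have "2 * pi * \<i> * f z = 2 * pi * \<i> * (f1 z + f2 (inverse z))"
      by (simp add: algebra_simps)
    then show ?thesis by simp
  qed
  show thesis by (rule that[OF r(1) h1 h2 eq])
qed

text \<open>On the unit circle cos t is the Joukowski map (z + 1/z)/2, so ln h(cos t) extends
  analytically to an annulus. Keeping a symmetrised analytic half of its Laurent series gives
  \<open>L\<close>, and |exp L|^2 = h(cos t) on the circle; the conjugation symmetry makes the
  Taylor coefficients of \<open>L\<close> real.\<close>

lemma szego_logarithm:
  assumes h: "analytic_near_interval h" and pos: "\<forall>t\<in>{-1..1}. h t > 0"
  obtains R L where "1 < R" "L holomorphic_on ball 0 R" "\<And>z. L (cnj z) = cnj (L z)"
    "\<And>t. 2 * Re (L (cis t)) = ln (h (cos t))"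
proof -
  obtain U H where U: "open U" "complex_of_real ` {-1..1} \<subseteq> U" and H: "H holomorphic_on U"
    and Hh: "\<And>t. t \<in> {-1..1} \<Longrightarrow> H (of_real t) = of_real (h t)"
    using h unfolding analytic_near_interval_def by auto
  \<comment> \<open>Shrinking to positive real part puts the values of \<open>H\<close> in the
    domain of the principal logarithm.\<close>
  define V where "V = U \<inter> H -` {z. Re z > 0}"
  have opV: "open V"
    unfolding V_def using H U(1)
    by (intro continuous_open_preimage holomorphic_on_imp_continuous_on open_halfspace_Re_gt)
  have V: "complex_of_real ` {-1..1} \<subseteq> V" using U Hh pos by (auto simp: V_def)
  define J where "J z = (z + inverse z) / 2" for z :: complex
  have Jcis: "J (cis t) = of_real (cos t)" for t
    by (simp add: J_def complex_eq_iff)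
  have contJ: "continuous_on (UNIV - {0}) J"
    unfolding J_def by (intro continuous_intros) auto
  define W where "W = (UNIV - {0}) \<inter> J -` V"
  have opW: "open W" unfolding W_def
    by (rule continuous_open_preimage[OF contJ _ opV]) auto
  have "sphere 0 1 \<subseteq> W"
  proof
    fix z :: complex assume "z \<in> sphere 0 1"
    then obtain t where "z = cis t"
      using complex_norm_eq_1_exp[of z] that[of "Arg2pi z"] by (auto simp: cis_conv_exp)
    then show "z \<in> W" using Jcis[of t] V by (auto simp: W_def)
  qed
  then obtain e where e: "e > 0" "(\<Union>x\<in>sphere 0 1. ball x e) \<subseteq> W"
    using compact_subset_open_imp_ball_epsilon_subset[OF _ opW] by (metis compact_sphere)
  \<comment> \<open>The radial projection z/|z| lies at distance | |z| - 1 | from z, so the annulus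
    between 1/R0 and R0 stays within e of the unit circle: for |z| < 1 the bound |z| (1 + e) > 1
    gives 1 - |z| < |z| e < e.\<close>
  define R0 where "R0 = 1 + e"
  have R0: "1 < R0" using e by (simp add: R0_def)
  have sub: "{z. inverse R0 < norm z \<and> norm z < R0} \<subseteq> W"
  proof
    fix z :: complex assume z: "z \<in> {z. inverse R0 < norm z \<and> norm z < R0}"
    have "inverse R0 > 0" using R0 by simp
    then have z0: "norm z > 0"
      using z \<open>inverse R0 > 0\<close> less_trans by blast
    have "1 < norm z * R0" using z R0 by (simp add: field_simps)
    then have "1 - norm z < norm z * e" by (simp add: R0_def algebra_simps)
    have "1 - norm z < e"
    proof (cases "norm z \<le> 1")
      case True
      then have "norm z * e \<le> 1 * e" using e by (intro mult_right_mono) auto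
      then show ?thesis using \<open>1 - norm z < norm z * e\<close> by simp
    qed (use e in auto)
    then have "\<bar>norm z - 1\<bar> < e" using z by (auto simp: R0_def)
    moreover have "dist (z / of_real (norm z)) z = \<bar>norm z - 1\<bar>"
    proof -
      have "z / of_real (norm z) - z = (z / of_real (norm z)) * of_real (1 - norm z)"
        using z0 by (simp add: field_simps)
      then have "dist (z / of_real (norm z)) z = norm (z / of_real (norm z)) * \<bar>1 - norm z\<bar>"
        by (simp only: dist_norm norm_mult norm_of_real)
      then show ?thesis using z0 by (simp add: norm_divide)
    qed
    moreover have "z / of_real (norm z) \<in> sphere 0 1" using z0 by (simp add: norm_divide)
    ultimately show "z \<in> W" using e(2) by (force simp: dist_commute)
  qed
  define l where "l z = Ln (H (J z))" for z
  have "l holomorphic_on W"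
  proof -
    have 1: "J holomorphic_on W" unfolding J_def W_def by (intro holomorphic_intros) auto
    have 2: "(\<lambda>z. H (J z)) holomorphic_on W"
    proof -
      have "H holomorphic_on V" using H by (rule holomorphic_on_subset) (auto simp: V_def)
      then show ?thesis
        using holomorphic_on_compose_gen[OF 1, of H V] by (auto simp: o_def W_def)
    qed
    show ?thesis unfolding l_def
      by (intro holomorphic_on_Ln' 2) (auto simp: W_def V_def complex_nonpos_Reals_iff)
  qed
  then have "l holomorphic_on {z. inverse R0 < norm z \<and> norm z < R0}"
    using sub holomorphic_on_subset by blast
  from annulus_split[OF R0 this] obtain R f1 f2 where
    R: "1 < R" and f: "f1 holomorphic_on ball 0 R" "f2 holomorphic_on ball 0 R"
    and l: "\<And>z. norm z = 1 \<Longrightarrow> l z = f1 z + f2 (inverse z)" by blast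
  \<comment> \<open>Since ln h(cos t) is even, l(z) may be averaged with l(1/z); this replaces the
    two Laurent halves by one function \<open>M\<close> with M(z) + M(1/z) = l(z) on the circle.
    \<open>L\<close> then averages \<open>M\<close> with its reflection to become real on the real
    axis.\<close>
  define M where "M z = f1 z / 2 + f2 z / 2" for z
  define L where "L z = (M z + (cnj \<circ> M \<circ> cnj) z) / 2" for z
  have M: "M holomorphic_on ball 0 R" unfolding M_def using f by (intro holomorphic_intros) auto
  have "cnj ` ball 0 R = ball 0 R"
  proof -
    have "z \<in> cnj ` ball 0 R" if "z \<in> ball 0 R" for z
      using that by (intro image_eqI[of _ _ "cnj z"]) auto
    then show ?thesis by auto
  qed
  then have "L holomorphic_on ball 0 R"
    unfolding L_def by (intro holomorphic_intros M holomorphic_on_compose_cnj_cnj) (auto simp: M)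
  moreover have "L (cnj z) = cnj (L z)" for z
    by (simp add: L_def add.commute)
  moreover have "2 * Re (L (cis t)) = ln (h (cos t))" for t
  proof -
    have lr: "l (cis u) = of_real (ln (h (cos u)))" for u
      using pos by (simp add: l_def Jcis Hh Ln_of_real)
    have "l (cis t) + l (cis (-t)) = 2 * (M (cis t) + M (cis (-t)))"
      using l[of "cis t"] l[of "cis (-t)"] by (simp add: M_def add_divide_distrib)
    then have "M (cis t) + M (cis (-t)) = of_real (ln (h (cos t)))"
    proof -
      have "2 * (M (cis t) + M (cis (-t))) = 2 * of_real (ln (h (cos t)))"
        using lr[of t] lr[of "-t"] \<open>l (cis t) + _ = _\<close> by simp
      then show ?thesis by (metis mult_left_cancel zero_neq_numeral)
    qed
    then have "Re (M (cis t)) + Re (M (cis (-t))) = ln (h (cos t))"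
      by (metis Re_complex_of_real plus_complex.sel(1))
    then show ?thesis by (simp add: L_def cis_cnj)
  qed
  ultimately show thesis using that R by blast
qed

subsection \<open>The phase as a principal value integral\<close>

text \<open>The left side is w^2 - 2 w cos \<theta> + 1 at w = e^(it), that is w (w + 1/w - 2 cos
  \<theta>).\<close>

lemma cis_diff_product:
  "(cis t - cis \<theta>) * (cis t - cnj (cis \<theta>)) = 2 * cis t * of_real (cos t - cos \<theta>)"
proof -
  have "(cos t - cos \<theta>) * (cos t - cos \<theta>) - (sin t - sin \<theta>) * (sin t + sin \<theta>) = 2 * cos t * (cos t - cos \<theta>)"
    using sin_cos_squared_add[of t] sin_cos_squared_add[of \<theta>] by algebra
  moreover have "(cos t - cos \<theta>) * (sin t + sin \<theta>) + (sin t - sin \<theta>) * (cos t - cos \<theta>) = 2 * sin t * (cos t - cos \<theta>)"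
    by algebra
  ultimately show ?thesis
    by (simp only: complex_eq_iff minus_complex.sel times_complex.sel cis.sel cis_cnj cos_minus sin_minus
        Re_complex_of_real Im_complex_of_real complex_Re_numeral complex_Im_numeral mult_zero_left mult_zero_right diff_0_right add_0_right add_0_left) simp
qed

lemma cos_image_half_circle: "cos ` {0<..<pi} = {-1<..<1}"
proof -
  have "t \<in> cos ` {0<..<pi}" if "-1 < t" "t < 1" for t :: real
    using that arccos_lt_bounded[of t] by (intro image_eqI[of _ _ "arccos t"]) auto
  moreover have "-1 < cos t \<and> cos t < 1" if "0 < t" "t < pi" for t
    using that cos_monotone_0_pi[of 0 t] cos_monotone_0_pi[of t pi] by auto
  ultimately show ?thesis by auto
qed

text \<open>Subtract from \<open>L\<close> the real affine function that interpolates it at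
  e^(i\<theta>) and its conjugate. The rest \<open>B\<close> is divisible by (w - z0)(w - cnj z0),
  and F = 2 w B / ((w - z0)(w - cnj z0)) is analytic, real on the real axis and 0 at 0, so Re F has
  mean 0. On the circle Re F is \<open>u\<close> minus the slope \<open>A1\<close>, which therefore
  is the mean of \<open>u\<close>.\<close>

lemma conjugate_function_integral:
  assumes R: "1 < R" and L: "L holomorphic_on ball 0 R" and cnj: "\<And>z. L (cnj z) = cnj (L z)"
    and th: "0 < \<theta>" "\<theta> < pi"
  defines "u \<equiv> (\<lambda>t. (Re (L (cis t)) - Re (L (cis \<theta>))) / (cos t - cos \<theta>))"
  shows "u absolutely_integrable_on {0<..<pi}" (is ?th1)
    and "integral {0<..<pi} u = pi * Im (L (cis \<theta>)) / sin \<theta>" (is ?th2)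
proof -
  define z0 where "z0 = cis \<theta>"
  have sin: "sin \<theta> > 0" using th by (rule sin_gt_zero)
  have z0: "norm z0 = 1" "z0 \<noteq> cnj z0" using sin by (auto simp: z0_def complex_eq_iff)
  \<comment> \<open>The imaginary part at \<open>z0\<close> determines the slope and the real part
    the constant. The zero of \<open>B\<close> at \<open>cnj z0\<close> then comes from the symmetry
    of \<open>L\<close>.\<close>
  define A1 where "A1 = Im (L z0) / sin \<theta>"
  define A0 where "A0 = Re (L z0) - A1 * cos \<theta>"
  define B where "B w = L w - (of_real A0 + of_real A1 * w)" for w
  have B: "B holomorphic_on ball 0 R" unfolding B_def by (intro holomorphic_intros L)
  have B0: "B z0 = 0" using sin by (simp add: B_def A0_def A1_def z0_def complex_eq_iff)
  then have B0': "B (cnj z0) = 0"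
    by (simp add: B_def cnj complex_eq_iff)
  define g1 where "g1 = (\<lambda>w. if w = z0 then deriv B z0 else (B w - B z0) / (w - z0))"
  define g2 where "g2 = (\<lambda>w. if w = cnj z0 then deriv g1 (cnj z0) else (g1 w - g1 (cnj z0)) / (w - cnj z0))"
  have g1: "g1 holomorphic_on ball 0 R"
    unfolding g1_def by (rule pole_lemma[OF B]) (use z0 R in \<open>auto simp: interior_open\<close>)
  have g2: "g2 holomorphic_on ball 0 R"
    unfolding g2_def by (rule pole_lemma[OF g1]) (use z0 R in \<open>auto simp: interior_open\<close>)
  define F where "F w = 2 * w * g2 w" for w
  have F: "F holomorphic_on ball 0 R" unfolding F_def by (intro holomorphic_intros g2)
  have Feq: "F w = 2 * w * B w / ((w - z0) * (w - cnj z0))" if "w \<noteq> z0" "w \<noteq> cnj z0" for w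
    using that z0 by (simp add: F_def g2_def g1_def B0 B0' mult_ac)
  have Fre: "F (of_real x) \<in> \<real>" if "\<bar>x\<bar> < 1" for x
  proof -
    have ne: "of_real x \<noteq> z0" "of_real x \<noteq> cnj z0" using sin by (auto simp: z0_def complex_eq_iff)
    have "L (of_real x) = cnj (L (of_real x))" using cnj[of "of_real x"] by simp
    then have "L (of_real x) \<in> \<real>" by (metis Reals_cnj_iff)
    then have "2 * of_real x * B (of_real x) \<in> \<real>" unfolding B_def by (intro Reals_mult Reals_diff Reals_add) auto
    moreover have "(of_real x - z0) * (of_real x - cnj z0) = of_real ((norm (of_real x - z0))\<^sup>2)"
      by (metis complex_norm_square complex_cnj_complex_of_real complex_cnj_diff)
    ultimately show ?thesis unfolding Feq[OF ne] by (metis Reals_divide Reals_of_real)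
  qed
  have contF: "continuous_on (cball 0 1) F"
    using F R by (auto intro!: holomorphic_on_imp_continuous_on elim!: holomorphic_on_subset)
  obtain K where K: "\<And>w. w \<in> cball 0 1 \<Longrightarrow> norm (F w) \<le> K"
    using compact_imp_bounded[OF compact_continuous_image[OF contF compact_cball]] unfolding bounded_iff by (metis image_eqI)
  have F1: "F holomorphic_on ball 0 1" by (rule holomorphic_on_subset[OF F]) (use R in auto)
  have lim: "((\<lambda>r. F (of_real r * cis t)) \<longlongrightarrow> F (cis t)) (at_left 1)" for t
  proof -
    have "isCont F (cis t)"
      using F R by (intro continuous_on_interior[OF holomorphic_on_imp_continuous_on[OF F]]) (auto simp: interior_open)
    moreover have "((\<lambda>r. of_real r * cis t) \<longlongrightarrow> cis t) (at_left 1)"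
      by (auto intro!: tendsto_eq_intros)
    ultimately show ?thesis by (rule isCont_tendsto_compose)
  qed
  have "integrable half_circle (\<lambda>t. Re (F (cis t)))" 
    and "integral\<^sup>L half_circle (\<lambda>t. Re (F (cis t))) = pi * Re ((deriv ^^ 0) F 0 / fact 0)"
    by (rule half_circle_mean_value[OF real_taylor[OF F1 Fre], of "\<lambda>_. K" "\<lambda>t. F (cis t)"];
      use K lim in \<open>force simp: norm_mult\<close>)+
  then have FI: "(\<lambda>t. Re (F (cis t))) absolutely_integrable_on {0<..<pi}"
    "integral {0<..<pi} (\<lambda>t. Re (F (cis t))) = 0"
    by (auto simp: integrable_restrict_space set_integrable_def lebesgue_integral_eq_integral F_def)
  have ueq: "u t = Re (F (cis t)) + A1" if t: "t \<in> {0<..<pi} - {\<theta>}" for t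
  proof -
    have "cos t \<noteq> cos \<theta>" using t th cos_inj_pi[of t \<theta>] by auto
    then have cne: "cos t - cos \<theta> \<noteq> 0" by simp
    have st: "sin t > 0" using t by (auto intro: sin_gt_zero)
    have ne: "cis t \<noteq> z0" "cis t \<noteq> cnj z0" using cne by (auto simp: z0_def complex_eq_iff)
    have "(cis t - z0) * (cis t - cnj z0) = 2 * cis t * of_real (cos t - cos \<theta>)"
      unfolding z0_def by (rule cis_diff_product)
    then have "F (cis t) = (2 * cis t) * B (cis t) / ((2 * cis t) * of_real (cos t - cos \<theta>))"
      using Feq[OF ne] by simp
    also have "\<dots> = B (cis t) / of_real (cos t - cos \<theta>)"
      by (rule nonzero_mult_divide_mult_cancel_left) auto
    finally have "Re (F (cis t)) = Re (B (cis t)) / (cos t - cos \<theta>)"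
      by (simp add: Re_divide_of_real del: of_real_diff)
    also have "Re (B (cis t)) = Re (L (cis t)) - Re (L z0) - A1 * (cos t - cos \<theta>)"
      by (simp add: B_def A0_def algebra_simps)
    finally show ?thesis using cne by (simp add: u_def z0_def divide_simps) (simp add: algebra_simps)
  qed
  have i1: "(\<lambda>t. Re (F (cis t)) + A1) absolutely_integrable_on {0<..<pi}"
    by (intro set_integral_add FI) (auto simp: absolutely_integrable_on_const)
  show ?th1
    by (rule absolutely_integrable_spike[OF i1, of "{\<theta>}"]) (use ueq in auto)
  have "integral {0<..<pi} u = integral {0<..<pi} (\<lambda>t. Re (F (cis t)) + A1)"
    by (rule integral_spike[of "{\<theta>}"]) (use ueq in auto)
  also have "\<dots> = integral {0<..<pi} (\<lambda>t. Re (F (cis t))) + integral {0<..<pi} (\<lambda>t. A1)"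
    by (intro integral_add set_lebesgue_integral_eq_integral(1)[OF FI(1)] integrable_on_const) auto
  also have "integral {0<..<pi} (\<lambda>t. A1) = pi * A1"
    by (simp flip: integral_open_interval_real)
  finally show ?th2 using FI by (simp add: A1_def z0_def)
qed

text \<open>The logarithmic antiderivative vanishes at both end points \<open>\<plusminus>1\<close>, so the two halves of the
  principal value cancel in the limit.\<close>

lemma pv_arcsine_kernel:
  fixes x :: real
  assumes x: "-1 < x" "x < 1"
  defines "k \<equiv> (\<lambda>t. 1 / sqrt (1 - t\<^sup>2) / (t - x))"
  defines "N \<equiv> (\<lambda>t. ln (1 - x * t + sqrt (1 - x\<^sup>2) * sqrt (1 - t\<^sup>2)))"
  shows "\<And>\<epsilon>. 0 < \<epsilon> \<Longrightarrow> \<epsilon> < 1 + x \<Longrightarrow> (k has_integral (ln \<epsilon> - N (x - \<epsilon>)) / sqrt (1 - x\<^sup>2)) {-1..x - \<epsilon>}"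
    and "\<And>\<epsilon>. 0 < \<epsilon> \<Longrightarrow> \<epsilon> < 1 - x \<Longrightarrow> (k has_integral (N (x + \<epsilon>) - ln \<epsilon>) / sqrt (1 - x\<^sup>2)) {x + \<epsilon>..1}"
proof -
  define s where "s = sqrt (1 - x\<^sup>2)"
  have x2: "x\<^sup>2 < 1" using x by (simp add: abs_square_less_1 abs_less_iff)
  have s: "s > 0" "s\<^sup>2 = 1 - x\<^sup>2" using x2 by (auto simp: s_def)
  have pos: "1 - x * t + s * sqrt (1 - t\<^sup>2) > 0" if "\<bar>t\<bar> \<le> 1" for t
  proof -
    have "\<bar>x * t\<bar> \<le> \<bar>x\<bar>" using that by (simp add: abs_mult mult_left_le)
    then have "x * t < 1" using x by linarith
    moreover have "t\<^sup>2 \<le> 1" using that by (simp add: abs_square_le_1)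
    ultimately show ?thesis using s by (smt (verit) mult_nonneg_nonneg real_sqrt_ge_zero)
  qed
  \<comment> \<open>With t = cos u and x = cos \<theta> the logarithm in \<open>N\<close> is taken
    of 1 - cos (u + \<theta>), so ln |t - x| - N(t) is ln |sin ((u - \<theta>)/2) / sin ((u +
    \<theta>)/2)|, the classical antiderivative for 1 / (cos u - cos \<theta>) up to the factor
    \<open>s\<close>.\<close>
  have key: "1 / (t - x) - (- x + s * (- t / sqrt (1 - t\<^sup>2))) / (1 - x * t + s * sqrt (1 - t\<^sup>2)) = s * k t"
    if t: "\<bar>t\<bar> < 1" "t \<noteq> x" for t
  proof -
    define q where "q = sqrt (1 - t\<^sup>2)"
    have "t\<^sup>2 < 1" using t by (simp add: abs_square_less_1)
    then have q: "q > 0" "q\<^sup>2 = 1 - t\<^sup>2" by (auto simp: q_def)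
    define n where "n = 1 - x * t + s * q"
    have n: "n > 0" using pos[of t] t by (simp add: n_def q_def)
    have "n * q - (- x * q - s * t) * (t - x) = s * n"
      unfolding n_def using s(2) q(2) by algebra
    then have "1 / (t - x) - (- x + s * (- t / q)) / n = s * (1 / q / (t - x))"
      using t n q by (simp add: field_simps)
    then show ?thesis by (simp add: k_def n_def q_def)
  qed
  have N: "N = (\<lambda>t. ln (1 - x * t + s * sqrt (1 - t\<^sup>2)))" by (simp add: N_def s_def)
  have contN: "continuous_on {-1..1} N"
    unfolding N using pos by (intro continuous_intros) (auto simp: abs_le_iff less_imp_neq[symmetric])
  have N1: "N 1 = ln (1 - x)" "N (-1) = ln (1 + x)" by (simp_all add: N)
  have dN: "(N has_real_derivative (- x + s * (- t / sqrt (1 - t\<^sup>2))) / (1 - x * t + s * sqrt (1 - t\<^sup>2))) (at t)"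
    if t: "\<bar>t\<bar> < 1" for t
  proof -
    have "t\<^sup>2 < 1" using t by (simp add: abs_square_less_1)
    then show ?thesis unfolding N using pos[of t] t
      by (auto intro!: derivative_eq_intros simp: divide_simps)
  qed
  { fix \<epsilon> assume e: "0 < \<epsilon>" "\<epsilon> < 1 + x"
    have "((\<lambda>t. s * k t) has_integral (ln (x - (x - \<epsilon>)) - N (x - \<epsilon>)) - (ln (x - (-1)) - N (-1))) {-1..x - \<epsilon>}"
    proof (rule fundamental_theorem_of_calculus_interior)
      show "continuous_on {- 1..x - \<epsilon>} (\<lambda>t. ln (x - t) - N t)"
        using e x by (intro continuous_intros continuous_on_subset[OF contN]) auto
      fix t assume t: "t \<in> {-1<..<x-\<epsilon>}"
      have "((\<lambda>t. ln (x - t) - N t) has_real_derivative s * k t) (at t)"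
        using t e x by (auto intro!: derivative_eq_intros dN simp flip: key) (simp add: divide_simps)
      then show "((\<lambda>t. ln (x - t) - N t) has_vector_derivative s * k t) (at t)"
        by (simp add: has_real_derivative_iff_has_vector_derivative)
    qed (use e in auto)
    then have "((\<lambda>t. s * k t) has_integral (ln \<epsilon> - N (x - \<epsilon>))) {-1..x - \<epsilon>}" by (simp add: N1 add.commute)
    from has_integral_mult_right[OF this, of "1/s"] s
    show "(k has_integral (ln \<epsilon> - N (x - \<epsilon>)) / sqrt (1 - x\<^sup>2)) {-1..x - \<epsilon>}"
      by (simp add: s_def) }
  { fix \<epsilon> assume e: "0 < \<epsilon>" "\<epsilon> < 1 - x"
    have "((\<lambda>t. s * k t) has_integral (ln (1 - x) - N 1) - (ln (x + \<epsilon> - x) - N (x + \<epsilon>))) {x + \<epsilon>..1}"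
    proof (rule fundamental_theorem_of_calculus_interior)
      show "continuous_on {x + \<epsilon>..1} (\<lambda>t. ln (t - x) - N t)"
        using e x by (intro continuous_intros continuous_on_subset[OF contN]) auto
      fix t assume t: "t \<in> {x+\<epsilon><..<1}"
      have "((\<lambda>t. ln (t - x) - N t) has_real_derivative s * k t) (at t)"
        using t e x by (auto intro!: derivative_eq_intros dN simp flip: key)
      then show "((\<lambda>t. ln (t - x) - N t) has_vector_derivative s * k t) (at t)"
        by (simp add: has_real_derivative_iff_has_vector_derivative)
    qed (use e in auto)
    then have "((\<lambda>t. s * k t) has_integral (N (x + \<epsilon>) - ln \<epsilon>)) {x + \<epsilon>..1}" by (simp add: N1 )
    from has_integral_mult_right[OF this, of "1/s"] s
    show "(k has_integral (N (x + \<epsilon>) - ln \<epsilon>) / sqrt (1 - x\<^sup>2)) {x + \<epsilon>..1}"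
      by (simp add: s_def) }
qed

text \<open>Write ln h(t) as ln h(x) plus a difference. After division by t - x the difference is
  absolutely integrable, and the substitution t = cos u reduces it to
  \<open>conjugate_function_integral\<close>; the constant ln h(x) meets the arcsine kernel, whose
  principal value is 0.\<close>

lemma phase_pv_integral:
  assumes R: "1 < R" and L: "L holomorphic_on ball 0 R" and cnj: "\<And>z. L (cnj z) = cnj (L z)"
    and Lh: "\<And>t. 2 * Re (L (cis t)) = ln (h (cos t))"
    and th: "0 < \<theta>" "\<theta> < pi"
  shows "pv_integral (\<lambda>t. ln (h t) / sqrt (1 - t\<^sup>2) / (t - cos \<theta>)) (cos \<theta>) = 2 * pi * Im (L (cis \<theta>)) / sin \<theta>"
proof -
  define x where "x = cos \<theta>"
  have sin: "sin \<theta> > 0" using th by (rule sin_gt_zero)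
  have x: "-1 < x" "x < 1" using th cos_monotone_0_pi[of 0 \<theta>] cos_monotone_0_pi[of \<theta> pi] by (auto simp: x_def)
  define f where "f t = ln (h t) / sqrt (1 - t\<^sup>2) / (t - x)" for t
  define k where "k t = 1 / sqrt (1 - t\<^sup>2) / (t - x)" for t
  define u where "u t = (ln (h t) - ln (h x)) / (t - x) / sqrt (1 - t\<^sup>2)" for t
  define I where "I = 2 * pi * Im (L (cis \<theta>)) / sin \<theta>"
  define v where "v t = (Re (L (cis t)) - Re (L (cis \<theta>))) / (cos t - cos \<theta>)" for t
  have v: "v absolutely_integrable_on {0<..<pi}" "integral {0<..<pi} v = pi * Im (L (cis \<theta>)) / sin \<theta>"
    unfolding v_def using conjugate_function_integral[OF R L cnj th] by auto
  have uv: "\<bar>- sin t\<bar> * u (cos t) = 2 * v t" if "t \<in> {0<..<pi}" for t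
  proof -
    have "sin t > 0" using that by (auto intro: sin_gt_zero)
    moreover from this have "sqrt (1 - (cos t)\<^sup>2) = sin t" by (simp add: sin_squared_eq[symmetric])
    moreover have "ln (h (cos t)) - ln (h x) = 2 * (Re (L (cis t)) - Re (L (cis \<theta>)))"
      unfolding Lh[symmetric] x_def by simp
    ultimately show ?thesis
      by (simp add: u_def v_def x_def)
  qed
  have "(\<lambda>t. 2 * v t) absolutely_integrable_on {0<..<pi}"
    using v(1) by (rule set_integrable_mult_right[rotated])
  then have "(\<lambda>t. \<bar>- sin t\<bar> * u (cos t)) absolutely_integrable_on {0<..<pi}"
    by (rule absolutely_integrable_spike[of _ _ "{}"]) (use uv in auto)
  moreover have "integral {0<..<pi} (\<lambda>t. \<bar>- sin t\<bar> * u (cos t)) = integral {0<..<pi} (\<lambda>t. 2 * v t)"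
    by (rule integral_cong) (rule uv)
  then have "integral {0<..<pi} (\<lambda>t. \<bar>- sin t\<bar> * u (cos t)) = I"
    using v(2) by (simp add: I_def)
  moreover note cos_image_half_circle
  moreover have "inj_on cos {0<..<pi}" by (rule inj_onI) (auto intro: cos_inj_pi)
  ultimately have u: "u absolutely_integrable_on {-1<..<1}" "integral {-1<..<1} u = I"
    using has_absolute_integral_change_of_variables_1'[of "{0<..<pi}" cos "\<lambda>t. - sin t" u I]
      has_field_derivative_at_within[OF DERIV_cos]
    by (metis lmeasurable_interval(2) fmeasurableD)+
  have ui: "u integrable_on {-1..1}" using u(1)
    by (simp add: absolutely_integrable_on_def integrable_on_Icc_iff_Ioo)
  have uI: "integral {-1..1} u = I" using u(2) by (simp add: integral_open_interval_real)
  define N where "N t = ln (1 - x * t + sqrt (1 - x\<^sup>2) * sqrt (1 - t\<^sup>2))" for t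
  define \<delta> where "\<delta> = min (1 + x) (1 - x)"
  have \<delta>: "\<delta> > 0" using x by (simp add: \<delta>_def)
  \<comment> \<open>The two terms \<open>ln \<epsilon>\<close> have cancelled. What remains of the
    constant part is a symmetric difference of \<open>N\<close>, which tends to 0 because
    \<open>N\<close> is continuous at \<open>x\<close>.\<close>
  have ev: "integral {-1..x - \<epsilon>} f + integral {x + \<epsilon>..1} f =
     (integral {-1..x - \<epsilon>} u + integral {x + \<epsilon>..1} u) + ln (h x) * ((N (x + \<epsilon>) - N (x - \<epsilon>)) / sqrt (1 - x\<^sup>2))"
    if e: "0 < \<epsilon>" "\<epsilon> < \<delta>" for \<epsilon>
  proof -
    have feq: "f t = u t + ln (h x) * k t" for t
      by (simp add: f_def u_def k_def diff_divide_distrib mult.commute)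
    have k1: "(k has_integral (ln \<epsilon> - N (x - \<epsilon>)) / sqrt (1 - x\<^sup>2)) {-1..x - \<epsilon>}"
      and k2: "(k has_integral (N (x + \<epsilon>) - ln \<epsilon>) / sqrt (1 - x\<^sup>2)) {x + \<epsilon>..1}"
      unfolding k_def N_def using pv_arcsine_kernel[OF x] e by (auto simp: \<delta>_def)
    have u1: "u integrable_on {-1..x - \<epsilon>}" "u integrable_on {x + \<epsilon>..1}"
      using e x by (auto intro!: integrable_on_subinterval[OF ui] simp: \<delta>_def)
    have "(f has_integral integral {-1..x - \<epsilon>} u + ln (h x) * ((ln \<epsilon> - N (x - \<epsilon>)) / sqrt (1 - x\<^sup>2))) {-1..x - \<epsilon>}"
      by (rule has_integral_eq[OF _ has_integral_add[OF integrable_integral[OF u1(1)] has_integral_mult_right[OF k1]]])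
        (use e feq in auto)
    moreover have "(f has_integral integral {x + \<epsilon>..1} u + ln (h x) * ((N (x + \<epsilon>) - ln \<epsilon>) / sqrt (1 - x\<^sup>2))) {x + \<epsilon>..1}"
      by (rule has_integral_eq[OF _ has_integral_add[OF integrable_integral[OF u1(2)] has_integral_mult_right[OF k2]]])
        (use e feq in auto)
    ultimately show ?thesis
      by (simp add: integral_unique algebra_simps diff_divide_distrib add_divide_distrib)
  qed
  have lim1: "((\<lambda>\<epsilon>. integral {-1..x - \<epsilon>} u) \<longlongrightarrow> integral {-1..x} u) (at_right 0)"
  proof -
    have "isCont (\<lambda>y. integral {-1..y} u) x"
      using indefinite_integral_continuous_1[OF ui] x by (intro continuous_on_interior) auto
    moreover have "((\<lambda>\<epsilon>. x - \<epsilon>) \<longlongrightarrow> x) (at_right 0)" by (auto intro!: tendsto_eq_intros)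
    ultimately show ?thesis by (rule isCont_tendsto_compose)
  qed
  have lim2: "((\<lambda>\<epsilon>. integral {x + \<epsilon>..1} u) \<longlongrightarrow> integral {x..1} u) (at_right 0)"
  proof -
    have "isCont (\<lambda>y. integral {y..1} u) x"
      using indefinite_integral_continuous_1'[OF ui] x by (intro continuous_on_interior) auto
    moreover have "((\<lambda>\<epsilon>. x + \<epsilon>) \<longlongrightarrow> x) (at_right 0)" by (auto intro!: tendsto_eq_intros)
    ultimately show ?thesis by (rule isCont_tendsto_compose)
  qed
  have Ncont: "isCont N x"
  proof -
    have x2: "x\<^sup>2 < 1" using x by (simp add: abs_square_less_1 abs_less_iff)
    then have "1 - x * x + sqrt (1 - x\<^sup>2) * sqrt (1 - x\<^sup>2) \<noteq> 0" by (simp add: power2_eq_square)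
    then show ?thesis unfolding N_def by (intro continuous_intros) auto
  qed
  have lim3: "((\<lambda>\<epsilon>. N (x + \<epsilon>) - N (x - \<epsilon>)) \<longlongrightarrow> N x - N x) (at_right 0)"
    by (intro tendsto_diff isCont_tendsto_compose[OF Ncont]) (auto intro!: tendsto_eq_intros)
  have "((\<lambda>\<epsilon>. (integral {-1..x - \<epsilon>} u + integral {x + \<epsilon>..1} u) + ln (h x) * ((N (x + \<epsilon>) - N (x - \<epsilon>)) / sqrt (1 - x\<^sup>2)))
      \<longlongrightarrow> (integral {-1..x} u + integral {x..1} u) + ln (h x) * ((N x - N x) / sqrt (1 - x\<^sup>2))) (at_right 0)"
    using sin x by (intro tendsto_intros lim1 lim2 lim3) (auto simp: x_def sin_squared_eq[symmetric])
  also have "(integral {-1..x} u + integral {x..1} u) + ln (h x) * ((N x - N x) / sqrt (1 - x\<^sup>2)) = I"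
    using Henstock_Kurzweil_Integration.integral_combine[where a="-1" and c=x and b=1 and f=u] x ui uI by simp
  finally have "((\<lambda>\<epsilon>. integral {-1..x - \<epsilon>} f + integral {x + \<epsilon>..1} f) \<longlongrightarrow> I) (at_right 0)"
  proof (rule Lim_transform_eventually)
    show "\<forall>\<^sub>F \<epsilon> in at_right 0. (integral {-1..x - \<epsilon>} u + integral {x + \<epsilon>..1} u) + ln (h x) * ((N (x + \<epsilon>) - N (x - \<epsilon>)) / sqrt (1 - x\<^sup>2))
        = integral {-1..x - \<epsilon>} f + integral {x + \<epsilon>..1} f"
      unfolding eventually_at_right_field using \<delta> ev by (intro exI[of _ \<delta>]) auto
  qed
  then have "pv_integral f x = I" unfolding pv_integral_def by (intro tendsto_Lim) auto
  then show ?thesis by (simp add: f_def[abs_def] x_def I_def)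
qed

subsection \<open>Entropy limits and equidistribution\<close>

lemma LIMSEQ_null_abs_le:
  fixes f g :: "nat \<Rightarrow> real"
  assumes "\<And>n. \<bar>f n\<bar> \<le> g n" "g \<longlonglongrightarrow> 0"
  shows "f \<longlonglongrightarrow> 0"
  by (rule Lim_null_comparison[OF _ assms(2)]) (use assms(1) in auto)

section \<open>Cesaro means of cosines along arithmetic progressions\<close>

lemma cesaro_mean_null:
  fixes a :: "nat \<Rightarrow> real"
  assumes "a \<longlonglongrightarrow> 0"
  shows "(\<lambda>n. (\<Sum>j<n. a j) / real n) \<longlonglongrightarrow> 0"
proof (rule LIMSEQ_I)
  fix e :: real assume e: "e > 0"
  obtain N where N: "\<And>j. j \<ge> N \<Longrightarrow> \<bar>a j\<bar> < e / 2"
    using LIMSEQ_D[OF assms, of "e/2"] e by auto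
  define S where "S = (\<Sum>j<N. \<bar>a j\<bar>)"
  obtain N1 where N1: "real N1 > 2 * S / e" using reals_Archimedean2 by blast
  show "\<exists>n0. \<forall>n\<ge>n0. norm ((\<Sum>j<n. a j) / real n - 0) < e"
  proof (intro exI[of _ "Suc (N + N1)"] allI impI)
    fix n assume n: "n \<ge> Suc (N + N1)"
    have "\<bar>\<Sum>j<n. a j\<bar> \<le> (\<Sum>j<n. \<bar>a j\<bar>)" by (rule sum_abs)
    also have "\<dots> = S + (\<Sum>j\<in>{N..<n}. \<bar>a j\<bar>)"
    proof -
      have un: "{..<n} = {..<N} \<union> {N..<n}" using n by auto
      show ?thesis unfolding S_def by (subst un, rule sum.union_disjoint) auto
    qed
    also have "(\<Sum>j\<in>{N..<n}. \<bar>a j\<bar>) \<le> (\<Sum>j\<in>{N..<n}. e / 2)"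
      using N by (intro sum_mono) (auto intro: less_imp_le)
    also have "\<dots> \<le> n * (e / 2)" using e by (auto intro!: mult_right_mono)
    finally have "\<bar>\<Sum>j<n. a j\<bar> \<le> S + n * (e / 2)" by simp
    moreover have "S < n * (e / 2)"
    proof -
      have "2 * S / e < n" using N1 n by linarith
      then show ?thesis using e by (simp add: field_simps)
    qed
    ultimately have "\<bar>\<Sum>j<n. a j\<bar> < n * e" by (simp add: field_simps)
    then show "norm ((\<Sum>j<n. a j) / real n - 0) < e" using n by (simp add: field_simps)
  qed
qed

text \<open>Multiplication by 2 sin (\<tau>/2) makes the sum telescope, so the partial sums stay
  bounded.\<close>

lemma cos_progression_mean:
  assumes "sin (\<tau> / 2) \<noteq> 0"
  shows "(\<lambda>n. (\<Sum>j<n. cos (real j * \<tau> + c)) / real n) \<longlonglongrightarrow> 0"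
proof -
  have tele: "2 * sin (\<tau> / 2) * (\<Sum>j<n. cos (real j * \<tau> + c)) = sin (real n * \<tau> + c - \<tau> / 2) - sin (c - \<tau> / 2)" for n
  proof (induction n)
    case (Suc n)
    have "2 * sin (\<tau> / 2) * cos (real n * \<tau> + c) = sin (real n * \<tau> + c + \<tau> / 2) - sin (real n * \<tau> + c - \<tau> / 2)"
      by (simp add: sin_add sin_diff)
    also have "real n * \<tau> + c + \<tau> / 2 = real (Suc n) * \<tau> + c - \<tau> / 2"
      by (simp add: field_simps)
    finally show ?case using Suc by (simp only: sum.lessThan_Suc distrib_left)
  qed simp
  have bd: "\<bar>\<Sum>j<n. cos (real j * \<tau> + c)\<bar> \<le> 1 / \<bar>sin (\<tau> / 2)\<bar>" for n
  proof -
    have "\<bar>sin (real n * \<tau> + c - \<tau> / 2) - sin (c - \<tau> / 2)\<bar> \<le> 2"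
      using abs_sin_le_one[of "real n * \<tau> + c - \<tau> / 2"] abs_sin_le_one[of "c - \<tau> / 2"] by linarith
    then have "2 * \<bar>sin (\<tau> / 2)\<bar> * \<bar>\<Sum>j<n. cos (real j * \<tau> + c)\<bar> \<le> 2"
      unfolding tele[symmetric] by (simp add: abs_mult)
    then show ?thesis using assms by (simp add: field_simps)
  qed
  have "\<bar>(\<Sum>j<n. cos (real j * \<tau> + c)) / real n\<bar> \<le> (1 / \<bar>sin (\<tau> / 2)\<bar>) / real n" for n
    using divide_right_mono[OF bd[of n], of "real n"] by (simp add: abs_divide)
  moreover have "(\<lambda>n. (1 / \<bar>sin (\<tau> / 2)\<bar>) / real n) \<longlonglongrightarrow> 0" by real_asymp
  ultimately show ?thesis
    by (rule LIMSEQ_null_abs_le)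
qed

text \<open>The doubled angle advances by 2\<theta>, which is not a multiple of 2 pi for \<theta> in
  (0, pi). Hence the normalised Christoffel sums have the limit 1/2 for rational and irrational
  \<theta>/pi alike.\<close>

lemma cos_squared_mean:
  assumes "0 < \<theta>" "\<theta> < pi"
  shows "(\<lambda>n. (\<Sum>j<n. (cos ((real j + 1/2) * \<theta> + \<delta>))\<^sup>2) / real n) \<longlonglongrightarrow> 1 / 2"
proof -
  have eq: "(cos ((real j + 1/2) * \<theta> + \<delta>))\<^sup>2 = 1 / 2 + cos (real j * (2 * \<theta>) + (\<theta> + 2 * \<delta>)) / 2" for j
    using cos_double_cos[of "(real j + 1/2) * \<theta> + \<delta>"] by (simp add: algebra_simps add_divide_distrib)
  have "sin ((2 * \<theta>) / 2) \<noteq> 0" using sin_gt_zero[of \<theta>] assms by simp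
  note lim = tendsto_mult_right[OF cos_progression_mean[OF this, of "\<theta> + 2 * \<delta>"], of "1/2"]
  have "(\<lambda>n. 1 / 2 + (\<Sum>j<n. cos (real j * (2 * \<theta>) + (\<theta> + 2 * \<delta>))) / real n * (1 / 2)) \<longlonglongrightarrow> 1 / 2"
    using tendsto_add[OF tendsto_const lim, of "1/2"] by simp
  then show ?thesis
  proof (rule Lim_transform_eventually)
    show "\<forall>\<^sub>F n in sequentially. 1 / 2 + (\<Sum>j<n. cos (real j * (2 * \<theta>) + (\<theta> + 2 * \<delta>))) / real n * (1 / 2) =
      (\<Sum>j<n. (cos ((real j + 1/2) * \<theta> + \<delta>))\<^sup>2) / real n"
      using eventually_gt_at_top[of 0]
      by eventually_elim (simp only: eq sum.distrib, simp add: add_divide_distrib flip: sum_divide_distrib)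
  qed
qed

section \<open>From asymptotics of the polynomials to the entropy\<close>

lemma continuous_on_xlogx: "continuous_on {0..} xlogx"
  unfolding continuous_on_eq_continuous_within
proof
  fix y :: real assume y: "y \<in> {0..}"
  show "continuous (at y within {0..}) xlogx"
  proof (cases "y = 0")
    case True
    have "((\<lambda>y::real. y * ln y) \<longlongrightarrow> 0) (at_right 0)" by real_asymp
    then have "(xlogx \<longlongrightarrow> 0) (at_right 0)"
      by (rule Lim_transform_eventually) (auto simp: xlogx_def eventually_at_filter)
    then show ?thesis using True
      by (simp add: continuous_within xlogx_def at_within_Ici_at_right)
  next
    case False
    then have "isCont (\<lambda>y. y * ln y) y" using y by (intro continuous_intros) auto
    moreover have "\<forall>\<^sub>F z in nhds y. z * ln z = xlogx z"
      by (rule eventually_mono[OF t1_space_nhds[OF False]]) (simp add: xlogx_def)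
    ultimately have "isCont xlogx y" by (simp add: isCont_cong)
    then show ?thesis by (rule continuous_at_imp_continuous_at_within)
  qed
qed

lemma FF_eq_xlogx: "FF y = xlogx (y\<^sup>2)"
  by (simp add: FF_def xlogx_def)

text \<open>The common factor \<open>A\<close> cancels in \<open>Psi\<close>. With U and X the sums
  of u_j and of u_j ln u_j over j < n, the defect equals (X/n) / (U/n) - ln (U/n), where U/n tends
  to 1/2 and X/n to \<open>M\<close>. The assumption on \<open>p 0\<close> keeps U positive.\<close>

lemma entropy_defect_limit:
  assumes A: "A > 0" and th: "0 < \<theta>" "\<theta> < pi"
    and asym: "(\<lambda>j. (poly (p j) x)\<^sup>2 / A - (cos ((real j + 1/2) * \<theta> + \<delta>))\<^sup>2) \<longlonglongrightarrow> 0"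
    and p0: "poly (p 0) x \<noteq> 0"
    and M: "(\<lambda>n. (\<Sum>j<n. FF (cos ((real j + 1/2) * \<theta> + \<delta>))) / real n) \<longlonglongrightarrow> M"
  shows "(\<lambda>n. entropy_defect p n x) \<longlonglongrightarrow> ln 2 + 2 * M"
proof -
  define u where "u j = (poly (p j) x)\<^sup>2 / A" for j
  define c where "c j = (cos ((real j + 1/2) * \<theta> + \<delta>))\<^sup>2" for j
  have uc: "(\<lambda>j. u j - c j) \<longlonglongrightarrow> 0" using asym by (simp add: u_def c_def)
  have u0: "u j \<ge> 0" for j using A by (simp add: u_def)
  have c01: "0 \<le> c j" "c j \<le> 1" for j by (auto simp: c_def abs_square_le_1)
  obtain B where B: "\<And>j. \<bar>u j - c j\<bar> \<le> B"
    using Bseq_eq_bounded convergent_imp_Bseq[OF convergentI[OF uc]] unfolding Bseq_def by auto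
  have uB: "u j \<in> {0..B + 1}" "c j \<in> {0..B + 1}" for j
    using B[of j] c01[of j] u0[of j] by auto
  \<comment> \<open>The sequences \<open>u\<close> and \<open>c\<close> approach each other without
    converging, so pointwise continuity is not enough. Both stay in one compact interval, on which
    \<open>xlogx\<close> is uniformly continuous, including at 0.\<close>
  have "uniformly_continuous_on {0..B + 1} xlogx"
    by (rule compact_uniformly_continuous) (auto intro: continuous_on_subset[OF continuous_on_xlogx])
  then have "(\<lambda>j. dist (xlogx (u j)) (xlogx (c j))) \<longlonglongrightarrow> 0"
    unfolding uniformly_continuous_on_sequentially using uB uc
    by (elim allE[of _ u] allE[of _ c]) (simp add: dist_real_def tendsto_rabs_zero_iff)
  then have xx: "(\<lambda>j. xlogx (u j) - xlogx (c j)) \<longlonglongrightarrow> 0"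
    by (simp add: dist_real_def tendsto_rabs_zero_iff)
  define U where "U n = (\<Sum>j<n. u j)" for n
  define X where "X n = (\<Sum>j<n. xlogx (u j))" for n
  have U: "(\<lambda>n. U n / real n) \<longlonglongrightarrow> 1 / 2"
    using tendsto_add[OF cesaro_mean_null[OF uc] cos_squared_mean[OF th, of \<delta>]]
    by (simp add: U_def c_def sum_subtractf diff_divide_distrib)
  have X: "(\<lambda>n. X n / real n) \<longlonglongrightarrow> M"
    using tendsto_add[OF cesaro_mean_null[OF xx] M]
    by (simp add: X_def c_def FF_eq_xlogx sum_subtractf diff_divide_distrib)
  have "(\<lambda>n. (X n / real n) / (U n / real n) - ln (U n / real n)) \<longlonglongrightarrow> M / (1 / 2) - ln (1 / 2)"
    by (intro tendsto_intros X U) auto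
  moreover have "M / (1 / 2) - ln (1 / 2) = ln 2 + 2 * M" by (simp add: ln_div)
  ultimately have "(\<lambda>n. (X n / real n) / (U n / real n) - ln (U n / real n)) \<longlonglongrightarrow> ln 2 + 2 * M"
    by (simp only:)
  then show ?thesis
  proof (rule Lim_transform_eventually)
    show "\<forall>\<^sub>F n in sequentially. (X n / real n) / (U n / real n) - ln (U n / real n) = entropy_defect p n x"
      using eventually_gt_at_top[of 0]
    proof eventually_elim
      case (elim n)
      have "u 0 > 0" using p0 A by (simp add: u_def)
      then have Up: "U n > 0" unfolding U_def
        using elim u0 by (intro sum_pos2[of _ 0]) auto
      have Psi: "Psi p n (Suc j) x = u j / U n" for j
        using A by (simp add: Psi_def christoffel_def U_def u_def field_simps flip: sum_divide_distrib)
      have xl: "xlogx (u j / U n) = (xlogx (u j) - u j * ln (U n)) / U n" for j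
      proof (cases "u j = 0")
        case False
        then have "u j > 0" using u0[of j] by simp
        then show ?thesis using Up by (simp add: xlogx_def ln_div field_simps)
      qed (simp add: xlogx_def)
      have "(\<Sum>j=1..n. xlogx (Psi p n j x)) = (\<Sum>j<n. xlogx (Psi p n (Suc j) x))"
        using sum.shift_bounds_Suc_ivl[of "\<lambda>j. xlogx (Psi p n j x)" 0 n]
        by (simp add: atLeastLessThanSuc_atLeastAtMost lessThan_atLeast0)
      also have "\<dots> = (X n - U n * ln (U n)) / U n"
        by (simp only: Psi xl X_def sum_subtractf sum_divide_distrib[symmetric] sum_distrib_right[symmetric] U_def[symmetric])
      also have "\<dots> = X n / U n - ln (U n)" using Up by (simp add: field_simps)
      finally show ?case using elim Up
        by (simp add: entropy_defect_def shannon_entropy_def ln_div)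
    qed
  qed
qed

text \<open>Advancing j by k adds s pi to the angle and leaves the squared cosine unchanged. The
  deviation \<open>d\<close> of the sums from linear growth is then k-periodic, hence bounded, and
  disappears after division by n.\<close>

lemma FF_mean_rational:
  assumes sk: "s < k" and th: "\<theta> = pi * real s / real k"
  shows "(\<lambda>n. (\<Sum>j<n. FF (cos ((real j + 1/2) * \<theta> + \<delta>))) / real n) \<longlonglongrightarrow>
     (1 / real k) * (\<Sum>i<k. FF (cos ((real i + 1/2) * \<theta> + \<delta>)))"
proof -
  have k: "k > 0" using sk by simp
  define g where "g j = FF (cos ((real j + 1/2) * \<theta> + \<delta>))" for j :: nat
  define m where "m = (1 / real k) * (\<Sum>i<k. g i)"
  have per: "g (j + k) = g j" for j
  proof -
    have "(real (j + k) + 1/2) * \<theta> + \<delta> = ((real j + 1/2) * \<theta> + \<delta>) + real s * pi"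
      using k by (simp add: th field_simps)
    moreover have "(cos (a + real s * pi))\<^sup>2 = (cos a)\<^sup>2" for a
      by (simp add: cos_add cos_npi sin_npi power_mult_distrib flip: power_mult)
    ultimately have "(cos ((real (j + k) + 1/2) * \<theta> + \<delta>))\<^sup>2 = (cos ((real j + 1/2) * \<theta> + \<delta>))\<^sup>2"
      by metis
    then show ?thesis by (simp only: g_def FF_eq_xlogx)
  qed
  define d where "d n = (\<Sum>j<n. g j) - m * real n" for n
  have shift: "(\<Sum>j<n + k. g j) = (\<Sum>j<k. g j) + (\<Sum>j<n. g j)" for n
  proof (induction n)
    case (Suc n)
    then show ?case by (simp add: per)
  qed simp
  have dper: "d (n + k) = d n" for n
    unfolding d_def shift using k by (simp add: m_def field_simps)
  have dmod: "d n = d (n mod k)" for n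
  proof (induction n rule: less_induct)
    case (less n)
    show ?case
    proof (cases "n < k")
      case False
      then have "d n = d (n - k)" using dper[of "n - k"] by simp
      also have "\<dots> = d ((n - k) mod k)" using False k by (intro less) simp
      finally show ?thesis using False by (simp add: le_mod_geq)
    qed simp
  qed
  define C where "C = (\<Sum>i<k. \<bar>d i\<bar>)"
  have "\<bar>d n\<bar> \<le> C" for n
    unfolding C_def using k dmod[of n] by (auto intro!: member_le_sum)
  then have "\<bar>d n / real n\<bar> \<le> C / real n" for n by (simp add: abs_divide divide_right_mono)
  moreover have "(\<lambda>n. C / real n) \<longlonglongrightarrow> 0" by real_asymp
  ultimately have "(\<lambda>n. d n / real n) \<longlonglongrightarrow> 0"
    by (rule LIMSEQ_null_abs_le)
  from tendsto_add[OF this tendsto_const[of m]]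
  have "(\<lambda>n. d n / real n + m) \<longlonglongrightarrow> m" by simp
  then have "(\<lambda>n. (\<Sum>j<n. g j) / real n) \<longlonglongrightarrow> m"
  proof (rule Lim_transform_eventually)
    show "\<forall>\<^sub>F n in sequentially. d n / real n + m = (\<Sum>j<n. g j) / real n"
      using eventually_gt_at_top[of 0] by eventually_elim (simp add: d_def field_simps)
  qed
  then show ?thesis by (simp add: g_def m_def)
qed

text \<open>Weyl's criterion for monomials in cos. The additional factor cos (k t) lets the
  induction on \<open>m\<close> close: each power of cos is traded for the neighbouring frequencies,
  and at m = 0 only k = 0 has a nonzero mean.\<close>

lemma equidistribution_trig_poly:
  fixes \<tau> c :: real
  assumes "\<And>k::nat. k > 0 \<Longrightarrow> sin (real k * \<tau> / 2) \<noteq> 0"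
  shows "(\<lambda>n. (\<Sum>j<n. cos (real j * \<tau> + c) ^ m * cos (real k * (real j * \<tau> + c))) / real n)
    \<longlonglongrightarrow> integral {0..pi} (\<lambda>t. cos t ^ m * cos (real k * t)) / pi"
proof (induction m arbitrary: k)
  case 0
  show ?case
  proof (cases "k = 0")
    case True
    have "(\<lambda>n::nat. real n / real n) \<longlonglongrightarrow> 1" by real_asymp
    then show ?thesis using True by simp
  next
    case False
    have "((\<lambda>t. cos (real k * t)) has_integral (sin (real k * pi) / k - sin (real k * 0) / k)) {0..pi}"
      by (rule fundamental_theorem_of_calculus)
        (use False in \<open>auto intro!: derivative_eq_intros simp flip: has_real_derivative_iff_has_vector_derivative\<close>)
    then have "integral {0..pi} (\<lambda>t. cos (real k * t)) = 0" by (simp add: sin_npi integral_unique)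
    moreover have "(\<lambda>n. (\<Sum>j<n. cos (real j * (real k * \<tau>) + real k * c)) / real n) \<longlonglongrightarrow> 0"
      using assms[of k] False by (intro cos_progression_mean) auto
    ultimately show ?thesis by (simp add: algebra_simps)
  qed
next
  case (Suc m)
  \<comment> \<open>This is |k - 1| as a natural number; for k = 0 the frequency -1 is replaced by
    1, as cos is even.\<close>
  define k' where "k' = (if k = 0 then 1 else k - 1)"
  have eq: "cos t ^ Suc m * cos (real k * t) = (cos t ^ m * cos (real (Suc k) * t) + cos t ^ m * cos (real k' * t)) / 2" for t
  proof -
    have "cos (real k' * t) = cos (real k * t - t)"
      by (cases "k = 0") (auto simp: k'_def algebra_simps of_nat_diff)
    then have "cos (real (Suc k) * t) + cos (real k' * t) = 2 * cos t * cos (real k * t)"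
      by (simp add: algebra_simps cos_add cos_diff)
    then show ?thesis by (simp add: algebra_simps flip: distrib_left)
  qed
  have ieq: "integral {0..pi} (\<lambda>t. cos t ^ Suc m * cos (real k * t)) =
    (integral {0..pi} (\<lambda>t. cos t ^ m * cos (real (Suc k) * t)) + integral {0..pi} (\<lambda>t. cos t ^ m * cos (real k' * t))) / 2"
    unfolding eq
    by (subst integral_add[symmetric])
      (auto intro!: integrable_continuous_real continuous_intros)
  have seq: "(\<Sum>j<n. cos (real j * \<tau> + c) ^ Suc m * cos (real k * (real j * \<tau> + c))) / real n =
      ((\<Sum>j<n. cos (real j * \<tau> + c) ^ m * cos (real (Suc k) * (real j * \<tau> + c))) / real n +
      (\<Sum>j<n. cos (real j * \<tau> + c) ^ m * cos (real k' * (real j * \<tau> + c))) / real n) / 2" for n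
    unfolding eq
    by (simp only: sum_divide_distrib[symmetric] sum.distrib) (simp add: add_divide_distrib)
  have "(\<lambda>n. ((\<Sum>j<n. cos (real j * \<tau> + c) ^ m * cos (real (Suc k) * (real j * \<tau> + c))) / real n +
      (\<Sum>j<n. cos (real j * \<tau> + c) ^ m * cos (real k' * (real j * \<tau> + c))) / real n) / 2) \<longlonglongrightarrow>
     (integral {0..pi} (\<lambda>t. cos t ^ m * cos (real (Suc k) * t)) / pi + integral {0..pi} (\<lambda>t. cos t ^ m * cos (real k' * t)) / pi) / 2"
    by (intro tendsto_intros Suc.IH) auto
  moreover have "(a / pi + b / pi) / 2 = (a + b) / 2 / pi" for a b :: real
    by (simp add: field_simps)
  ultimately show ?case
    unfolding ieq seq by (simp only:)
qed

text \<open>Monomials are the case k = 0 of \<open>equidistribution_trig_poly\<close>, and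
  Stone-Weierstrass on [-1,1] passes to continuous functions of cos. Continuity is all that is
  available for y ln y at y = 0.\<close>

lemma equidistribution_cos:
  fixes \<tau> c :: real and g :: "real \<Rightarrow> real"
  assumes irr: "\<And>k::nat. k > 0 \<Longrightarrow> sin (real k * \<tau> / 2) \<noteq> 0" and g: "continuous_on {-1..1} g"
  shows "(\<lambda>n. (\<Sum>j<n. g (cos (real j * \<tau> + c))) / real n) \<longlonglongrightarrow> integral {0..pi} (\<lambda>t. g (cos t)) / pi"
proof (rule LIMSEQ_I)
  fix e :: real assume e: "e > 0"
  obtain q where q: "real_polynomial_function q" "\<And>x. x \<in> {-1..1} \<Longrightarrow> \<bar>g x - q x\<bar> < e / 3"
    using Stone_Weierstrass_real_polynomial_function[OF _ g, of "e/3"] e by auto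
  obtain a d where qa: "q = (\<lambda>x. \<Sum>i\<le>d. a i * x ^ i)"
    using q(1) unfolding real_polynomial_function_iff_sum by auto
  have qcont: "continuous_on X q" for X unfolding qa by (intro continuous_intros)
  have qlim: "(\<lambda>n. (\<Sum>j<n. q (cos (real j * \<tau> + c))) / real n) \<longlonglongrightarrow> integral {0..pi} (\<lambda>t. q (cos t)) / pi"
  proof -
    have lim: "(\<lambda>n. \<Sum>i\<le>d. a i * ((\<Sum>j<n. cos (real j * \<tau> + c) ^ i * cos (real 0 * (real j * \<tau> + c))) / real n)) \<longlonglongrightarrow>
       (\<Sum>i\<le>d. a i * (integral {0..pi} (\<lambda>t. cos t ^ i * cos (real 0 * t)) / pi))"
      by (intro tendsto_intros equidistribution_trig_poly irr)
    have "integral {0..pi} (\<lambda>t. q (cos t)) = (\<Sum>i\<le>d. a i * integral {0..pi} (\<lambda>t. cos t ^ i))"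
      unfolding qa by (subst integral_sum) (auto intro!: integrable_continuous_real continuous_intros)
    moreover have "(\<Sum>j<n. q (cos (real j * \<tau> + c))) = (\<Sum>i\<le>d. a i * (\<Sum>j<n. cos (real j * \<tau> + c) ^ i))" for n
      unfolding qa by (subst sum.swap) (simp add: sum_distrib_left)
    ultimately show ?thesis
      using lim by (simp only: sum_divide_distrib[where A="{..d}"] of_nat_0 mult_zero_left cos_zero
        mult_1_right times_divide_eq_right)
  qed
  have cosI: "cos t \<in> {-1..1}" for t :: real by simp
  have gi: "(\<lambda>t. g (cos t)) integrable_on {0..pi}" "(\<lambda>t. q (cos t)) integrable_on {0..pi}"
    by (auto intro!: integrable_continuous_real continuous_on_compose2[OF g] continuous_on_compose2[OF qcont[of UNIV]] continuous_intros)
  have "\<bar>integral {0..pi} (\<lambda>t. g (cos t)) - integral {0..pi} (\<lambda>t. q (cos t))\<bar> \<le> e / 3 * pi"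
  proof -
    have "norm (integral (cbox 0 pi) (\<lambda>t. g (cos t) - q (cos t))) \<le> e / 3 * measure lborel (cbox 0 pi)"
      by (rule has_integral_bound[OF _ integrable_integral])
        (use e q(2)[OF cosI] gi in \<open>auto intro!: integrable_diff less_imp_le\<close>)
    then show ?thesis using gi by (simp add: integral_diff)
  qed
  then have I: "\<bar>integral {0..pi} (\<lambda>t. g (cos t)) / pi - integral {0..pi} (\<lambda>t. q (cos t)) / pi\<bar> \<le> e / 3"
    by (simp add: abs_divide field_simps flip: diff_divide_distrib)
  obtain N where N: "\<And>n. n \<ge> N \<Longrightarrow> \<bar>(\<Sum>j<n. q (cos (real j * \<tau> + c))) / real n - integral {0..pi} (\<lambda>t. q (cos t)) / pi\<bar> < e / 3"
    using LIMSEQ_D[OF qlim, of "e/3"] e by auto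
  show "\<exists>n0. \<forall>n\<ge>n0. norm ((\<Sum>j<n. g (cos (real j * \<tau> + c))) / real n - integral {0..pi} (\<lambda>t. g (cos t)) / pi) < e"
  proof (intro exI[of _ "Suc N"] allI impI)
    fix n assume n: "n \<ge> Suc N"
    have "\<bar>(\<Sum>j<n. g (cos (real j * \<tau> + c))) - (\<Sum>j<n. q (cos (real j * \<tau> + c)))\<bar> \<le> (\<Sum>j<n. e / 3)"
      unfolding sum_subtractf[symmetric]
      by (rule order_trans[OF sum_abs sum_mono]) (use q(2)[OF cosI] in \<open>auto intro: less_imp_le\<close>)
    then have "\<bar>(\<Sum>j<n. g (cos (real j * \<tau> + c))) / real n - (\<Sum>j<n. q (cos (real j * \<tau> + c))) / real n\<bar> \<le> e / 3"
      using n by (simp add: abs_divide field_simps flip: diff_divide_distrib)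
    then show "norm ((\<Sum>j<n. g (cos (real j * \<tau> + c))) / real n - integral {0..pi} (\<lambda>t. g (cos t)) / pi) < e"
      using I N[of n] n by (simp only: real_norm_def) linarith
  qed
qed

text \<open>The value \<open>M\<close> of the mean of \<open>y ln y\<close>, \<open>y = cos\<^sup>2 (t/2)\<close>, comes from two linear relations with
  the mean \<open>M'\<close> of \<open>y\<^sup>2 ln y\<close>: integration by parts gives \<open>4 M' = 3 M + 1/4\<close>, and the doubling identity
  \<open>sin\<^sup>2 t = 4 y (1 - y)\<close> together with equidistribution of \<open>2\<theta>\<close> gives \<open>M = ln 2 + 8 M - 8 M'\<close>.\<close>

lemma FF_mean_irrational:
  assumes irr: "\<theta> / pi \<notin> \<rat>"
  shows "(\<lambda>n. (\<Sum>j<n. FF (cos ((real j + 1/2) * \<theta> + \<delta>))) / real n) \<longlonglongrightarrow> 1 / 2 - ln 2"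
proof -
  define y where "y t = (1 + cos t) / 2" for t :: real
  define g where "g x = xlogx ((1 + x) / 2)" for x :: real
  define g2 where "g2 x = (1 + x) / 2 * xlogx ((1 + x) / 2)" for x :: real
  have cg: "continuous_on {-1..1} g" unfolding g_def
    by (intro continuous_on_compose2[OF continuous_on_xlogx] continuous_intros) auto
  have cg2: "continuous_on {-1..1} g2" unfolding g2_def
    by (intro continuous_intros continuous_on_compose2[OF continuous_on_xlogx]) auto
  define M where "M = integral {0..pi} (\<lambda>t. g (cos t)) / pi"
  define M2 where "M2 = integral {0..pi} (\<lambda>t. g2 (cos t)) / pi"
  have sin0: "sin (real k * (real m * \<theta>) / 2) \<noteq> 0" if "k > 0" "m > 0" for k m :: nat
  proof
    assume "sin (real k * (real m * \<theta>) / 2) = 0"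
    then obtain i :: int where "real k * (real m * \<theta>) / 2 = of_int i * pi"
      using sin_zero_iff_int2 by auto
    then have "\<theta> / pi = 2 * of_int i / (of_nat k * of_nat m)" using that by (simp add: field_simps)
    then show False using irr by (metis Rats_divide Rats_mult Rats_number_of Rats_of_int Rats_of_nat)
  qed
  have lim_g: "(\<lambda>n. (\<Sum>j<n. g (cos (real j * (real m * \<theta>) + c))) / real n) \<longlonglongrightarrow> M" if "m > 0" for m :: nat and c
    unfolding M_def using sin0 that by (intro equidistribution_cos cg) auto
  have lim_g2: "(\<lambda>n. (\<Sum>j<n. g2 (cos (real j * (real m * \<theta>) + c))) / real n) \<longlonglongrightarrow> M2" if "m > 0" for m :: nat and c
    unfolding M2_def using sin0 that by (intro equidistribution_cos cg2) auto
  have parts: "4 * M2 = 3 * M + 1 / 4"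
  proof -
    \<comment> \<open>This is y ln y times (sin t)/2 with y = cos (t/2)^2. It vanishes at 0 and pi,
      so the integral of its derivative gives a relation between the means without boundary
      terms.\<close>
    define G where "G t = xlogx ((cos (t/2))\<^sup>2) * (cos (t/2) * sin (t/2))" for t :: real
    have "((\<lambda>t. 2 * g2 (cos t) - 3 / 2 * g (cos t) - (1 - cos (2 * t)) / 8) has_integral G pi - G 0) {0..pi}"
    proof (rule fundamental_theorem_of_calculus_interior)
      show "continuous_on {0..pi} G" unfolding G_def
        by (intro continuous_intros continuous_on_compose2[OF continuous_on_xlogx]) auto
      fix t assume t: "t \<in> {0<..<pi}"
      define c s where "c = cos (t/2)" and "s = sin (t/2)"
      have c: "c > 0" using t by (auto simp: c_def intro!: cos_gt_zero_pi)
      have cs: "s\<^sup>2 = 1 - c\<^sup>2" by (simp add: c_def s_def sin_squared_eq)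
      have ct: "cos t = 2 * c\<^sup>2 - 1" using cos_double_cos[of "t/2"] by (simp add: c_def)
      have c2t: "cos (2 * t) = 2 * (cos t)\<^sup>2 - 1" by (rule cos_double_cos)
      have "((\<lambda>t. (cos (t/2))\<^sup>2 * ln ((cos (t/2))\<^sup>2) * (cos (t/2) * sin (t/2))) has_real_derivative
         (2 * c * (- s / 2) * ln (c\<^sup>2) + c\<^sup>2 * (2 * c * (- s / 2) / c\<^sup>2)) * (c * s) + c\<^sup>2 * ln (c\<^sup>2) * (- s / 2 * s + c * (c / 2))) (at t)"
        using c unfolding c_def s_def by (auto intro!: derivative_eq_intros)
      also have "(2 * c * (- s / 2) * ln (c\<^sup>2) + c\<^sup>2 * (2 * c * (- s / 2) / c\<^sup>2)) * (c * s) + c\<^sup>2 * ln (c\<^sup>2) * (- s / 2 * s + c * (c / 2))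
          = 2 * (c\<^sup>2 * (c\<^sup>2 * ln (c\<^sup>2))) - 3 / 2 * (c\<^sup>2 * ln (c\<^sup>2)) - c\<^sup>2 * (1 - c\<^sup>2)"
      proof -
        have "c\<^sup>2 * (2 * c * (- s / 2) / c\<^sup>2) = - c * s" using c by simp
        then show ?thesis using cs by (simp only:) algebra
      qed
      also have "\<dots> = 2 * g2 (cos t) - 3 / 2 * g (cos t) - (1 - cos (2 * t)) / 8"
        unfolding g2_def g_def c2t ct using c by (simp add: xlogx_def power2_eq_square field_simps)
      finally have "((\<lambda>t. (cos (t/2))\<^sup>2 * ln ((cos (t/2))\<^sup>2) * (cos (t/2) * sin (t/2))) has_real_derivative
          2 * g2 (cos t) - 3 / 2 * g (cos t) - (1 - cos (2 * t)) / 8) (at t)" .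
      moreover have "(\<lambda>t. (cos (t/2))\<^sup>2 * ln ((cos (t/2))\<^sup>2) * (cos (t/2) * sin (t/2))) = G"
        by (auto simp: G_def xlogx_def fun_eq_iff)
      ultimately show "(G has_vector_derivative 2 * g2 (cos t) - 3 / 2 * g (cos t) - (1 - cos (2 * t)) / 8) (at t)"
        by (simp add: has_real_derivative_iff_has_vector_derivative)
    qed auto
    moreover have "G pi = 0" "G 0 = 0" by (auto simp: G_def)
    ultimately have i0: "((\<lambda>t. 2 * g2 (cos t) - 3 / 2 * g (cos t) - (1 - cos (2 * t)) / 8) has_integral 0) {0..pi}"
      by simp
    have i1: "((\<lambda>t. g2 (cos t)) has_integral pi * M2) {0..pi}"
      unfolding M2_def
      by (simp, intro integrable_integral integrable_continuous_real continuous_on_compose2[OF cg2] continuous_intros) auto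
    have i2: "((\<lambda>t. g (cos t)) has_integral pi * M) {0..pi}"
      unfolding M_def
      by (simp, intro integrable_integral integrable_continuous_real continuous_on_compose2[OF cg] continuous_intros) auto
    have i3: "((\<lambda>t. (1 - cos (2 * t)) / 8) has_integral ((pi - sin (2 * pi) / 2) / 8 - (0 - sin (2 * 0) / 2) / 8)) {0..pi}"
      by (rule fundamental_theorem_of_calculus)
        (auto intro!: derivative_eq_intros simp flip: has_real_derivative_iff_has_vector_derivative)
    have "2 * (pi * M2) - 3 / 2 * (pi * M) - ((pi - sin (2 * pi) / 2) / 8 - (0 - sin (2 * 0) / 2) / 8) = 0"
      by (rule has_integral_unique[OF has_integral_diff[OF has_integral_diff[OF has_integral_mult_right[OF i1] has_integral_mult_right[OF i2]] i3] i0])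
    then have "pi * (4 * M2 - 3 * M - 1 / 4) = 0" by (simp add: algebra_simps)
    then show ?thesis by simp
  qed
  have doubling: "M = ln 2 + 8 * M - 8 * M2"
  proof -
    define x where "x j = real j * \<theta>" for j :: nat
    define w where "w t = 1 / 2 - cos (2 * t) / 2" for t :: real
    have th: "sin (\<theta>) \<noteq> 0" using sin0[of 2 1] by simp
    \<comment> \<open>The shift by pi exchanges y and 1 - y, and 2 t + pi produces 4 y (1 - y).
      Expanding its logarithm leaves only \<open>g\<close> and \<open>g2\<close> at the angles t and
      t + pi, whose means do not depend on the phase.\<close>
    have pt: "g (cos (2 * t + pi)) = ln 4 * w t + 4 * g (cos t) - 4 * g2 (cos t)
        + 4 * g (cos (t + pi)) - 4 * g2 (cos (t + pi))" for t
    proof -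
      have 0: "(1 + cos t) / 2 = y t" by (simp add: y_def)
      have 1: "(1 + cos (t + pi)) / 2 = 1 - y t" by (simp add: y_def field_simps)
      have 2: "(1 + cos (2 * t + pi)) / 2 = 4 * (y t * (1 - y t))"
        by (simp only: y_def cos_periodic_pi cos_double_cos) (simp add: power2_eq_square field_simps)
      have 3: "w t = 4 * (y t * (1 - y t))"
        by (simp only: w_def y_def cos_periodic_pi cos_double_cos) (simp add: power2_eq_square field_simps)
      have y01: "0 \<le> y t" "y t \<le> 1" by (auto simp: y_def) (use cos_ge_minus_one[of t] in linarith)
      show ?thesis
      proof (cases "y t = 0 \<or> y t = 1")
        case True
        then show ?thesis unfolding g_def g2_def 0 1 2 3 by (auto simp: xlogx_def)
      next
        case False
        then have p: "0 < y t" "0 < 1 - y t" using y01 by auto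
        have "ln (4 * (y t * (1 - y t))) = ln 4 + (ln (y t) + ln (1 - y t))"
          using p by (simp add: ln_mult)
        then show ?thesis unfolding g_def g2_def 0 1 2 3 using p
          by (simp add: xlogx_def algebra_simps)
      qed
    qed
    have "(\<lambda>n. (\<Sum>j<n. g (cos (2 * x j + pi))) / real n) \<longlonglongrightarrow> M"
      using lim_g[of 2 pi] by (simp add: x_def algebra_simps)
    moreover have "(\<lambda>n. (\<Sum>j<n. g (cos (2 * x j + pi))) / real n) \<longlonglongrightarrow> ln 4 * (1 / 2) + 4 * M - 4 * M2 + 4 * M - 4 * M2"
    proof -
      have c2: "(\<lambda>n. (\<Sum>j<n. w (x j)) / real n) \<longlonglongrightarrow> 1 / 2"
      proof -
        have "(\<lambda>n. (\<Sum>j<n. cos (real j * (2 * \<theta>) + 0)) / real n) \<longlonglongrightarrow> 0"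
          using th by (intro cos_progression_mean) simp
        from tendsto_diff[OF tendsto_const[of "1/2"] tendsto_divide[OF this tendsto_const[of 2]]]
        have "(\<lambda>n. 1 / 2 - (\<Sum>j<n. cos (2 * x j)) / real n / 2) \<longlonglongrightarrow> 1 / 2" by (simp add: x_def mult_ac)
        then show ?thesis
        proof (rule Lim_transform_eventually)
          show "\<forall>\<^sub>F n in sequentially. 1 / 2 - (\<Sum>j<n. cos (2 * x j)) / real n / 2 = (\<Sum>j<n. w (x j)) / real n"
            using eventually_gt_at_top[of 0]
            by eventually_elim (simp add: w_def sum_subtractf field_simps flip: sum_divide_distrib)
        qed
      qed
      have 1: "(\<lambda>n. (\<Sum>j<n. g (cos (x j + c))) / real n) \<longlonglongrightarrow> M" for c
        using lim_g[of 1 c] by (simp add: x_def)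
      have 2: "(\<lambda>n. (\<Sum>j<n. g2 (cos (x j + c))) / real n) \<longlonglongrightarrow> M2" for c
        using lim_g2[of 1 c] by (simp add: x_def)
      have "(\<lambda>n. ln 4 * ((\<Sum>j<n. w (x j)) / real n) + 4 * ((\<Sum>j<n. g (cos (x j + 0))) / real n)
          - 4 * ((\<Sum>j<n. g2 (cos (x j + 0))) / real n) + 4 * ((\<Sum>j<n. g (cos (x j + pi))) / real n)
          - 4 * ((\<Sum>j<n. g2 (cos (x j + pi))) / real n)) \<longlonglongrightarrow> ln 4 * (1 / 2) + 4 * M - 4 * M2 + 4 * M - 4 * M2"
        by (intro tendsto_intros 1 2 c2)
      then show ?thesis unfolding pt
        by (simp only: sum.distrib sum_subtractf add_divide_distrib diff_divide_distrib add_0_right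
            times_divide_eq_right sum_distrib_left)
    qed
    ultimately have "M = ln 4 * (1 / 2) + 4 * M - 4 * M2 + 4 * M - 4 * M2" by (rule LIMSEQ_unique)
    moreover have "ln (4::real) = 2 * ln 2" using ln_realpow[of 2 2] by simp
    ultimately show ?thesis by simp
  qed
  have M: "M = 1 / 2 - ln 2" using parts doubling by linarith
  \<comment> \<open>By the double angle formula a squared cosine is (1 + cos)/2 at twice the angle,
    so the progression has step 2\<theta>.\<close>
  have "FF (cos ((real j + 1/2) * \<theta> + \<delta>)) = g (cos (real j * (real 2 * \<theta>) + (\<theta> + 2 * \<delta>)))" for j
    using cos_double_cos[of "(real j + 1/2) * \<theta> + \<delta>"]
    by (simp add: FF_eq_xlogx g_def algebra_simps)
  then show ?thesis using lim_g[of 2 "\<theta> + 2 * \<delta>"] M by simp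
qed

subsection \<open>Functions with algebraic singularities at both end points\<close>

text \<open>A crude form of Jordan's inequality: cos is at least 1/2 on [0, t/2], which gives sin
  (t/2) at least t/4 and then sin t = 2 sin (t/2) cos (t/2) at least t/4.\<close>

lemma sin_lower_bound:
  fixes t :: real
  assumes "0 \<le> t" "t \<le> pi / 2"
  shows "t / 4 \<le> sin t"
proof (cases "t = 0")
  case False
  then have t: "0 < t / 2" using assms by simp
  obtain z where z: "0 < z" "z < t / 2" "sin (t / 2) - sin 0 = (t / 2 - 0) * cos z"
    using MVT2[OF t, of sin cos] by (auto intro: DERIV_sin)
  have half: "1 / 2 \<le> cos x" if "0 \<le> x" "x \<le> t / 2" for x
  proof -
    have "x \<le> pi / 3" using that assms by simp
    then have "cos (pi / 3) \<le> cos x" using that by (intro cos_monotone_0_pi_le) auto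
    then show ?thesis by (simp add: cos_60)
  qed
  have "t / 4 \<le> sin (t / 2)"
  proof -
    have "t / 2 * (1 / 2) \<le> t / 2 * cos z"
      using half[of z] z t by (intro mult_left_mono) auto
    then show ?thesis using z(3) by simp
  qed
  then have "(t / 4) * (1 / 2) \<le> sin (t / 2) * cos (t / 2)"
    using half[of "t/2"] t by (intro mult_mono) auto
  then show ?thesis using sin_double[of "t / 2"] by simp
qed simp

text \<open>Up to the factor 4^s the function is dominated by the power of the distance to the
  nearer end point; adding both powers avoids splitting the interval.\<close>

lemma integrable_sin_powr:
  fixes s :: real
  assumes "0 \<le> s" "s < 1"
  shows "integrable half_circle (\<lambda>t. sin t powr (- s))"
proof -
  have *: "(\<lambda>t. t powr (-s)) absolutely_integrable_on {0<..<pi}"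
    "(\<lambda>t. (pi - t) powr (-s)) absolutely_integrable_on {0<..<pi}"
  proof -
    have "((\<lambda>t. t powr (-s)) has_integral pi powr (1 - s) / (1 - s) - 0 powr (1 - s) / (1 - s)) {0..pi}"
    proof (rule fundamental_theorem_of_calculus_interior)
      show "continuous_on {0..pi} (\<lambda>t. t powr (1 - s) / (1 - s))"
        by (intro continuous_on_divide continuous_on_minus continuous_on_powr' continuous_on_diff continuous_on_const continuous_on_id)
          (use assms in auto)
    qed (use assms in \<open>auto intro!: derivative_eq_intros simp flip: has_real_derivative_iff_has_vector_derivative\<close>)
    then show "(\<lambda>t. t powr (-s)) absolutely_integrable_on {0<..<pi}"
      by (intro nonnegative_absolutely_integrable_1) (auto simp: has_integral_Icc_iff_Ioo integrable_on_def)
    have "((\<lambda>t. (pi - t) powr (-s)) has_integral (- ((pi - pi) powr (1 - s)) / (1 - s)) - (- ((pi - 0) powr (1 - s)) / (1 - s))) {0..pi}"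
    proof (rule fundamental_theorem_of_calculus_interior)
      show "continuous_on {0..pi} (\<lambda>t. - ((pi - t) powr (1 - s)) / (1 - s))"
        by (intro continuous_on_divide continuous_on_minus continuous_on_powr' continuous_on_diff continuous_on_const continuous_on_id)
          (use assms in auto)
    qed (use assms in \<open>auto intro!: derivative_eq_intros simp flip: has_real_derivative_iff_has_vector_derivative\<close>)
    then show "(\<lambda>t. (pi - t) powr (-s)) absolutely_integrable_on {0<..<pi}"
      by (intro nonnegative_absolutely_integrable_1) (auto simp: has_integral_Icc_iff_Ioo integrable_on_def)
  qed
  then have "integrable half_circle (\<lambda>t. 4 powr s * (t powr (-s) + (pi - t) powr (-s)))"
    by (intro integrable_mult_right Bochner_Integration.integrable_add) (auto simp: integrable_restrict_space set_integrable_def)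
  then show ?thesis
  proof (rule integrable_half_circle_dominated[rotated])
    fix t :: real assume t: "0 < t" "t < pi"
    have neg: "x powr (-s) \<le> 4 powr s * y powr (-s)" if "0 < y" "y / 4 \<le> x" for x y :: real
    proof -
      have "x powr (-s) \<le> (y / 4) powr (-s)" using that assms by (intro powr_mono2') auto
      also have "\<dots> = 4 powr s * y powr (-s)" using that by (simp add: powr_divide powr_minus field_simps)
      finally show ?thesis .
    qed
    have "sin t powr (-s) \<le> 4 powr s * t powr (-s) \<or> sin t powr (-s) \<le> 4 powr s * (pi - t) powr (-s)"
    proof (cases "t \<le> pi / 2")
      case True
      then show ?thesis using neg[of t "sin t"] sin_lower_bound[of t] t by auto
    next
      case False
      then show ?thesis using neg[of "pi - t" "sin t"] sin_lower_bound[of "pi - t"] t by auto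
    qed
    then show "norm (sin t powr - s) \<le> 4 powr s * (t powr (-s) + (pi - t) powr (-s))"
      by (auto simp: distrib_left intro: order_trans)
  next
    show "continuous_on {0<..<pi} (\<lambda>t. sin t powr (- s))"
      using sin_gt_zero by (intro continuous_intros) (force simp: less_le)+
  qed
qed

text \<open>The shape of the Szego function of a Jacobi-type weight. \<open>E\<close> is a parameter
  because the class must absorb several operations: reciprocals, derivatives, and products with z^j
  all have this shape with other exponents and another \<open>E\<close>. Principal powers are
  harmless, as 1 - z and 1 + z avoid the cut on the closed disc away from 1 and -1.\<close>

definition jacobi_fun :: "real \<Rightarrow> real \<Rightarrow> (complex \<Rightarrow> complex) \<Rightarrow> complex \<Rightarrow> complex" where
  "jacobi_fun a b E z = (1 - z) powr of_real a * (1 + z) powr of_real b * E z"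

lemma slit_disc:
  fixes z :: complex
  assumes "norm z \<le> 1" "z \<noteq> 1" "z \<noteq> -1"
  shows "1 - z \<notin> \<real>\<^sub>\<le>\<^sub>0" "1 + z \<notin> \<real>\<^sub>\<le>\<^sub>0"
proof -
  have "\<bar>Re z\<bar> \<noteq> 1"
  proof
    assume r: "\<bar>Re z\<bar> = 1"
    have "(Re z)\<^sup>2 + (Im z)\<^sup>2 \<le> 1" using assms(1) by (simp add: cmod_def)
    then have "Im z = 0" using r by (metis add_le_same_cancel1 one_power2 power2_abs power2_less_eq_zero_iff)
    then show False using r assms by (auto simp: complex_eq_iff abs_if split: if_splits)
  qed
  moreover have "\<bar>Re z\<bar> \<le> 1" using abs_Re_le_cmod[of z] assms(1) by linarith
  ultimately have "\<bar>Re z\<bar> < 1" by linarith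
  then show "1 - z \<notin> \<real>\<^sub>\<le>\<^sub>0" "1 + z \<notin> \<real>\<^sub>\<le>\<^sub>0" by (auto simp: complex_nonpos_Reals_iff)
qed

text \<open>The product rule with the lowest powers pulled out. What is left in the bracket involves
  only \<open>E\<close> and its derivative, so differentiation lowers both exponents by one and
  stays inside the class.\<close>

lemma jacobi_fun_has_field_derivative:
  assumes "norm z \<le> 1" "z \<noteq> 1" "z \<noteq> -1" "(E has_field_derivative E') (at z)"
  shows "(jacobi_fun a b E has_field_derivative
     (1 - z) powr of_real (a - 1) * (1 + z) powr of_real (b - 1) *
       (- of_real a * (1 + z) * E z + of_real b * (1 - z) * E z + (1 - z) * (1 + z) * E')) (at z)"
proof -
  note s = slit_disc[OF assms(1-3)]
  have p: "(1 - z) powr of_real a = (1 - z) powr of_real (a - 1) * (1 - z)"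
    "(1 + z) powr of_real b = (1 + z) powr of_real (b - 1) * (1 + z)"
    using powr_add[of "1 - z" "of_real (a - 1)" 1] powr_add[of "1 + z" "of_real (b - 1)" 1] assms
    by (auto simp: add_eq_0_iff)
  have "((\<lambda>z. (1 - z) powr of_real a) has_field_derivative of_real a * (1 - z) powr of_real (a - 1) * (-1)) (at z)"
    using s(1) by (auto intro!: derivative_eq_intros has_field_derivative_powr)
  moreover have "((\<lambda>z. (1 + z) powr of_real b) has_field_derivative of_real b * (1 + z) powr of_real (b - 1)) (at z)"
    using s(2) by (auto intro!: derivative_eq_intros has_field_derivative_powr)
  ultimately have "(jacobi_fun a b E has_field_derivative
     ((of_real a * (1 - z) powr of_real (a - 1) * (-1)) * (1 + z) powr of_real b + (of_real b * (1 + z) powr of_real (b - 1)) * (1 - z) powr of_real a) * E z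
       + E' * ((1 - z) powr of_real a * (1 + z) powr of_real b)) (at z)"
    unfolding jacobi_fun_def by (intro DERIV_mult assms)
  then show ?thesis
    by (rule DERIV_cong) (unfold p, simp add: algebra_simps)
qed

lemma jacobi_fun_deriv:
  assumes R: "1 < R" and E: "E holomorphic_on ball 0 R" and z: "norm z \<le> 1" "z \<noteq> 1" "z \<noteq> -1"
  shows "(jacobi_fun a b E has_field_derivative
     jacobi_fun (a - 1) (b - 1) (\<lambda>z. - of_real a * (1 + z) * E z + of_real b * (1 - z) * E z + (1 - z) * (1 + z) * deriv E z) z) (at z)"
  unfolding jacobi_fun_def[of "a - 1"]
  by (rule jacobi_fun_has_field_derivative[OF z holomorphic_derivI[OF E]]) (use z R in auto)

lemma isCont_jacobi_fun:
  assumes "1 < R" "E holomorphic_on ball 0 R" "norm z \<le> 1" "z \<noteq> 1" "z \<noteq> -1"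
  shows "isCont (jacobi_fun a b E) z"
  using jacobi_fun_deriv[OF assms] by (rule DERIV_isCont)

lemma jacobi_fun_holomorphic:
  assumes "1 < R" "E holomorphic_on ball 0 R"
  shows "jacobi_fun a b E holomorphic_on ball 0 1"
proof (rule holomorphic_onI)
  fix z :: complex assume "z \<in> ball 0 1"
  then have "norm z \<le> 1" "z \<noteq> 1" "z \<noteq> -1" by auto
  from jacobi_fun_deriv[OF assms this, THEN has_field_derivative_at_within]
  show "jacobi_fun a b E field_differentiable at z within ball 0 1"
    unfolding field_differentiable_def by blast
qed

lemma norm_jacobi_fun:
  "norm (jacobi_fun a b E z) = norm (1 - z) powr a * norm (1 + z) powr b * norm (E z)"
  by (simp add: jacobi_fun_def norm_mult norm_powr_real_powr')

lemma jacobi_fun_real: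
  assumes "E (of_real x) \<in> \<real>" "\<bar>x\<bar> < 1"
  shows "jacobi_fun a b E (of_real x) \<in> \<real>"
proof -
  have "(1 - complex_of_real x) powr of_real a = of_real ((1 - x) powr a)"
    "(1 + complex_of_real x) powr of_real b = of_real ((1 + x) powr b)"
    using powr_of_real[of "1 - x" a] powr_of_real[of "1 + x" b] assms by auto
  then show ?thesis using assms(1) unfolding jacobi_fun_def by (metis Reals_mult Reals_of_real)
qed

lemma jacobi_fun_inverse:
  "inverse (jacobi_fun a b E z) = jacobi_fun (- a) (- b) (\<lambda>z. inverse (E z)) z"
  by (simp add: jacobi_fun_def powr_minus)

lemma cis_not_pm1: "0 < t \<Longrightarrow> t < pi \<Longrightarrow> cis t \<noteq> 1" "0 < t \<Longrightarrow> t < pi \<Longrightarrow> cis t \<noteq> -1"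
  using sin_gt_zero[of t] by (auto simp: complex_eq_iff)

lemma continuous_on_jacobi_fun_cis:
  assumes "1 < R" "E holomorphic_on ball 0 R"
  shows "continuous_on {0<..<pi} (\<lambda>t. jacobi_fun a b E (cis t))"
proof -
  have "isCont (\<lambda>t. jacobi_fun a b E (cis t)) t" if "t \<in> {0<..<pi}" for t
  proof -
    have "isCont cis t" unfolding cis_conv_exp[abs_def] by (intro continuous_intros)
    moreover have "isCont (jacobi_fun a b E) (cis t)"
      using that cis_not_pm1[of t] by (intro isCont_jacobi_fun[OF assms]) auto
    ultimately show ?thesis by (rule isCont_o2)
  qed
  then show ?thesis by (simp add: continuous_at_imp_continuous_on)
qed

text \<open>The distance of 1 from the line through the origin in direction e^(it) is |sin t|. The
  bound does not involve r, as a majorant for r tending to 1 requires.\<close>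

lemma sin_le_norm_one_minus_ray:
  assumes "0 \<le> r"
  shows "\<bar>sin t\<bar> \<le> norm (1 - of_real r * cis t)" "\<bar>sin t\<bar> \<le> norm (1 + of_real r * cis t)"
proof -
  have "(sin t)\<^sup>2 \<le> (norm (1 - of_real r * cis t))\<^sup>2"
  proof -
    have "(norm (1 - of_real r * cis t))\<^sup>2 = (r - cos t)\<^sup>2 + (sin t)\<^sup>2"
    proof -
      have "(norm (1 - of_real r * cis t))\<^sup>2 = (1 - r * cos t)\<^sup>2 + (r * sin t)\<^sup>2"
        by (simp add: cmod_power2)
      then show ?thesis using sin_cos_squared_add[of t] by algebra
    qed
    then show ?thesis by simp
  qed
  then show "\<bar>sin t\<bar> \<le> norm (1 - of_real r * cis t)"
    by (metis abs_le_square_iff abs_norm_cancel)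
  have "(sin t)\<^sup>2 \<le> (norm (1 + of_real r * cis t))\<^sup>2"
  proof -
    have "(norm (1 + of_real r * cis t))\<^sup>2 = (r + cos t)\<^sup>2 + (sin t)\<^sup>2"
    proof -
      have "(norm (1 + of_real r * cis t))\<^sup>2 = (1 + r * cos t)\<^sup>2 + (r * sin t)\<^sup>2"
        by (simp add: cmod_power2)
      then show ?thesis using sin_cos_squared_add[of t] by algebra
    qed
    then show ?thesis by simp
  qed
  then show "\<bar>sin t\<bar> \<le> norm (1 + of_real r * cis t)"
    by (metis abs_le_square_iff abs_norm_cancel)
qed

lemma powr_bounded_by_negative_part:
  fixes x \<sigma> a :: real
  assumes "0 < \<sigma>" "\<sigma> \<le> x" "x \<le> 2"
  shows "x powr a \<le> 2 powr \<bar>a\<bar> * \<sigma> powr (- max 0 (- a))"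
proof (cases "a \<ge> 0")
  case True
  then have "x powr a \<le> 2 powr a" using assms by (intro powr_mono2) auto
  then show ?thesis using True assms by simp
next
  case False
  then have "x powr a \<le> \<sigma> powr a" using assms by (intro powr_mono2') auto
  moreover have "1 * \<sigma> powr a \<le> 2 powr \<bar>a\<bar> * \<sigma> powr a"
    by (rule mult_right_mono) (auto simp: ge_one_powr_ge_zero)
  ultimately show ?thesis using False by simp
qed

text \<open>The singularities at 1 and -1 are weak enough for a majorant uniform in the radius, so
  the mean value property survives on the unit circle itself. At 0 both powers are 1, which leaves
  \<open>E 0\<close>.\<close>

lemma jacobi_fun_mean_value:
  assumes R: "1 < R" and E: "E holomorphic_on ball 0 R" and re: "\<And>x. \<bar>x\<bar> < 1 \<Longrightarrow> E (of_real x) \<in> \<real>"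
    and ab: "- 1/2 < a" "- 1/2 < b"
  shows "integrable half_circle (\<lambda>t. Re (jacobi_fun a b E (cis t)))"
    and "integral\<^sup>L half_circle (\<lambda>t. Re (jacobi_fun a b E (cis t))) = pi * Re (E 0)"
proof -
  let ?J = "jacobi_fun a b E"
  have contE: "continuous_on (cball 0 1) E"
    using E R by (auto intro!: holomorphic_on_imp_continuous_on elim!: holomorphic_on_subset)
  obtain K where K: "\<And>w. w \<in> cball 0 1 \<Longrightarrow> norm (E w) \<le> K"
    using compact_imp_bounded[OF compact_continuous_image[OF contE compact_cball]] unfolding bounded_iff by (metis image_eqI)
  \<comment> \<open>Each negative part is below 1/2, so even their sum is below 1 and the power of
    sin is integrable.\<close>
  define s where "s = max 0 (- a) + max 0 (- b)"
  have s: "0 \<le> s" "s < 1" using ab by (auto simp: s_def)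
  define B where "B t = 2 powr \<bar>a\<bar> * 2 powr \<bar>b\<bar> * K * sin t powr (- s)" for t
  have B: "integrable half_circle B"
    unfolding B_def by (intro integrable_mult_right integrable_sin_powr s)
  have bound: "norm (?J (of_real r * cis t)) \<le> B t" if r: "0 \<le> r" "r < 1" and t: "0 < t" "t < pi" for r t
  proof -
    have st: "sin t > 0" using t by (rule sin_gt_zero)
    let ?w = "of_real r * cis t"
    have w: "norm ?w \<le> 1" using r by (simp add: norm_mult)
    have "norm (1 - ?w) \<le> 2" "norm (1 + ?w) \<le> 2"
      using norm_triangle_ineq4[of 1 ?w] norm_triangle_ineq[of 1 ?w] w by auto
    then have "norm (1 - ?w) powr a \<le> 2 powr \<bar>a\<bar> * sin t powr (- max 0 (- a))"
      "norm (1 + ?w) powr b \<le> 2 powr \<bar>b\<bar> * sin t powr (- max 0 (- b))"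
      using sin_le_norm_one_minus_ray[OF r(1), of t] st by (auto intro!: powr_bounded_by_negative_part)
    then have "norm (?J ?w) \<le> (2 powr \<bar>a\<bar> * sin t powr (- max 0 (- a))) * (2 powr \<bar>b\<bar> * sin t powr (- max 0 (- b))) * K"
      unfolding norm_jacobi_fun using K[of ?w] w by (intro mult_mono) auto
    also have "\<dots> = B t"
      unfolding B_def s_def minus_add_distrib powr_add by simp
    finally show ?thesis .
  qed
  have lim: "((\<lambda>r. ?J (of_real r * cis t)) \<longlongrightarrow> ?J (cis t)) (at_left 1)" if "0 < t" "t < pi" for t
  proof -
    have "isCont ?J (cis t)" using that cis_not_pm1[of t] by (intro isCont_jacobi_fun[OF R E]) auto
    moreover have "((\<lambda>r. of_real r * cis t) \<longlongrightarrow> cis t) (at_left 1)"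
      by (auto intro!: tendsto_eq_intros)
    ultimately show ?thesis by (rule isCont_tendsto_compose)
  qed
  note hyps = real_taylor[OF jacobi_fun_holomorphic[OF R E] jacobi_fun_real[where E=E, OF re]] B bound lim
  show "integrable half_circle (\<lambda>t. Re (?J (cis t)))"
    by (rule half_circle_mean_value(1)[OF hyps]) auto
  have "integral\<^sup>L half_circle (\<lambda>t. Re (?J (cis t))) = pi * Re ((deriv ^^ 0) ?J 0 / fact 0)"
    by (rule half_circle_mean_value(2)[OF hyps]) auto
  then show "integral\<^sup>L half_circle (\<lambda>t. Re (?J (cis t))) = pi * Re (E 0)"
    by (simp add: jacobi_fun_def)
qed

section \<open>Absolutely convergent boundary series for large exponents\<close>

lemma jacobi_fun_bounded:
  assumes R: "1 < R" and E: "E holomorphic_on ball 0 R" and ab: "0 \<le> a" "0 \<le> b"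
  obtains K where "\<And>z. norm z < 1 \<Longrightarrow> norm (jacobi_fun a b E z) \<le> K"
proof -
  have contE: "continuous_on (cball 0 1) E"
    using E R by (auto intro!: holomorphic_on_imp_continuous_on elim!: holomorphic_on_subset)
  obtain K where K: "\<And>w. w \<in> cball 0 1 \<Longrightarrow> norm (E w) \<le> K"
    using compact_imp_bounded[OF compact_continuous_image[OF contE compact_cball]] unfolding bounded_iff by (metis image_eqI)
  have "norm (jacobi_fun a b E z) \<le> 2 powr a * 2 powr b * K" if z: "norm z < 1" for z
  proof -
    have "norm (1 - z) \<le> 2" "norm (1 + z) \<le> 2"
      using norm_triangle_ineq4[of 1 z] norm_triangle_ineq[of 1 z] z by auto
    then show ?thesis unfolding norm_jacobi_fun using ab z K[of z]
      by (intro mult_mono powr_mono2) auto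
  qed
  then show thesis by (rule that)
qed

text \<open>Exponents of at least 2 keep the second derivative bounded on the disc. Cauchy's
  estimate on radius r, with r tending to 1, bounds its Taylor coefficients, so those of the
  function are O(1/k^2).\<close>

lemma jacobi_fun_taylor_summable:
  assumes R: "1 < R" and E: "E holomorphic_on ball 0 R" and ab: "2 \<le> a" "2 \<le> b"
  shows "summable (\<lambda>k. norm ((deriv ^^ k) (jacobi_fun a b E) 0 / fact k))"
proof -
  let ?J = "jacobi_fun a b E"
  define E1 where "E1 z = - of_real a * (1 + z) * E z + of_real b * (1 - z) * E z + (1 - z) * (1 + z) * deriv E z" for z
  define E2 where "E2 z = - of_real (a - 1) * (1 + z) * E1 z + of_real (b - 1) * (1 - z) * E1 z + (1 - z) * (1 + z) * deriv E1 z" for z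
  have E1: "E1 holomorphic_on ball 0 R" unfolding E1_def by (intro holomorphic_intros E) auto
  have E2: "E2 holomorphic_on ball 0 R" unfolding E2_def by (intro holomorphic_intros E1) auto
  have ne: "z \<noteq> 1" "z \<noteq> -1" if "norm z < 1" for z :: complex using that by auto
  have d1: "deriv ?J z = jacobi_fun (a - 1) (b - 1) E1 z" if "z \<in> ball 0 1" for z
    using jacobi_fun_deriv[OF R E _ ne, of z a b] that unfolding E1_def by (intro DERIV_imp_deriv) auto
  have d2: "deriv (deriv ?J) z = jacobi_fun (a - 2) (b - 2) E2 z" if "z \<in> ball 0 1" for z
  proof -
    have "deriv (deriv ?J) z = deriv (jacobi_fun (a - 1) (b - 1) E1) z"
      by (rule deriv_cong_ev) (use that d1 eventually_nhds_in_open[of "ball 0 1" z] in \<open>auto elim!: eventually_mono\<close>)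
    also have "\<dots> = jacobi_fun (a - 1 - 1) (b - 1 - 1) E2 z"
      using jacobi_fun_deriv[OF R E1 _ ne, of z "a - 1" "b - 1"] that unfolding E2_def by (intro DERIV_imp_deriv) auto
    finally show ?thesis by simp
  qed
  obtain K where K: "\<And>z. norm z < 1 \<Longrightarrow> norm (jacobi_fun (a - 2) (b - 2) E2 z) \<le> K"
    using jacobi_fun_bounded[OF R E2, of "a - 2" "b - 2"] ab by auto
  let ?D = "deriv (deriv ?J)"
  have D: "?D holomorphic_on ball 0 1"
    by (intro holomorphic_deriv jacobi_fun_holomorphic[OF R E]) auto
  have bd: "norm ((deriv ^^ n) ?D 0) \<le> fact n * K" for n
  proof -
    have "norm ((deriv ^^ n) ?D 0) \<le> fact n * K / r ^ n" if r: "0 < r" "r < 1" for r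
    proof (rule Cauchy_inequality)
      show "?D holomorphic_on ball 0 r" by (rule holomorphic_on_subset[OF D]) (use r in auto)
      show "continuous_on (cball 0 r) ?D"
        by (rule holomorphic_on_imp_continuous_on[OF holomorphic_on_subset[OF D]]) (use r in auto)
    qed (use r d2 K in auto)
    then have "\<forall>\<^sub>F r in at_left 1. norm ((deriv ^^ n) ?D 0) \<le> fact n * K / r ^ n"
      unfolding eventually_at_left_field by (intro exI[of _ 0]) auto
    moreover have "((\<lambda>r. fact n * K / r ^ n) \<longlongrightarrow> fact n * K) (at_left 1)"
      by (auto intro!: tendsto_eq_intros)
    ultimately show ?thesis
      by (intro tendsto_lowerbound[where F="at_left (1::real)"]) auto
  qed
  have b1: "norm ((deriv ^^ (n + 2)) ?J 0 / fact (n + 2)) \<le> K * (1 / real (n + 1) ^ 2)" for n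
  proof -
    have "(deriv ^^ (n + 2)) ?J = (deriv ^^ n) ?D" by (simp only: funpow_add o_apply) (simp add: numeral_2_eq_2)
    then have "norm ((deriv ^^ (n + 2)) ?J 0 / fact (n + 2)) = norm ((deriv ^^ n) ?D 0) / fact (n + 2)"
      by (simp only: norm_divide norm_fact)
    also have "\<dots> \<le> fact n * K / fact (n + 2)" by (intro divide_right_mono bd) auto
    also have "\<dots> = K / (real (n + 1) * real (n + 2))"
    proof -
      have "fact (n + 2) = fact n * (real (n + 1) * real (n + 2))" by (simp add: algebra_simps)
      then show ?thesis by (simp only: mult_divide_mult_cancel_left[OF fact_nonzero])
    qed
    also have "\<dots> \<le> K / real (n + 1) ^ 2"
    proof -
      have "K \<ge> 0" using bd[of 0] by (simp add: order_trans[OF norm_ge_zero])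
      then show ?thesis by (intro divide_left_mono) (auto simp: power2_eq_square)
    qed
    finally show ?thesis by simp
  qed
  have b2: "summable (\<lambda>n. K * (1 / real (n + 1) ^ 2))"
    using inverse_power_summable[of 2, where 'a=real] summable_Suc_iff[of "\<lambda>n. 1 / real n ^ 2"]
    by (intro summable_mult) (simp add: inverse_eq_divide)
  have "summable (\<lambda>n. norm ((deriv ^^ (n + 2)) ?J 0 / fact (n + 2)))"
    by (rule summable_comparison_test[OF _ b2], rule exI[of _ 0], clarify, unfold real_norm_def abs_norm_cancel, rule b1)
  then show ?thesis using summable_iff_shift[of "\<lambda>k. norm ((deriv ^^ k) ?J 0 / fact k)" 2] by simp
qed

text \<open>By absolute summability the power series is continuous on the closed disc. It equals the
  function inside, and radial limits identify the two at every e^(it) with t strictly between 0 and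
  pi.\<close>

lemma jacobi_fun_boundary_series:
  assumes R: "1 < R" and E: "E holomorphic_on ball 0 R" and re: "\<And>x. \<bar>x\<bar> < 1 \<Longrightarrow> E (of_real x) \<in> \<real>"
    and ab: "2 \<le> a" "2 \<le> b"
  obtains c :: "nat \<Rightarrow> real" where "summable (\<lambda>k. \<bar>c k\<bar>)"
    "\<And>t. 0 < t \<Longrightarrow> t < pi \<Longrightarrow> (\<lambda>k. of_real (c k) * cis (real k * t)) sums jacobi_fun a b E (cis t)"
proof -
  let ?J = "jacobi_fun a b E"
  define c where "c k = Re ((deriv ^^ k) ?J 0 / fact k)" for k
  have c: "(\<lambda>k. of_real (c k) * z ^ k) sums ?J z" if "norm z < 1" for z
    unfolding c_def by (rule real_taylor[OF jacobi_fun_holomorphic[OF R E] jacobi_fun_real[where E=E, OF re] that]) auto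
  have summ: "summable (\<lambda>k. \<bar>c k\<bar>)"
    by (rule summable_comparison_test[OF _ jacobi_fun_taylor_summable[OF R E ab]])
      (auto simp: c_def abs_Re_le_cmod simp del: Re_divide_of_nat)
  define g where "g z = (\<Sum>k. of_real (c k) * z ^ k)" for z :: complex
  have sm: "summable (\<lambda>k. of_real (c k) * z ^ k)" if "norm z \<le> 1" for z :: complex
    by (rule summable_comparison_test[OF _ summ])
      (use that in \<open>auto simp: norm_mult norm_power intro!: mult_left_le power_le_one\<close>)
  have "uniform_limit (cball 0 1) (\<lambda>n z. \<Sum>k<n. of_real (c k) * z ^ k) g sequentially"
    unfolding g_def
    by (rule Weierstrass_m_test[OF _ summ])
      (auto simp: norm_mult norm_power intro!: mult_left_le power_le_one)
  then have contg: "continuous_on (cball 0 1) g"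
    by (rule uniform_limit_theorem[rotated]) (auto intro!: always_eventually continuous_intros)
  have eq: "g (cis t) = ?J (cis t)" if t: "0 < t" "t < pi" for t
  proof -
    have "((\<lambda>r. ?J (of_real r * cis t)) \<longlongrightarrow> ?J (cis t)) (at_left 1)"
    proof -
      have "isCont ?J (cis t)" using t cis_not_pm1[of t] by (intro isCont_jacobi_fun[OF R E]) auto
      moreover have "((\<lambda>r. of_real r * cis t) \<longlongrightarrow> cis t) (at_left 1)"
        by (auto intro!: tendsto_eq_intros)
      ultimately show ?thesis by (rule isCont_tendsto_compose)
    qed
    moreover have ev: "\<forall>\<^sub>F r::real in at_left 1. 0 < r \<and> r < 1"
      unfolding eventually_at_left_field by (intro exI[of _ 0]) auto
    have "((\<lambda>r. g (of_real r * cis t)) \<longlongrightarrow> g (cis t)) (at_left 1)"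
    proof (rule continuous_on_tendsto_compose[OF contg])
      show "((\<lambda>r. of_real r * cis t) \<longlongrightarrow> cis t) (at_left 1)"
        by (auto intro!: tendsto_eq_intros)
      show "\<forall>\<^sub>F r in at_left 1. of_real r * cis t \<in> cball 0 1"
        using ev by eventually_elim (auto simp: norm_mult)
    qed auto
    then have "((\<lambda>r. ?J (of_real r * cis t)) \<longlongrightarrow> g (cis t)) (at_left 1)"
      by (rule Lim_transform_eventually)
        (use ev in eventually_elim, use c in \<open>auto simp: g_def sums_iff norm_mult\<close>)
    ultimately show ?thesis by (intro tendsto_unique[of "at_left (1::real)"]) auto
  qed
  have "(\<lambda>k. of_real (c k) * cis (real k * t)) sums ?J (cis t)" if t: "0 < t" "t < pi" for t
    using summable_sums[OF sm[of "cis t"]] eq[OF t] by (simp add: g_def Complex.DeMoivre)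
  then show thesis using that summ by blast
qed

subsection \<open>Weighted square integrable functions on the half circle\<close>

definition cos_span :: "nat \<Rightarrow> (real \<Rightarrow> real) \<Rightarrow> bool" where
  "cos_span n g \<longleftrightarrow> (\<exists>a. \<forall>t. g t = (\<Sum>k\<le>n. a k * cos (real k * t)))"

lemma cos_span_cos: "k \<le> n \<Longrightarrow> cos_span n (\<lambda>t. cos (real k * t))"
  unfolding cos_span_def
  by (intro exI[of _ "\<lambda>j. if j = k then 1 else 0"])
    (simp add: if_distrib[of "\<lambda>x. x * _"] sum.delta cong: if_cong)

lemma cos_span_scale: "cos_span n g \<Longrightarrow> cos_span n (\<lambda>t. c * g t)"
proof -
  assume "cos_span n g"
  then obtain a where a: "\<And>t. g t = (\<Sum>k\<le>n. a k * cos (real k * t))" by (auto simp: cos_span_def)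
  show ?thesis unfolding cos_span_def
    by (intro exI[of _ "\<lambda>k. c * a k"]) (simp add: a sum_distrib_left mult.assoc)
qed

lemma cos_span_add:
  assumes "cos_span n g" "cos_span n h"
  shows "cos_span n (\<lambda>t. g t + h t)"
proof -
  obtain a b where a: "\<And>t. g t = (\<Sum>k\<le>n. a k * cos (real k * t))"
    and b: "\<And>t. h t = (\<Sum>k\<le>n. b k * cos (real k * t))"
    using assms by (auto simp: cos_span_def)
  show ?thesis unfolding cos_span_def
    by (intro exI[of _ "\<lambda>k. a k + b k"]) (simp add: a b sum.distrib distrib_right)
qed

lemma cos_span_sum:
  assumes "finite I" "\<And>i. i \<in> I \<Longrightarrow> cos_span n (g i)"
  shows "cos_span n (\<lambda>t. \<Sum>i\<in>I. g i t)"
  using assms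
proof (induction I rule: finite_induct)
  case empty
  show ?case unfolding cos_span_def by (intro exI[of _ "\<lambda>k. 0"]) simp
next
  case (insert i I)
  then show ?case by (simp add: cos_span_add)
qed

lemma cos_times_cos_multiple:
  "cos t * cos (real k * t) = cos (real (Suc k) * t) / 2 + cos (real (if k = 0 then 1 else k - 1) * t) / 2"
proof -
  have "cos (real (if k = 0 then 1 else k - 1) * t) = cos (real k * t - t)"
    by (cases "k = 0") (auto simp: algebra_simps of_nat_diff)
  moreover have "cos (real (Suc k) * t) = cos (real k * t + t)" by (simp add: algebra_simps)
  ultimately show ?thesis by (simp add: cos_add cos_diff field_simps)
qed

lemma cos_span_poly:
  assumes "degree Q \<le> n"
  shows "cos_span n (\<lambda>t. poly Q (cos t))"
  using assms
proof (induction Q arbitrary: n)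
  case 0
  show ?case using cos_span_scale[OF cos_span_cos[of 0 n], of 0] by simp
next
  case (pCons c Q)
  have c: "cos_span n (\<lambda>t. c)" using cos_span_scale[OF cos_span_cos[of 0 n], of c] by simp
  show ?case
  proof (cases "Q = 0")
    case False
    then obtain n' where n: "n = Suc n'" "degree Q \<le> n'"
      using pCons.prems by (cases n) auto
    from pCons.IH[OF n(2)] obtain a where a: "\<And>t. poly Q (cos t) = (\<Sum>k\<le>n'. a k * cos (real k * t))"
      by (auto simp: cos_span_def)
    have "cos_span n (\<lambda>t. \<Sum>k\<le>n'. a k * (1 / 2 * cos (real (Suc k) * t) + 1 / 2 * cos (real (if k = 0 then 1 else k - 1) * t)))"
      by (intro cos_span_sum cos_span_scale cos_span_add cos_span_cos) (auto simp: n)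
    moreover have "cos t * poly Q (cos t) = (\<Sum>k\<le>n'. a k * (1 / 2 * cos (real (Suc k) * t) + 1 / 2 * cos (real (if k = 0 then 1 else k - 1) * t)))" for t
    proof -
      have "cos t * poly Q (cos t) = (\<Sum>k\<le>n'. a k * (cos t * cos (real k * t)))"
        unfolding a sum_distrib_left by (intro sum.cong) auto
      then show ?thesis by (simp only: cos_times_cos_multiple) (simp add: field_simps)
    qed
    ultimately have "cos_span n (\<lambda>t. cos t * poly Q (cos t))" by simp
    then show ?thesis using cos_span_add[OF c] by simp
  qed (use c in simp)
qed

text \<open>The converse of \<open>cos_span_poly\<close> for a single frequency. The induction
  carries two consecutive degrees because the recurrence has three terms.\<close>

lemma chebyshev_poly_exists:
  "\<exists>T :: real poly. degree T \<le> k \<and> (\<forall>t. poly T (cos t) = cos (real k * t))"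
proof -
  have "(\<exists>T :: real poly. degree T \<le> k \<and> (\<forall>t. poly T (cos t) = cos (real k * t))) \<and>
    (\<exists>T :: real poly. degree T \<le> Suc k \<and> (\<forall>t. poly T (cos t) = cos (real (Suc k) * t)))"
  proof (induction k)
    case 0
    show ?case by (intro conjI exI[of _ 1] exI[of _ "[:0, 1:]"]) auto
  next
    case (Suc k)
    then obtain T U :: "real poly" where T: "degree T \<le> k" "\<And>t. poly T (cos t) = cos (real k * t)"
      and U: "degree U \<le> Suc k" "\<And>t. poly U (cos t) = cos (real (Suc k) * t)" by auto
    have "degree ([:0, 2:] * U) \<le> Suc (Suc k)"
      using U(1) degree_mult_le[of "[:0, 2::real:]" U] by simp
    then have "degree ([:0, 2:] * U - T) \<le> Suc (Suc k)"
      using T(1) by (intro degree_diff_le) auto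
    moreover have "poly ([:0, 2:] * U - T) (cos t) = cos (real (Suc (Suc k)) * t)" for t
      using cos_times_cos_multiple[of t "Suc k"] by (simp add: T U)
    ultimately show ?case using U by blast
  qed
  then show ?thesis by blast
qed

text \<open>Leading terms are removed one degree at a time. The bound on Q is stated through
  vanishing coefficients, so that n = 0 forces Q = 0 and the induction can start there.\<close>

lemma graded_poly_basis:
  fixes P :: "nat \<Rightarrow> 'a::field poly"
  assumes P: "\<And>n. degree (P n) = n" "\<And>n. P n \<noteq> 0" and Q: "\<And>i. i \<ge> n \<Longrightarrow> coeff Q i = 0"
  shows "\<exists>d. Q = (\<Sum>j<n. smult (d j) (P j))"
  using Q
proof (induction n arbitrary: Q)
  case 0
  then show ?case by (auto simp: poly_eq_iff)
next
  case (Suc n)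
  have lc: "coeff (P n) n \<noteq> 0" using P(1)[of n] P(2)[of n] leading_coeff_0_iff[of "P n"] by simp
  define c where "c = coeff Q n / coeff (P n) n"
  have "coeff (Q - smult c (P n)) i = 0" if "i \<ge> n" for i
  proof (cases "i = n")
    case True
    then show ?thesis using lc by (simp add: c_def)
  next
    case False
    then have "coeff (P n) i = 0" using that P(1)[of n] by (intro coeff_eq_0) auto
    then show ?thesis using Suc.prems[of i] False that by simp
  qed
  from Suc.IH[OF this] obtain d where d: "Q - smult c (P n) = (\<Sum>j<n. smult (d j) (P j))" by blast
  have "Q = (\<Sum>j<Suc n. smult ((d(n := c)) j) (P j))"
    using d by (simp add: algebra_simps)
  then show ?case by blast
qed

section \<open>Orthogonality of cosines and the Chebyshev kernel\<close>

lemma integral_half_circle_cos_cos: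
  "integral\<^sup>L half_circle (\<lambda>t. cos (real j * t) * cos (real k * t)) =
    (if j = k then (if j = 0 then pi else pi / 2) else 0)"
proof -
  have eq: "cos (real j * t) * cos (real k * t) = (cos (real (j + k) * t) + cos (real (if j \<le> k then k - j else j - k) * t)) / 2" for t
  proof -
    have "cos (real (if j \<le> k then k - j else j - k) * t) = cos (real j * t - real k * t)"
      using cos_minus[of "real k * t - real j * t"] by (auto simp: of_nat_diff algebra_simps)
    then show ?thesis by (simp add: algebra_simps cos_add cos_diff)
  qed
  have i: "integrable half_circle (\<lambda>t. cos (real j * t))" for j
    by (rule integrable_half_circle_bounded[where B=1]) (auto intro!: continuous_intros)
  show ?thesis unfolding eq
    by (simp only: integral_divide_zero Bochner_Integration.integral_add[OF i i] integral_half_circle_cos) auto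
qed

text \<open>This is pi times the reproducing kernel of the Chebyshev polynomials of the first kind.
  The constant function has squared norm pi and the other cosines pi/2, hence the factor 2 from k =
  1 on.\<close>

definition cos_kernel :: "real \<Rightarrow> nat \<Rightarrow> real \<Rightarrow> real" where
  "cos_kernel \<theta> N t = 1 + (\<Sum>k=1..N. 2 * cos (real k * \<theta>) * cos (real k * t))"

text \<open>The recurrence 2 cos x cos (k x) = cos ((k+1) x) + cos ((k-1) x), used at \<theta> and
  at t, makes the sum telescope. Keeping the factor cos \<theta> - cos t on the left avoids an
  exception at t = \<theta>.\<close>

lemma cos_kernel_christoffel_darboux:
  "cos_kernel \<theta> N t * (cos \<theta> - cos t) = cos (real (Suc N) * \<theta>) * cos (real N * t) - cos (real N * \<theta>) * cos (real (Suc N) * t)"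
proof (induction N)
  case 0
  then show ?case by (simp add: cos_kernel_def)
next
  case (Suc N)
  have r: "2 * cos x * cos (real (Suc N) * x) = cos (real (Suc (Suc N)) * x) + cos (real N * x)" for x
    using cos_times_cos_multiple[of x "Suc N"] by simp
  have "cos_kernel \<theta> (Suc N) t * (cos \<theta> - cos t) = cos_kernel \<theta> N t * (cos \<theta> - cos t) +
      (2 * cos \<theta> * cos (real (Suc N) * \<theta>)) * cos (real (Suc N) * t) - cos (real (Suc N) * \<theta>) * (2 * cos t * cos (real (Suc N) * t))"
    unfolding cos_kernel_def by (simp add: algebra_simps)
  then show ?case unfolding r Suc by (simp add: algebra_simps)
qed

lemma cos_kernel_reproducing:
  "integral\<^sup>L half_circle (\<lambda>t. cos (real j * t) * cos_kernel \<theta> N t) = (if j \<le> N then pi * cos (real j * \<theta>) else 0)"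
proof -
  have i: "integrable half_circle (\<lambda>t. cos (real j * t))" for j
    by (rule integrable_half_circle_bounded[where B=1]) (auto intro!: continuous_intros)
  have i2: "integrable half_circle (\<lambda>t. cos (real j * t) * cos (real k * t))" for j k
    by (rule integrable_half_circle_bounded[where B=1]) (auto intro!: continuous_intros mult_le_one simp: abs_mult)
  have "(\<lambda>t. cos (real j * t) * cos_kernel \<theta> N t) =
    (\<lambda>t. cos (real j * t) + (\<Sum>k=1..N. 2 * cos (real k * \<theta>) * (cos (real j * t) * cos (real k * t))))"
    by (simp add: cos_kernel_def distrib_left sum_distrib_left mult_ac)
  then have "integral\<^sup>L half_circle (\<lambda>t. cos (real j * t) * cos_kernel \<theta> N t) =
     (if j = 0 then pi else 0) + (\<Sum>k=1..N. 2 * cos (real k * \<theta>) * (if j = k then (if j = 0 then pi else pi / 2) else 0))"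
    using i i2 by (simp add: integral_half_circle_cos integral_half_circle_cos_cos)
  also have "\<dots> = (if j \<le> N then pi * cos (real j * \<theta>) else 0)"
    by (cases "j = 0") (simp_all add: if_distrib[of "\<lambda>x. _ * x"] sum.delta cong: if_cong)
  finally show ?thesis .
qed

lemma continuous_on_cos_kernel: "continuous_on X (cos_kernel \<theta> N)"
  unfolding cos_kernel_def[abs_def] by (intro continuous_intros)

lemma cos_kernel_bound: "\<bar>cos_kernel \<theta> N t\<bar> \<le> 1 + 2 * real N"
proof -
  have "\<bar>\<Sum>k=1..N. 2 * cos (real k * \<theta>) * cos (real k * t)\<bar> \<le> (\<Sum>k=1..N. 2)"
    by (rule order_trans[OF sum_abs sum_mono]) (auto simp: abs_mult mult_le_one)
  then show ?thesis unfolding cos_kernel_def by simp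
qed

text \<open>The Cauchy-Schwarz argument: evaluate at the vertex - B/C. For C = 0 the expression is
  affine in x, and boundedness from below forces B = 0.\<close>

lemma discriminant_bound:
  fixes A B C :: real
  assumes "\<And>x. 0 \<le> A + 2 * x * B + x\<^sup>2 * C" "0 \<le> A" "0 \<le> C"
  shows "\<bar>B\<bar> \<le> sqrt A * sqrt C"
proof -
  have "B\<^sup>2 \<le> A * C"
  proof (cases "C = 0")
    case True
    have "B = 0"
    proof (rule ccontr)
      assume "B \<noteq> 0"
      then show False using assms(1)[of "- (A + 1) / (2 * B)"] True by (simp add: field_simps)
    qed
    then show ?thesis using True by simp
  next
    case False
    then have C: "C > 0" using assms by simp
    have "0 \<le> (A + 2 * (- B / C) * B + (- B / C)\<^sup>2 * C) * C"
      using assms(1)[of "- B / C"] C by (intro mult_nonneg_nonneg) auto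
    also have "\<dots> = A * C - B\<^sup>2" using C by (simp add: field_simps power2_eq_square)
    finally show ?thesis by simp
  qed
  then have "sqrt (B\<^sup>2) \<le> sqrt (A * C)" by (rule real_sqrt_le_mono)
  then show ?thesis by (simp add: real_sqrt_mult)
qed

text \<open>\<open>f\<close> stands for w(cos t) sin t, so the inner product of two polynomials in
  cos t is their original weighted inner product on [-1,1].\<close>

locale half_circle_weight =
  fixes f :: "real \<Rightarrow> real"
  assumes f_cont: "continuous_on {0<..<pi} f"
    and f_pos: "\<And>t. 0 < t \<Longrightarrow> t < pi \<Longrightarrow> 0 < f t"
    and f_int: "integrable half_circle f"
begin

text \<open>Measurability of \<open>u\<close> is a separate condition because integrability of u^2 f
  does not imply it, and products u v f need it.\<close>

definition L2 :: "(real \<Rightarrow> real) \<Rightarrow> bool" where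
  "L2 u \<longleftrightarrow> u \<in> borel_measurable half_circle \<and> integrable half_circle (\<lambda>t. (u t)\<^sup>2 * f t)"

definition ip :: "(real \<Rightarrow> real) \<Rightarrow> (real \<Rightarrow> real) \<Rightarrow> real" where
  "ip u v = integral\<^sup>L half_circle (\<lambda>t. u t * v t * f t)"

lemma f_meas [measurable]: "f \<in> borel_measurable half_circle"
  using f_int by (rule borel_measurable_integrable)

lemma L2_prod:
  assumes "L2 u" "L2 v"
  shows "integrable half_circle (\<lambda>t. u t * v t * f t)"
proof (rule Bochner_Integration.integrable_bound)
  show "integrable half_circle (\<lambda>t. (u t)\<^sup>2 * f t + (v t)\<^sup>2 * f t)"
    using assms by (auto simp: L2_def)
  have [measurable]: "u \<in> borel_measurable half_circle" "v \<in> borel_measurable half_circle"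
    using assms by (auto simp: L2_def)
  show "(\<lambda>t. u t * v t * f t) \<in> borel_measurable half_circle" by measurable
  have "norm (u t * v t * f t) \<le> norm ((u t)\<^sup>2 * f t + (v t)\<^sup>2 * f t)" if "0 < t" "t < pi" for t
  proof -
    have "2 * (\<bar>u t\<bar> * \<bar>v t\<bar>) \<le> (u t)\<^sup>2 + (v t)\<^sup>2"
      using sum_squares_bound[of "\<bar>u t\<bar>" "\<bar>v t\<bar>"] by simp
    moreover have "0 \<le> \<bar>u t\<bar> * \<bar>v t\<bar>" by simp
    ultimately have "\<bar>u t\<bar> * \<bar>v t\<bar> \<le> (u t)\<^sup>2 + (v t)\<^sup>2" by linarith
    then show ?thesis using f_pos[OF that]
      by (simp add: abs_mult flip: distrib_right)
  qed
  then show "AE t in half_circle. norm (u t * v t * f t) \<le> norm ((u t)\<^sup>2 * f t + (v t)\<^sup>2 * f t)"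
    by (intro AE_I2) (auto simp: space_restrict_space)
qed

lemma L2_scale: "L2 u \<Longrightarrow> L2 (\<lambda>t. c * u t)"
  unfolding L2_def by (auto simp: power_mult_distrib mult.assoc)

lemma L2_add:
  assumes "L2 u" "L2 v"
  shows "L2 (\<lambda>t. u t + v t)"
proof -
  have "(\<lambda>t. (u t + v t)\<^sup>2 * f t) = (\<lambda>t. (u t)\<^sup>2 * f t + (2 * (u t * v t * f t) + (v t)\<^sup>2 * f t))"
    by (simp add: fun_eq_iff power2_eq_square algebra_simps)
  then show ?thesis using assms L2_prod[OF assms] unfolding L2_def by auto
qed

lemma L2_diff: "L2 u \<Longrightarrow> L2 v \<Longrightarrow> L2 (\<lambda>t. u t - v t)"
  using L2_add[OF _ L2_scale[of v "-1"]] by simp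

lemma L2_bounded:
  assumes "continuous_on {0<..<pi} u" "\<And>t. 0 < t \<Longrightarrow> t < pi \<Longrightarrow> \<bar>u t\<bar> \<le> B"
  shows "L2 u"
proof -
  have m: "u \<in> borel_measurable half_circle"
    by (intro continuous_imp_measurable_on_sets_lebesgue assms) auto
  have "integrable half_circle (\<lambda>t. (u t)\<^sup>2 * f t)"
  proof (rule integrable_half_circle_dominated)
    show "continuous_on {0<..<pi} (\<lambda>t. (u t)\<^sup>2 * f t)" by (intro continuous_intros assms f_cont)
    show "integrable half_circle (\<lambda>t. B\<^sup>2 * f t)" using f_int by simp
    fix t assume t: "0 < t" "t < pi"
    have "(u t)\<^sup>2 \<le> B\<^sup>2" using assms(2)[OF t] by (rule abs_le_square_iff[THEN iffD1, OF order_trans]) simp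
    then show "norm ((u t)\<^sup>2 * f t) \<le> B\<^sup>2 * f t" using f_pos[OF t] by (simp add: abs_mult)
  qed
  with m show ?thesis by (simp add: L2_def)
qed

lemma L2_poly_cos: "L2 (\<lambda>t. poly Q (cos t))"
proof -
  obtain a where a: "\<And>t. poly Q (cos t) = (\<Sum>k\<le>degree Q. a k * cos (real k * t))"
    using cos_span_poly[of Q "degree Q"] by (auto simp: cos_span_def)
  show ?thesis
  proof (rule L2_bounded)
    show "continuous_on {0<..<pi} (\<lambda>t. poly Q (cos t))" by (intro continuous_intros)
    fix t :: real
    show "\<bar>poly Q (cos t)\<bar> \<le> (\<Sum>k\<le>degree Q. \<bar>a k\<bar>)"
      unfolding a by (rule order_trans[OF sum_abs sum_mono]) (auto simp: abs_mult mult_left_le)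
  qed
qed

lemma L2_cos: "L2 (\<lambda>t. cos (real k * t))"
  by (rule L2_bounded[where B=1]) (auto intro!: continuous_intros)

lemma ip_commute: "ip u v = ip v u"
  by (simp add: ip_def mult.commute)

lemma ip_add_left: "L2 u \<Longrightarrow> L2 v \<Longrightarrow> L2 w \<Longrightarrow> ip (\<lambda>t. u t + v t) w = ip u w + ip v w"
  unfolding ip_def using L2_prod by (simp add: distrib_right flip: Bochner_Integration.integral_add)

lemma ip_diff_left: "L2 u \<Longrightarrow> L2 v \<Longrightarrow> L2 w \<Longrightarrow> ip (\<lambda>t. u t - v t) w = ip u w - ip v w"
  unfolding ip_def using L2_prod by (simp add: left_diff_distrib flip: Bochner_Integration.integral_diff)

lemma ip_scale_left: "ip (\<lambda>t. c * u t) w = c * ip u w"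
  unfolding ip_def by (simp add: mult.assoc)

lemma ip_add_right: "L2 u \<Longrightarrow> L2 v \<Longrightarrow> L2 w \<Longrightarrow> ip w (\<lambda>t. u t + v t) = ip w u + ip w v"
  using ip_add_left ip_commute by metis

lemma ip_diff_right: "L2 u \<Longrightarrow> L2 v \<Longrightarrow> L2 w \<Longrightarrow> ip w (\<lambda>t. u t - v t) = ip w u - ip w v"
  using ip_diff_left ip_commute by metis

lemma ip_scale_right: "ip w (\<lambda>t. c * u t) = c * ip w u"
  using ip_scale_left ip_commute by metis

lemma L2_sum: "finite I \<Longrightarrow> (\<And>i. i \<in> I \<Longrightarrow> L2 (u i)) \<Longrightarrow> L2 (\<lambda>t. \<Sum>i\<in>I. u i t)"
proof (induction I rule: finite_induct)
  case empty
  show ?case by (simp add: L2_def)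
qed (simp add: L2_add)

lemma ip_sum_right:
  "finite I \<Longrightarrow> L2 w \<Longrightarrow> (\<And>i. i \<in> I \<Longrightarrow> L2 (u i)) \<Longrightarrow> ip w (\<lambda>t. \<Sum>i\<in>I. u i t) = (\<Sum>i\<in>I. ip w (u i))"
proof (induction I rule: finite_induct)
  case empty
  show ?case by (simp add: ip_def)
qed (simp add: ip_add_right L2_sum)

lemma ip_nonneg: "0 \<le> ip u u"
proof -
  have "0 \<le> u t * u t * f t" if "0 < t" "t < pi" for t
    using f_pos[OF that] by simp
  then show ?thesis unfolding ip_def
    by (intro integral_nonneg_AE AE_I2) (auto simp: space_restrict_space)
qed

lemma ip_Cauchy_Schwarz:
  assumes "L2 u" "L2 v"
  shows "\<bar>ip u v\<bar> \<le> sqrt (ip u u) * sqrt (ip v v)"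
proof (rule discriminant_bound)
  fix x
  have "0 \<le> ip (\<lambda>t. u t + x * v t) (\<lambda>t. u t + x * v t)" by (rule ip_nonneg)
  also have "\<dots> = ip u u + 2 * x * ip u v + x\<^sup>2 * ip v v"
    using assms by (simp add: ip_add_left ip_add_right ip_scale_left ip_scale_right L2_add L2_scale
        ip_commute[of v u] power2_eq_square algebra_simps)
  finally show "0 \<le> ip u u + 2 * x * ip u v + x\<^sup>2 * ip v v" .
qed (rule ip_nonneg)+

lemma ip_norm_diff:
  assumes "L2 u" "L2 v"
  shows "ip (\<lambda>t. u t - x * v t) (\<lambda>t. u t - x * v t) = ip u u - 2 * x * ip u v + x\<^sup>2 * ip v v"
  using assms by (simp add: ip_diff_left ip_diff_right ip_scale_left ip_scale_right L2_diff L2_scale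
        ip_commute[of v u] power2_eq_square algebra_simps)

text \<open>Subtracting the first n projections leaves \<open>r n\<close>, whose squared norm is
  that of \<open>u\<close> minus the sum of a_k^2 / c. Hence the a_k^2 are summable and tend to 0.
  With constant weight this becomes the Riemann-Lebesgue lemma.\<close>

lemma bessel_tendsto_zero:
  assumes u: "L2 u" and g: "\<And>k. L2 (g k)" and c: "0 < c"
    and orth: "\<And>j k. ip (g j) (g k) = (if j = k then c else 0)"
  shows "(\<lambda>k. ip u (g k)) \<longlonglongrightarrow> 0"
proof -
  define a where "a k = ip u (g k)" for k
  define r where "r n t = u t - (\<Sum>k<n. a k / c * g k t)" for n t
  have r: "L2 (r n)" for n unfolding r_def by (intro L2_diff L2_sum L2_scale u g) auto
  have rg: "ip (r n) (g m) = (if m < n then 0 else a m)" for n m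
  proof -
    have "ip (r n) (g m) = a m - (\<Sum>k<n. a k / c * ip (g k) (g m))"
    proof -
      have s: "L2 (\<lambda>t. a k / c * g k t)" for k by (intro L2_scale g)
      have "ip (r n) (g m) = ip u (g m) - ip (\<lambda>t. \<Sum>k<n. a k / c * g k t) (g m)"
        unfolding r_def by (intro ip_diff_left L2_sum s u g) auto
      also have "ip (\<lambda>t. \<Sum>k<n. a k / c * g k t) (g m) = (\<Sum>k<n. ip (g m) (\<lambda>t. a k / c * g k t))"
        unfolding ip_commute[of _ "g m"] by (intro ip_sum_right s g) auto
      finally show ?thesis by (simp only: ip_scale_right ip_commute[of "g m"] a_def)
    qed
    then show ?thesis using c by (simp add: orth if_distrib[of "\<lambda>x. _ * x"] sum.delta cong: if_cong)
  qed
  have norm: "ip (r n) (r n) = ip u u - (\<Sum>k<n. (a k)\<^sup>2 / c)" for n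
  proof (induction n)
    case 0
    then show ?case by (simp add: r_def[abs_def])
  next
    case (Suc n)
    have e: "r (Suc n) = (\<lambda>t. r n t - a n / c * g n t)"
      by (simp add: r_def fun_eq_iff)
    have "ip (r (Suc n)) (r (Suc n)) = ip (r n) (r n) - 2 * (a n / c) * ip (r n) (g n) + (a n / c)\<^sup>2 * ip (g n) (g n)"
      unfolding e by (rule ip_norm_diff[OF r g])
    also have "\<dots> = ip (r n) (r n) - (a n)\<^sup>2 / c"
      using c by (simp add: rg orth power2_eq_square field_simps)
    finally show ?case using Suc by simp
  qed
  have psum: "(\<Sum>k<n. (a k)\<^sup>2 / c) \<le> ip u u" for n
    using norm[of n] ip_nonneg[of "r n"] by simp
  have "summable (\<lambda>k. (a k)\<^sup>2 / c)"
    by (rule bounded_imp_summable[of _ "ip u u"]) (use c psum in \<open>simp_all only: lessThan_Suc_atMost[symmetric], simp\<close>)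
  then have "(\<lambda>k. (a k)\<^sup>2 / c) \<longlonglongrightarrow> 0" by (rule summable_LIMSEQ_zero)
  from tendsto_mult_right[OF this, of c] c have "(\<lambda>k. (a k)\<^sup>2) \<longlonglongrightarrow> 0" by simp
  from tendsto_real_sqrt[OF this] have "a \<longlonglongrightarrow> 0" by (simp add: tendsto_rabs_zero_iff)
  then show ?thesis by (simp add: a_def[abs_def])
qed

end

subsection \<open>Localisation at a point\<close>

text \<open>The kernel reproduces cosines of frequency at most N and annihilates higher ones. The
  frequency |k - N| is at most N exactly for k at most 2 N, so the error comes only from the tail of
  \<open>w\<close>, which starts at 2 N + 1.\<close>

lemma cos_series_kernel_integral:
  fixes w :: "nat \<Rightarrow> real"
  assumes summ: "summable (\<lambda>k. \<bar>w k\<bar>)"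
    and g: "\<And>t. 0 < t \<Longrightarrow> t < pi \<Longrightarrow> (\<lambda>k. w k * cos ((real k - real N) * t)) sums g t"
    and th: "0 < \<theta>" "\<theta> < pi"
  shows "integrable half_circle (\<lambda>t. g t * cos_kernel \<theta> N t)" (is ?th1)
    and "\<bar>integral\<^sup>L half_circle (\<lambda>t. g t * cos_kernel \<theta> N t) - pi * g \<theta>\<bar> \<le> pi * (\<Sum>k. \<bar>w (k + Suc (2 * N))\<bar>)" (is ?th2)
proof -
  let ?M = "half_circle"
  define v where "v k t = w k * cos ((real k - real N) * t) * cos_kernel \<theta> N t" for k t
  \<comment> \<open>The frequency |k - N| as a natural number, the form in which
    \<open>cos_kernel_reproducing\<close> applies.\<close>
  define j where "j k = (if k \<le> N then N - k else k - N)" for k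
  have cosj: "cos ((real k - real N) * t) = cos (real (j k) * t)" for k t
    using cos_minus[of "(real k - real N) * t"] by (auto simp: j_def of_nat_diff algebra_simps)
  have cK: "continuous_on {0<..<pi} (cos_kernel \<theta> N)" by (rule continuous_on_cos_kernel)
  have vb: "\<bar>v k t\<bar> \<le> \<bar>w k\<bar> * (1 + 2 * real N)" for k t
    unfolding v_def abs_mult mult.assoc
    using mult_mono[of "\<bar>cos ((real k - real N) * t)\<bar>" 1 "\<bar>cos_kernel \<theta> N t\<bar>" "1 + 2 * real N"] cos_kernel_bound[of \<theta> N t]
    by (intro mult_left_mono) auto
  have vi: "integrable ?M (v k)" for k
    by (rule integrable_half_circle_bounded[where B="\<bar>w k\<bar> * (1 + 2 * real N)"])
      (use vb in \<open>auto simp: v_def intro!: continuous_intros cK\<close>)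
  have s2: "summable (\<lambda>k. \<bar>w k\<bar> * (1 + 2 * real N))" by (intro summable_mult2 summ)
  have s1: "summable (\<lambda>k. norm (v k t))" for t
    by (rule summable_comparison_test[OF _ s2]) (use vb in auto)
  have s3: "summable (\<lambda>k. integral\<^sup>L ?M (\<lambda>t. norm (v k t)))"
  proof (rule summable_comparison_test[OF _ summable_mult[OF s2, of pi]], intro exI[of _ 0] allI impI)
    fix k
    have "integral\<^sup>L ?M (\<lambda>t. norm (v k t)) \<le> integral\<^sup>L ?M (\<lambda>t. \<bar>w k\<bar> * (1 + 2 * real N))"
      by (rule integral_mono) (use vi vb in auto)
    also have "\<dots> = pi * (\<bar>w k\<bar> * (1 + 2 * real N))" by (simp add: measure_restrict_space)
    finally show "norm (integral\<^sup>L ?M (\<lambda>t. norm (v k t))) \<le> pi * (\<bar>w k\<bar> * (1 + 2 * real N))" by simp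
  qed
  have gv: "(\<lambda>k. v k t) sums (g t * cos_kernel \<theta> N t)" if "0 < t" "t < pi" for t
    unfolding v_def by (intro sums_mult2 g that)
  have cong: "(\<Sum>k. v k t) = g t * cos_kernel \<theta> N t" if "t \<in> space ?M" for t
    using gv[of t] that by (auto simp: sums_iff space_restrict_space)
  have "integrable ?M (\<lambda>t. \<Sum>k. v k t)"
    by (rule integrable_suminf[OF vi AE_I2[OF s1] s3])
  then show ?th1
    by (subst (asm) Bochner_Integration.integrable_cong[OF refl cong]) auto
  have iv: "integral\<^sup>L ?M (v k) = w k * (if j k \<le> N then pi * cos (real (j k) * \<theta>) else 0)" for k
    unfolding v_def cosj by (simp only: mult.assoc integral_mult_right_zero cos_kernel_reproducing)
  have "(\<lambda>k. integral\<^sup>L ?M (v k)) sums integral\<^sup>L ?M (\<lambda>t. \<Sum>k. v k t)"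
    by (rule sums_integral[OF vi AE_I2[OF s1] s3])
  moreover have "integral\<^sup>L ?M (\<lambda>t. \<Sum>k. v k t) = integral\<^sup>L ?M (\<lambda>t. g t * cos_kernel \<theta> N t)"
    by (rule Bochner_Integration.integral_cong[OF refl cong])
  ultimately have I: "(\<lambda>k. integral\<^sup>L ?M (v k)) sums integral\<^sup>L ?M (\<lambda>t. g t * cos_kernel \<theta> N t)" by simp
  have "(\<lambda>k. pi * (w k * cos ((real k - real N) * \<theta>))) sums (pi * g \<theta>)"
    by (intro sums_mult g th)
  from sums_diff[OF I this]
  have D: "(\<lambda>k. integral\<^sup>L ?M (v k) - pi * (w k * cos ((real k - real N) * \<theta>))) sums
     (integral\<^sup>L ?M (\<lambda>t. g t * cos_kernel \<theta> N t) - pi * g \<theta>)" .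
  define d where "d k = integral\<^sup>L ?M (v k) - pi * (w k * cos ((real k - real N) * \<theta>))" for k
  have d0: "d k = 0" if "k \<le> 2 * N" for k
    using that unfolding d_def iv cosj by (auto simp: j_def)
  have d1: "\<bar>d k\<bar> \<le> pi * \<bar>w k\<bar>" if "k \<ge> Suc (2 * N)" for k
    using that unfolding d_def iv cosj by (auto simp: j_def abs_mult mult_left_le)
  have "(\<lambda>k. d (k + Suc (2 * N))) sums (integral\<^sup>L ?M (\<lambda>t. g t * cos_kernel \<theta> N t) - pi * g \<theta>)"
    using D[folded d_def] d0 by (subst sums_iff_shift) (simp add: sum.neutral)
  then have eq: "integral\<^sup>L ?M (\<lambda>t. g t * cos_kernel \<theta> N t) - pi * g \<theta> = (\<Sum>k. d (k + Suc (2 * N)))"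
    by (rule sums_unique)
  have sw: "summable (\<lambda>k. pi * \<bar>w (k + Suc (2 * N))\<bar>)"
    using summ by (intro summable_mult summable_ignore_initial_segment)
  have sd: "summable (\<lambda>k. \<bar>d (k + Suc (2 * N))\<bar>)"
    by (rule summable_comparison_test[OF _ sw]) (use d1 in auto)
  have "\<bar>\<Sum>k. d (k + Suc (2 * N))\<bar> \<le> (\<Sum>k. \<bar>d (k + Suc (2 * N))\<bar>)"
    by (rule summable_rabs[OF sd])
  also have "\<dots> \<le> (\<Sum>k. pi * \<bar>w (k + Suc (2 * N))\<bar>)"
    by (rule suminf_le[OF _ sd sw]) (rule d1, simp)
  also have "\<dots> = pi * (\<Sum>k. \<bar>w (k + Suc (2 * N))\<bar>)"
    using summ by (intro suminf_mult summable_ignore_initial_segment)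
  finally show ?th2 unfolding eq .
qed

context half_circle_weight
begin

lemma cos_span_kernel_integral:
  assumes "cos_span N g"
  shows "integrable half_circle (\<lambda>t. g t * cos_kernel \<theta> N t)"
    and "integral\<^sup>L half_circle (\<lambda>t. g t * cos_kernel \<theta> N t) = pi * g \<theta>"
proof -
  let ?M = "half_circle"
  obtain a where a: "\<And>t. g t = (\<Sum>k\<le>N. a k * cos (real k * t))"
    using assms by (auto simp: cos_span_def)
  have eq: "(\<lambda>t. g t * cos_kernel \<theta> N t) = (\<lambda>t. \<Sum>k\<le>N. a k * (cos (real k * t) * cos_kernel \<theta> N t))"
    by (simp add: a sum_distrib_right mult.assoc)
  have i: "integrable ?M (\<lambda>t. cos (real k * t) * cos_kernel \<theta> N t)" for k
    by (rule integrable_half_circle_bounded[where B="1 * (1 + 2 * real N)"])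
      (auto intro!: continuous_intros continuous_on_cos_kernel mult_mono[OF _ cos_kernel_bound, of _ 1, simplified] simp: abs_mult)
  show "integrable ?M (\<lambda>t. g t * cos_kernel \<theta> N t)"
    unfolding eq by (intro Bochner_Integration.integrable_sum integrable_mult_right i)
  show "integral\<^sup>L ?M (\<lambda>t. g t * cos_kernel \<theta> N t) = pi * g \<theta>"
    unfolding eq
    by (simp only: Bochner_Integration.integral_sum[OF integrable_mult_right[OF i]] integral_mult_right_zero cos_kernel_reproducing a)
      (simp add: sum_distrib_left mult_ac)
qed

text \<open>As \<open>S\<close> is orthogonal to all lower degrees, \<open>c\<close> times the n-th
  polynomial is the orthogonal projection of \<open>S\<close> onto degree at most n. So
  \<open>e\<close> is minus the projection error: it is orthogonal to that space, obeys Pythagoras,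
  and is no longer than the error of any other approximation.\<close>

lemma orthonormal_residual:
  fixes P :: "nat \<Rightarrow> real poly" and S :: "real \<Rightarrow> real"
  assumes P: "\<And>n. degree (P n) = n" "\<And>n. P n \<noteq> 0"
    and orth: "\<And>m n. ip (\<lambda>t. poly (P m) (cos t)) (\<lambda>t. poly (P n) (cos t)) = (if m = n then 1 else 0)"
    and S: "L2 S" and S0: "\<And>m. m < n \<Longrightarrow> ip S (\<lambda>t. cos (real m * t)) = 0"
  defines "c \<equiv> ip S (\<lambda>t. poly (P n) (cos t))"
  defines "e \<equiv> (\<lambda>t. c * poly (P n) (cos t) - S t)"
  shows "L2 e"
    and "\<And>Q. degree Q \<le> n \<Longrightarrow> ip e (\<lambda>t. poly Q (cos t)) = 0"
    and "ip S S = c\<^sup>2 + ip e e"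
    and "\<And>Q. degree Q \<le> n \<Longrightarrow> ip e e \<le> ip (\<lambda>t. S t - poly Q (cos t)) (\<lambda>t. S t - poly Q (cos t))"
proof -
  let ?p = "\<lambda>j t. poly (P j) (cos t)"
  show e: "L2 e" unfolding e_def by (intro L2_diff L2_scale L2_poly_cos S)
  have Slow: "ip S (\<lambda>t. poly Q (cos t)) = 0" if "degree Q < n" for Q
  proof -
    obtain a where a: "\<And>t. poly Q (cos t) = (\<Sum>k\<le>degree Q. a k * cos (real k * t))"
      using cos_span_poly[of Q "degree Q"] by (auto simp: cos_span_def)
    have "ip S (\<lambda>t. poly Q (cos t)) = (\<Sum>k\<le>degree Q. ip S (\<lambda>t. a k * cos (real k * t)))"
      unfolding a by (intro ip_sum_right S L2_scale L2_cos) auto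
    also have "\<dots> = 0" using S0 that by (intro sum.neutral) (auto simp: ip_scale_right)
    finally show ?thesis .
  qed
  have ep: "ip e (?p j) = 0" if "j \<le> n" for j
  proof -
    have "ip e (?p j) = c * ip (?p n) (?p j) - ip S (?p j)"
      unfolding e_def by (simp add: ip_diff_left ip_scale_left L2_scale L2_poly_cos S)
    also have "\<dots> = 0"
    proof (cases "j = n")
      case True
      then show ?thesis by (simp add: orth c_def)
    next
      case False
      then show ?thesis using Slow[of "P j"] that by (simp add: orth P)
    qed
    finally show ?thesis .
  qed
  show eQ: "ip e (\<lambda>t. poly Q (cos t)) = 0" if Q: "degree Q \<le> n" for Q
  proof -
    obtain d where d: "Q = (\<Sum>j<Suc n. smult (d j) (P j))"
      using graded_poly_basis[of P "Suc n" Q] P Q by (auto simp: coeff_eq_0)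
    have "ip e (\<lambda>t. poly Q (cos t)) = ip e (\<lambda>t. \<Sum>j<Suc n. d j * ?p j t)"
      unfolding d by (simp only: poly_sum poly_smult)
    also have "\<dots> = (\<Sum>j<Suc n. ip e (\<lambda>t. d j * ?p j t))"
      by (intro ip_sum_right e L2_scale L2_poly_cos) auto
    also have "\<dots> = 0" using ep by (intro sum.neutral) (auto simp: ip_scale_right)
    finally show ?thesis .
  qed
  have enorm: "ip (\<lambda>t. c' * e t + poly Q (cos t)) (\<lambda>t. c' * e t + poly Q (cos t)) =
      c'\<^sup>2 * ip e e + ip (\<lambda>t. poly Q (cos t)) (\<lambda>t. poly Q (cos t))" if "degree Q \<le> n" for c' Q
    using eQ[OF that] ip_commute[of "\<lambda>t. poly Q (cos t)" e]
    by (simp add: ip_add_left ip_add_right ip_scale_left ip_scale_right L2_add L2_scale e L2_poly_cos power2_eq_square)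
  have "S = (\<lambda>t. -1 * e t + poly (smult c (P n)) (cos t))" by (simp add: e_def)
  then have "ip S S = ip (\<lambda>t. -1 * e t + poly (smult c (P n)) (cos t)) (\<lambda>t. -1 * e t + poly (smult c (P n)) (cos t))"
    by simp
  also have "\<dots> = (-1)\<^sup>2 * ip e e + ip (\<lambda>t. poly (smult c (P n)) (cos t)) (\<lambda>t. poly (smult c (P n)) (cos t))"
    by (rule enorm) (simp add: P)
  also have "\<dots> = c\<^sup>2 + ip e e" by (simp add: ip_scale_left ip_scale_right orth power2_eq_square)
  finally show "ip S S = c\<^sup>2 + ip e e" .
  show "ip e e \<le> ip (\<lambda>t. S t - poly Q (cos t)) (\<lambda>t. S t - poly Q (cos t))" if Q: "degree Q \<le> n" for Q
  proof -
    have eq: "(\<lambda>t. S t - poly Q (cos t)) = (\<lambda>t. -1 * e t + poly (smult c (P n) - Q) (cos t))"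
      by (simp add: e_def)
    have "degree (smult c (P n) - Q) \<le> n" using Q P by (intro degree_diff_le) auto
    from enorm[OF this, of "-1"] show ?thesis unfolding eq using ip_nonneg by simp
  qed
qed

text \<open>Korous' localisation: against the Chebyshev kernel the weight is frozen at \<open>\<theta>\<close>; the frozen part
  sees only boundedly many frequencies because \<open>e\<close> is orthogonal to low degrees, and the remainder is
  tame because \<open>f t - f \<theta>\<close> cancels the singularity in the Christoffel--Darboux formula.\<close>

lemma residual_kernel_bound:
  fixes m n :: nat
  assumes th: "0 < \<theta>" "\<theta> < pi" and e: "L2 e"
    and e0: "\<And>Q. degree Q \<le> n \<Longrightarrow> ip e (\<lambda>t. poly Q (cos t)) = 0" and mn: "2 * m \<le> n"
    and H: "integrable half_circle (\<lambda>t. (sin t ^ (2 * m) * ((f t - f \<theta>) / (cos t - cos \<theta>)))\<^sup>2 / f t)"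
  shows "\<bar>integral\<^sup>L half_circle (\<lambda>t. sin t ^ (2 * m) * e t * cos_kernel \<theta> (n + 2 * m) t)\<bar> \<le>
    (8 * real m * sqrt (ip (\<lambda>_. 1) (\<lambda>_. 1)) +
     2 * sqrt (integral\<^sup>L half_circle (\<lambda>t. (sin t ^ (2 * m) * ((f t - f \<theta>) / (cos t - cos \<theta>)))\<^sup>2 / f t))) / f \<theta>
     * sqrt (ip e e)"
proof -
  let ?M = "half_circle"
  define N where "N = n + 2 * m"
  define q where "q t = sin t ^ (2 * m)" for t :: real
  define h where "h t = (q t * ((f t - f \<theta>) / (cos t - cos \<theta>)))\<^sup>2 / f t" for t
  have h: "integrable ?M h" using H by (simp add: h_def[abs_def] q_def)
  have f0: "f \<theta> > 0" using f_pos th by simp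
  have q01: "\<bar>q t\<bar> \<le> 1" for t
    unfolding q_def power_abs by (rule power_le_one) auto
  have qpoly: "q t = poly ([:1, 0, -1:] ^ m) (cos t)" for t
  proof -
    have "(sin t)\<^sup>2 = poly [:1, 0, -1:] (cos t)"
      using sin_cos_squared_add[of t] by (simp add: power2_eq_square algebra_simps)
    then show ?thesis unfolding q_def by (simp only: power_mult poly_power)
  qed
  have L2q: "L2 (\<lambda>t. q t * cos (real k * t))" for k
    by (rule L2_bounded[where B=1]) (use q01 in \<open>auto simp: q_def abs_mult intro!: continuous_intros mult_le_one\<close>)
  \<comment> \<open>Since sin^2 = 1 - cos^2, the factor \<open>q\<close> is a polynomial of degree
    2m in cos t. Multiplying by it costs 2m degrees of orthogonality.\<close>
  have ek: "ip e (\<lambda>t. q t * cos (real k * t)) = 0" if k: "k + 2 * m \<le> n" for k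
  proof -
    obtain T :: "real poly" where T: "degree T \<le> k" "\<And>t. poly T (cos t) = cos (real k * t)"
      using chebyshev_poly_exists by blast
    have "degree ([:1, 0, -1:] ^ m :: real poly) \<le> 2 * m"
      using degree_power_le[of "[:1, 0, -1::real:]" m] by simp
    then have "degree ([:1, 0, -1:] ^ m * T) \<le> n"
      using T(1) k degree_mult_le[of "[:1, 0, -1:] ^ m" T] by linarith
    from e0[OF this] show ?thesis by (simp add: qpoly T)
  qed
  have eb: "\<bar>ip e (\<lambda>t. q t * cos (real k * t))\<bar> \<le> sqrt (ip e e) * sqrt (ip (\<lambda>_. 1) (\<lambda>_. 1))" for k
  proof -
    have "ip (\<lambda>t. q t * cos (real k * t)) (\<lambda>t. q t * cos (real k * t)) \<le> ip (\<lambda>_. 1) (\<lambda>_. 1)"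
      unfolding ip_def
    proof (rule integral_mono)
      show "integrable ?M (\<lambda>t. q t * cos (real k * t) * (q t * cos (real k * t)) * f t)" by (rule L2_prod[OF L2q L2q])
      show "integrable ?M (\<lambda>t. 1 * 1 * f t)" using f_int by simp
      fix t assume "t \<in> space ?M"
      then have "f t \<ge> 0" using f_pos[of t] by (auto simp: space_restrict_space)
      moreover have "(q t * cos (real k * t)) * (q t * cos (real k * t)) \<le> 1"
        using q01[of t] abs_square_le_1[of "q t * cos (real k * t)"]
        by (simp add: abs_mult mult_le_one power2_eq_square)
      ultimately show "q t * cos (real k * t) * (q t * cos (real k * t)) * f t \<le> 1 * 1 * f t"
        by (intro mult_right_mono) auto
    qed
    then have "sqrt (ip e e) * sqrt (ip (\<lambda>t. q t * cos (real k * t)) (\<lambda>t. q t * cos (real k * t))) \<le> sqrt (ip e e) * sqrt (ip (\<lambda>_. 1) (\<lambda>_. 1))"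
      using ip_nonneg by (intro mult_left_mono) auto
    then show ?thesis using ip_Cauchy_Schwarz[OF e L2q[of k]] by linarith
  qed
  have qK: "(\<lambda>t. q t * cos_kernel \<theta> N t) = (\<lambda>t. q t * cos (real 0 * t) + (\<Sum>k=1..N. 2 * cos (real k * \<theta>) * (q t * cos (real k * t))))"
    by (simp add: cos_kernel_def distrib_left sum_distrib_left mult_ac)
  have L2qK: "L2 (\<lambda>t. q t * cos_kernel \<theta> N t)"
    unfolding qK by (intro L2_add L2_sum L2_scale L2q) auto
  \<comment> \<open>Only frequencies k with n - 2m < k and k at most n + 2m survive. These are 4m
    terms, each with a coefficient at most 2 in absolute value, hence the constant 8m, independent
    of n.\<close>
  have first: "\<bar>ip e (\<lambda>t. q t * cos_kernel \<theta> N t)\<bar> \<le> 8 * real m * (sqrt (ip e e) * sqrt (ip (\<lambda>_. 1) (\<lambda>_. 1)))"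
  proof -
    have "ip e (\<lambda>t. q t * cos_kernel \<theta> N t) = ip e (\<lambda>t. q t * cos (real 0 * t)) + (\<Sum>k=1..N. ip e (\<lambda>t. 2 * cos (real k * \<theta>) * (q t * cos (real k * t))))"
      unfolding qK by (subst ip_add_right, simp_all only: L2q e L2_sum L2_scale finite_atLeastAtMost ip_sum_right)
    also have "ip e (\<lambda>t. q t * cos (real 0 * t)) = 0" using mn by (intro ek) auto
    also have "(\<Sum>k=1..N. ip e (\<lambda>t. 2 * cos (real k * \<theta>) * (q t * cos (real k * t)))) =
        (\<Sum>k\<in>{n - 2 * m <.. N}. 2 * cos (real k * \<theta>) * ip e (\<lambda>t. q t * cos (real k * t)))"
      unfolding ip_scale_right
    proof (rule sum.mono_neutral_right)
      show "\<forall>k\<in>{1..N} - {n - 2 * m<..N}. 2 * cos (real k * \<theta>) * ip e (\<lambda>t. q t * cos (real k * t)) = 0"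
        using mn by (auto intro!: ek)
    qed auto
    finally have "\<bar>ip e (\<lambda>t. q t * cos_kernel \<theta> N t)\<bar> \<le> (\<Sum>k\<in>{n - 2 * m <.. N}. \<bar>2 * cos (real k * \<theta>) * ip e (\<lambda>t. q t * cos (real k * t))\<bar>)"
      using sum_abs[of "\<lambda>k. 2 * cos (real k * \<theta>) * ip e (\<lambda>t. q t * cos (real k * t))" "{n - 2 * m <.. N}"] by simp
    also have "\<dots> \<le> (\<Sum>k\<in>{n - 2 * m <.. N}. 2 * (sqrt (ip e e) * sqrt (ip (\<lambda>_. 1) (\<lambda>_. 1))))"
      unfolding abs_mult using ip_nonneg by (intro sum_mono mult_mono eb) auto
    also have "\<dots> = 8 * real m * (sqrt (ip e e) * sqrt (ip (\<lambda>_. 1) (\<lambda>_. 1)))"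
      using mn by (simp add: N_def)
    finally show ?thesis .
  qed
  define k where "k t = cos (real (Suc N) * \<theta>) * cos (real N * t) - cos (real N * \<theta>) * cos (real (Suc N) * t)" for t
  have k2: "\<bar>k t\<bar> \<le> 2" for t
  proof -
    have "\<bar>cos (real (Suc N) * \<theta>) * cos (real N * t)\<bar> \<le> 1" "\<bar>cos (real N * \<theta>) * cos (real (Suc N) * t)\<bar> \<le> 1"
      by (auto simp only: abs_mult intro!: mult_le_one abs_cos_le_one abs_ge_zero)
    then show ?thesis unfolding k_def by linarith
  qed
  have [measurable]: "q \<in> borel_measurable ?M" "k \<in> borel_measurable ?M" "(\<lambda>t. cos t) \<in> borel_measurable ?M"
    unfolding q_def[abs_def] k_def[abs_def]
    by (auto intro!: continuous_imp_measurable_on_sets_lebesgue continuous_intros)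
  \<comment> \<open>Here \<open>k\<close> is the Christoffel-Darboux numerator, bounded by 2.
    Division by f t lets the part with f t - f \<theta> be read as the inner product of
    \<open>e\<close> and \<open>g\<close>, so that Cauchy-Schwarz applies; the squared norm of
    \<open>g\<close> is at most 4 times the integral of \<open>h\<close>.\<close>
  define g where "g t = q t * ((f t - f \<theta>) / (cos t - cos \<theta>)) * k t / f t" for t
  have gsq: "(g t)\<^sup>2 * f t = (k t)\<^sup>2 * h t" if "0 < t" "t < pi" for t
  proof -
    have "(A * K / F)\<^sup>2 * F = K\<^sup>2 * (A\<^sup>2 / F)" if "F > 0" for A K F :: real
      using that by (simp add: field_simps power2_eq_square)
    then show ?thesis unfolding g_def h_def using f_pos[OF that] by blast
  qed
  have k4: "(k t)\<^sup>2 \<le> 4" for t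
    using abs_le_square_iff[of "k t" 2] k2[of t] by simp
  have h0: "h t \<ge> 0" if "0 < t" "t < pi" for t
    using f_pos[OF that] by (simp add: h_def)
  have ig: "integrable ?M (\<lambda>t. (g t)\<^sup>2 * f t)"
  proof (rule Bochner_Integration.integrable_bound[OF integrable_mult_right[OF h, of 4]])
    show "(\<lambda>t. (g t)\<^sup>2 * f t) \<in> borel_measurable ?M" unfolding g_def by measurable
    have "norm ((g t)\<^sup>2 * f t) \<le> norm (4 * h t)" if "0 < t" "t < pi" for t
      using gsq[OF that] h0[OF that] k4[of t] mult_right_mono[OF k4 h0[OF that]] by simp
    then show "AE t in ?M. norm ((g t)\<^sup>2 * f t) \<le> norm (4 * h t)"
      by (intro AE_I2) (auto simp: space_restrict_space)
  qed
  have L2g: "L2 g" using ig unfolding L2_def g_def[abs_def] by simp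
  have gg: "ip g g \<le> 4 * integral\<^sup>L ?M h"
  proof -
    have "ip g g = integral\<^sup>L ?M (\<lambda>t. (g t)\<^sup>2 * f t)" by (simp add: ip_def power2_eq_square)
    also have "\<dots> \<le> integral\<^sup>L ?M (\<lambda>t. 4 * h t)"
      by (rule integral_mono[OF ig integrable_mult_right[OF h]])
        (use gsq h0 mult_right_mono[OF k4 h0] in \<open>auto simp: space_restrict_space\<close>)
    finally show ?thesis by simp
  qed
  have second: "\<bar>ip e g\<bar> \<le> sqrt (ip e e) * (2 * sqrt (integral\<^sup>L ?M h))"
  proof -
    have "sqrt (ip g g) \<le> sqrt (4 * integral\<^sup>L ?M h)" by (rule real_sqrt_le_mono[OF gg])
    then have "sqrt (ip g g) \<le> 2 * sqrt (integral\<^sup>L ?M h)" by (simp add: real_sqrt_mult)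
    then have "sqrt (ip e e) * sqrt (ip g g) \<le> sqrt (ip e e) * (2 * sqrt (integral\<^sup>L ?M h))"
      using ip_nonneg by (intro mult_left_mono) auto
    then show ?thesis using ip_Cauchy_Schwarz[OF e L2g] by linarith
  qed
  \<comment> \<open>f \<theta> is split as f t - (f t - f \<theta>). The closed form of the kernel
    divides by cos t - cos \<theta>, so the null set t = \<theta> is left out.\<close>
  have ae: "AE t in ?M. f \<theta> * (q t * e t * cos_kernel \<theta> N t) = e t * (q t * cos_kernel \<theta> N t) * f t + e t * g t * f t"
  proof -
    have "AE t in ?M. t \<noteq> \<theta>"
      using AE_completion[OF AE_lborel_singleton[of \<theta>]]
      by (subst AE_restrict_space_iff) (auto elim: eventually_mono)
    moreover have "AE t in ?M. 0 < t \<and> t < pi" by (intro AE_I2) (auto simp: space_restrict_space)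
    ultimately show ?thesis
    proof eventually_elim
      case (elim t)
      then have ft: "f t > 0" using f_pos by simp
      have "cos t \<noteq> cos \<theta>" using elim th cos_inj_pi[of t \<theta>] by auto
      then have kt: "k t / (cos t - cos \<theta>) = - cos_kernel \<theta> N t"
        unfolding k_def cos_kernel_christoffel_darboux[symmetric] by (simp add: field_simps)
      have "e t * g t * f t = e t * q t * (f t - f \<theta>) * (k t / (cos t - cos \<theta>))"
        using ft by (simp add: g_def)
      then show ?case unfolding kt by (simp add: algebra_simps)
    qed
  qed
  have i1: "integrable ?M (\<lambda>t. e t * (q t * cos_kernel \<theta> N t) * f t)" by (rule L2_prod[OF e L2qK])
  have i2: "integrable ?M (\<lambda>t. e t * g t * f t)" by (rule L2_prod[OF e L2g])
  have [measurable]: "e \<in> borel_measurable ?M" using e by (simp add: L2_def)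
  have [measurable]: "cos_kernel \<theta> N \<in> borel_measurable ?M"
    by (auto intro!: continuous_imp_measurable_on_sets_lebesgue continuous_on_cos_kernel)
  have "f \<theta> * integral\<^sup>L ?M (\<lambda>t. q t * e t * cos_kernel \<theta> N t) = integral\<^sup>L ?M (\<lambda>t. f \<theta> * (q t * e t * cos_kernel \<theta> N t))"
    by simp
  also have "\<dots> = integral\<^sup>L ?M (\<lambda>t. e t * (q t * cos_kernel \<theta> N t) * f t + e t * g t * f t)"
  proof (rule integral_cong_AE[OF _ _ ae])
    show "(\<lambda>t. f \<theta> * (q t * e t * cos_kernel \<theta> N t)) \<in> borel_measurable ?M" by measurable
    show "(\<lambda>t. e t * (q t * cos_kernel \<theta> N t) * f t + e t * g t * f t) \<in> borel_measurable ?M"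
      by (rule borel_measurable_integrable[OF Bochner_Integration.integrable_add[OF i1 i2]])
  qed
  also have "\<dots> = ip e (\<lambda>t. q t * cos_kernel \<theta> N t) + ip e g"
    unfolding ip_def by (rule Bochner_Integration.integral_add[OF i1 i2])
  finally have main: "f \<theta> * integral\<^sup>L ?M (\<lambda>t. q t * e t * cos_kernel \<theta> N t) = ip e (\<lambda>t. q t * cos_kernel \<theta> N t) + ip e g" .
  have "f \<theta> * \<bar>integral\<^sup>L ?M (\<lambda>t. q t * e t * cos_kernel \<theta> N t)\<bar> = \<bar>ip e (\<lambda>t. q t * cos_kernel \<theta> N t) + ip e g\<bar>"
    unfolding main[symmetric] using f0 by (simp add: abs_mult)
  also have "\<dots> \<le> (8 * real m * sqrt (ip (\<lambda>_. 1) (\<lambda>_. 1)) + 2 * sqrt (integral\<^sup>L ?M h)) * sqrt (ip e e)"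
    using first second by (simp add: algebra_simps)
  finally show ?thesis
    using f0 by (simp add: N_def q_def h_def[abs_def] field_simps)
qed

text \<open>Against the kernel of order n + 2m the polynomial part of sin^(2m) e_n is reproduced
  exactly and the S_n part up to a tail of \<open>w\<close>. So pi sin(\<theta>)^(2m) e_n(\<theta>)
  is a kernel integral of e_n plus a null sequence, and \<open>residual_kernel_bound\<close>
  controls that integral by the norm of e_n, with a constant independent of n.\<close>

theorem pointwise_asymptotics:
  fixes P :: "nat \<Rightarrow> real poly" and S :: "nat \<Rightarrow> real \<Rightarrow> real" and w :: "nat \<Rightarrow> real"
  assumes P: "\<And>n. degree (P n) = n" "\<And>n. P n \<noteq> 0"
    and orth: "\<And>m n. ip (\<lambda>t. poly (P m) (cos t)) (\<lambda>t. poly (P n) (cos t)) = (if m = n then 1 else 0)"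
    and S: "\<And>n. L2 (S n)" and S0: "\<And>m n. m < n \<Longrightarrow> ip (S n) (\<lambda>t. cos (real m * t)) = 0"
    and Snorm: "(\<lambda>n. ip (S n) (S n)) \<longlonglongrightarrow> \<nu>"
    and approx: "\<And>\<epsilon>. \<epsilon> > 0 \<Longrightarrow> \<forall>\<^sub>F n in sequentially. \<exists>Q. degree Q \<le> n \<and>
       ip (\<lambda>t. S n t - poly Q (cos t)) (\<lambda>t. S n t - poly Q (cos t)) < \<epsilon>"
    and th: "0 < \<theta>" "\<theta> < pi"
    and w: "summable (\<lambda>k. \<bar>w k\<bar>)"
    and series: "\<And>n t. 0 < t \<Longrightarrow> t < pi \<Longrightarrow>
       (\<lambda>k. w k * cos ((real k - real (n + 2 * m)) * t)) sums (sin t ^ (2 * m) * S n t)"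
    and H: "integrable half_circle (\<lambda>t. (sin t ^ (2 * m) * ((f t - f \<theta>) / (cos t - cos \<theta>)))\<^sup>2 / f t)"
  defines "c \<equiv> (\<lambda>n. ip (S n) (\<lambda>t. poly (P n) (cos t)))"
  shows "(\<lambda>n. (c n)\<^sup>2) \<longlonglongrightarrow> \<nu>" and "(\<lambda>n. c n * poly (P n) (cos \<theta>) - S n \<theta>) \<longlonglongrightarrow> 0"
proof -
  let ?M = "half_circle"
  define e where "e n = (\<lambda>t. c n * poly (P n) (cos t) - S n t)" for n
  have res: "L2 (e n)" "\<And>Q. degree Q \<le> n \<Longrightarrow> ip (e n) (\<lambda>t. poly Q (cos t)) = 0"
    "ip (S n) (S n) = (c n)\<^sup>2 + ip (e n) (e n)"
    "\<And>Q. degree Q \<le> n \<Longrightarrow> ip (e n) (e n) \<le> ip (\<lambda>t. S n t - poly Q (cos t)) (\<lambda>t. S n t - poly Q (cos t))" for n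
    unfolding e_def c_def by (rule orthonormal_residual[OF P orth S S0]; assumption)+
  have ee: "(\<lambda>n. ip (e n) (e n)) \<longlonglongrightarrow> 0"
  proof (rule LIMSEQ_I)
    fix \<epsilon> :: real assume "\<epsilon> > 0"
    from approx[OF this] obtain n0 where n0: "\<And>n. n \<ge> n0 \<Longrightarrow> \<exists>Q. degree Q \<le> n \<and>
       ip (\<lambda>t. S n t - poly Q (cos t)) (\<lambda>t. S n t - poly Q (cos t)) < \<epsilon>"
      by (auto simp: eventually_sequentially)
    have "norm (ip (e n) (e n) - 0) < \<epsilon>" if n: "n \<ge> n0" for n
    proof -
      obtain Q where Q: "degree Q \<le> n" "ip (\<lambda>t. S n t - poly Q (cos t)) (\<lambda>t. S n t - poly Q (cos t)) < \<epsilon>"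
        using n0[OF n] by blast
      have "ip (e n) (e n) < \<epsilon>" using res(4)[OF Q(1)] Q(2) by linarith
      then show ?thesis using ip_nonneg[of "e n"] by simp
    qed
    then show "\<exists>n0. \<forall>n\<ge>n0. norm (ip (e n) (e n) - 0) < \<epsilon>" by blast
  qed
  have "(\<lambda>n. ip (S n) (S n) - ip (e n) (e n)) \<longlonglongrightarrow> \<nu> - 0" by (intro tendsto_diff Snorm ee)
  moreover have "ip (S n) (S n) - ip (e n) (e n) = (c n)\<^sup>2" for n using res(3)[of n] by simp
  ultimately show "(\<lambda>n. (c n)\<^sup>2) \<longlonglongrightarrow> \<nu>" by simp
  define q where "q = sin \<theta> ^ (2 * m)"
  have q: "q > 0" using sin_gt_zero[of \<theta>] th by (simp add: q_def)
  define C where "C = (8 * real m * sqrt (ip (\<lambda>_. 1) (\<lambda>_. 1)) +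
     2 * sqrt (integral\<^sup>L ?M (\<lambda>t. (sin t ^ (2 * m) * ((f t - f \<theta>) / (cos t - cos \<theta>)))\<^sup>2 / f t))) / f \<theta>"
  define tail where "tail n = (\<Sum>k. \<bar>w (k + Suc (2 * (n + 2 * m)))\<bar>)" for n
  have tail: "tail \<longlonglongrightarrow> 0"
  proof -
    have "(\<lambda>i. \<Sum>k. \<bar>w (k + i)\<bar>) \<longlonglongrightarrow> 0" using suminf_exist_split2[OF w] .
    moreover have "filterlim (\<lambda>n. Suc (2 * (n + 2 * m))) sequentially sequentially"
      by (rule filterlim_subseq) (auto simp: strict_mono_def)
    ultimately show ?thesis unfolding tail_def by (rule filterlim_compose)
  qed
  have bound: "pi * q * \<bar>e n \<theta>\<bar> \<le> C * sqrt (ip (e n) (e n)) + pi * tail n" if n: "2 * m \<le> n" for n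
  proof -
    let ?N = "n + 2 * m"
    let ?I = "\<lambda>g. integral\<^sup>L ?M (\<lambda>t. g t * cos_kernel \<theta> ?N t)"
    have span: "cos_span ?N (\<lambda>t. sin t ^ (2 * m) * (c n * poly (P n) (cos t)))"
    proof -
      have "(sin t)\<^sup>2 = poly [:1, 0, -1:] (cos t)" for t :: real
        using sin_cos_squared_add[of t] by (simp add: power2_eq_square algebra_simps)
      then have eq: "sin t ^ (2 * m) * (c n * poly (P n) (cos t)) = poly ([:1, 0, -1:] ^ m * smult (c n) (P n)) (cos t)" for t
        by (simp only: power_mult poly_power poly_mult poly_smult)
      have "degree ([:1, 0, -1:] ^ m * smult (c n) (P n)) \<le> ?N"
        using degree_mult_le[of "[:1, 0, -1:] ^ m" "smult (c n) (P n)"] degree_power_le[of "[:1, 0, -1::real:]" m] P(1)[of n]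
          degree_smult_le[of "c n" "P n"] by simp
      from cos_span_poly[OF this] show ?thesis by (simp only: eq)
    qed
    note k1 = cos_span_kernel_integral[OF span, of \<theta>]
    note k2 = cos_series_kernel_integral[OF w series th]
    have "?I (\<lambda>t. sin t ^ (2 * m) * e n t) = ?I (\<lambda>t. sin t ^ (2 * m) * (c n * poly (P n) (cos t))) - ?I (\<lambda>t. sin t ^ (2 * m) * S n t)"
      by (subst Bochner_Integration.integral_diff[symmetric]) (use k1(1) k2(1)[of n] in \<open>auto simp: e_def algebra_simps\<close>)
    also have "\<dots> = pi * (q * (c n * poly (P n) (cos \<theta>))) - ?I (\<lambda>t. sin t ^ (2 * m) * S n t)"
      unfolding k1(2) q_def by simp
    finally have "pi * q * e n \<theta> = ?I (\<lambda>t. sin t ^ (2 * m) * e n t) + (?I (\<lambda>t. sin t ^ (2 * m) * S n t) - pi * (q * S n \<theta>))"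
      by (simp add: e_def algebra_simps)
    moreover have "\<bar>?I (\<lambda>t. sin t ^ (2 * m) * S n t) - pi * (q * S n \<theta>)\<bar> \<le> pi * tail n"
      using k2(2)[of n] by (simp add: tail_def q_def)
    moreover have "\<bar>?I (\<lambda>t. sin t ^ (2 * m) * e n t)\<bar> \<le> C * sqrt (ip (e n) (e n))"
      unfolding C_def by (rule residual_kernel_bound[OF th res(1) res(2) n H])
    ultimately have "\<bar>pi * q * e n \<theta>\<bar> \<le> C * sqrt (ip (e n) (e n)) + pi * tail n" by linarith
    then show ?thesis using q by (simp add: abs_mult)
  qed
  have "(\<lambda>n. (C * sqrt (ip (e n) (e n)) + pi * tail n) / (pi * q)) \<longlonglongrightarrow> (C * sqrt 0 + pi * 0) / (pi * q)"
    using q by (intro tendsto_intros ee tail) auto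
  then have "(\<lambda>n. (C * sqrt (ip (e n) (e n)) + pi * tail n) / (pi * q)) \<longlonglongrightarrow> 0" by simp
  then have "(\<lambda>n. e n \<theta>) \<longlonglongrightarrow> 0"
  proof (rule Lim_null_comparison[rotated])
    show "\<forall>\<^sub>F n in sequentially. norm (e n \<theta>) \<le> (C * sqrt (ip (e n) (e n)) + pi * tail n) / (pi * q)"
      using eventually_ge_at_top[of "2 * m"]
    proof eventually_elim
      case (elim n)
      then show ?case using bound[OF elim] q by (simp add: pos_le_divide_eq mult.commute)
    qed
  qed
  then show "(\<lambda>n. c n * poly (P n) (cos \<theta>) - S n \<theta>) \<longlonglongrightarrow> 0" by (simp add: e_def)
qed

end

subsection \<open>Polynomial approximation of the reciprocal\<close>

text \<open>Half-angle forms. For t in (0, pi) the arguments (t - pi)/2 and t/2 lie strictly between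
  -pi/2 and pi/2, so principal powers can be taken factor by factor.\<close>

lemma one_minus_cis_polar: "0 \<le> t \<Longrightarrow> t \<le> 2 * pi \<Longrightarrow> 1 - cis t = of_real (2 * sin (t / 2)) * cis ((t - pi) / 2)"
  and one_plus_cis_polar: "1 + cis t = of_real (2 * cos (t / 2)) * cis (t / 2)"
proof -
  have c: "cos t = 1 - 2 * (sin (t / 2))\<^sup>2" using cos_double_sin[of "t / 2"] by simp
  have c': "cos t = 2 * (cos (t / 2))\<^sup>2 - 1" using cos_double_cos[of "t / 2"] by simp
  have s: "sin t = 2 * sin (t / 2) * cos (t / 2)" using sin_double[of "t / 2"] by simp
  have e: "(t - pi) / 2 = t / 2 - pi / 2" by (simp add: diff_divide_distrib)
  show "1 - cis t = of_real (2 * sin (t / 2)) * cis ((t - pi) / 2)"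
    unfolding e by (simp add: complex_eq_iff cos_diff sin_diff s c power2_eq_square)
  show "1 + cis t = of_real (2 * cos (t / 2)) * cis (t / 2)"
    by (simp add: complex_eq_iff s c' power2_eq_square)
qed

lemma powr_squared: "(x powr p)\<^sup>2 = x powr (2 * p)" for x p :: real
  using powr_add[of x p p] by (simp add: power2_eq_square)

lemma polar_powr:
  assumes "r > 0" "- pi < x" "x \<le> pi"
  shows "(of_real r * cis x) powr of_real a = of_real (r powr a) * cis (a * x)"
proof -
  have "Ln (of_real r * cis x) = of_real (ln r) + \<i> * of_real x"
    by (rule Ln_unique) (use assms in \<open>auto simp: exp_add cis_conv_exp exp_of_real\<close>)
  then have "(of_real r * cis x) powr of_real a = exp (of_real (a * ln r) + \<i> * of_real (a * x))"
    using assms by (simp add: powr_def algebra_simps)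
  also have "\<dots> = of_real (r powr a) * cis (a * x)"
    using assms by (simp add: exp_add cis_conv_exp powr_def exp_of_real del: of_real_mult)
  finally show ?thesis .
qed

text \<open>Separates modulus and argument of the two power factors. The argument found here becomes
  the elementary part of \<open>phi\<close>.\<close>

lemma jacobi_fun_cis:
  assumes "0 < t" "t < pi"
  shows "jacobi_fun a b E (cis t) = of_real ((2 * sin (t / 2)) powr a * (2 * cos (t / 2)) powr b) *
    cis (a * ((t - pi) / 2) + b * (t / 2)) * E (cis t)"
proof -
  have "sin (t / 2) > 0" "cos (t / 2) > 0"
    using assms by (auto intro: sin_gt_zero cos_gt_zero_pi)
  then have "(of_real (2 * sin (t / 2)) * cis ((t - pi) / 2)) powr of_real a = of_real ((2 * sin (t / 2)) powr a) * cis (a * ((t - pi) / 2))"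
    "(of_real (2 * cos (t / 2)) * cis (t / 2)) powr of_real b = of_real ((2 * cos (t / 2)) powr b) * cis (b * (t / 2))"
    using assms by (intro polar_powr; simp)+
  moreover have "1 - cis t = of_real (2 * sin (t / 2)) * cis ((t - pi) / 2)"
    using assms by (intro one_minus_cis_polar) auto
  ultimately show ?thesis
    by (simp only: jacobi_fun_def one_plus_cis_polar cis_mult[symmetric] of_real_mult mult_ac)
qed

text \<open>The two distances have product 2 sin t, so shifting both exponents by s makes them
  nonnegative at the cost of (2 sin t)^(-s). For the squared modulus of D this matters: the negative
  parts of 2a and 2b may add up to more than 1, whereas their maximum stays below 1.\<close>

lemma circle_distance_product:
  fixes p q s :: real
  assumes t: "0 < t" "t < pi" and s: "0 \<le> s" "0 \<le> p + s" "0 \<le> q + s"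
  shows "norm (1 - cis t) powr p * norm (1 + cis t) powr q \<le> 2 powr (p + s) * 2 powr (q + s) * sin t powr (- s)"
proof -
  define u v where "u = norm (1 - cis t)" and "v = norm (1 + cis t)"
  have st: "sin t > 0" using t by (rule sin_gt_zero)
  have u: "0 < u" "u \<le> 2" and v: "0 < v" "v \<le> 2"
    using cis_not_pm1[OF t] norm_triangle_ineq4[of 1 "cis t"] norm_triangle_ineq[of 1 "cis t"]
    by (auto simp: u_def v_def add_eq_0_iff)
  have uv: "u * v = 2 * sin t"
  proof -
    have "(1 - cis t) * (1 + cis t) = - 2 * \<i> * of_real (sin t) * cis t"
      using sin_cos_squared_add[of t] by (simp add: complex_eq_iff power2_eq_square algebra_simps)
    then have "u * v = norm (- 2 * \<i> * of_real (sin t) * cis t)" by (simp only: u_def v_def norm_mult[symmetric])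
    then show ?thesis using st by (simp add: norm_mult)
  qed
  have "u powr p * v powr q = (u powr (p + s) * v powr (q + s)) * (u * v) powr (- s)"
    using u v by (simp add: powr_mult powr_add powr_minus field_simps)
  also have "\<dots> \<le> (2 powr (p + s) * 2 powr (q + s)) * sin t powr (- s)"
  proof (intro mult_mono)
    show "(u * v) powr (- s) \<le> sin t powr (- s)"
      unfolding uv using st s by (intro powr_mono2') auto
  qed (use u v s in \<open>auto intro!: powr_mono2\<close>)
  finally show ?thesis by (simp add: u_def v_def)
qed

lemma jacobi_fun_sq_integrable:
  assumes R: "1 < R" and E: "E holomorphic_on ball 0 R" and ab: "- 1/2 < a" "- 1/2 < b"
  shows "integrable half_circle (\<lambda>t. (norm (jacobi_fun a b E (cis t)))\<^sup>2)"
proof -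
  have contE: "continuous_on (cball 0 1) E"
    using E R by (auto intro!: holomorphic_on_imp_continuous_on elim!: holomorphic_on_subset)
  obtain K where K: "\<And>w. w \<in> cball 0 1 \<Longrightarrow> norm (E w) \<le> K"
    using compact_imp_bounded[OF compact_continuous_image[OF contE compact_cball]] unfolding bounded_iff by (metis image_eqI)
  define s where "s = max 0 (max (- 2 * a) (- 2 * b))"
  have s: "0 \<le> s" "s < 1" "0 \<le> 2 * a + s" "0 \<le> 2 * b + s" using ab by (auto simp: s_def)
  show ?thesis
  proof (rule integrable_half_circle_dominated)
    show "continuous_on {0<..<pi} (\<lambda>t. (norm (jacobi_fun a b E (cis t)))\<^sup>2)"
      by (intro continuous_intros continuous_on_jacobi_fun_cis[OF R E])
    show "integrable half_circle (\<lambda>t. K\<^sup>2 * (2 powr (2 * a + s) * 2 powr (2 * b + s)) * sin t powr (- s))"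
      by (intro integrable_mult_right integrable_sin_powr s)
    fix t :: real assume t: "0 < t" "t < pi"
    have "(norm (jacobi_fun a b E (cis t)))\<^sup>2 = (norm (E (cis t)))\<^sup>2 * (norm (1 - cis t) powr (2 * a) * norm (1 + cis t) powr (2 * b))"
      using cis_not_pm1[OF t] unfolding norm_jacobi_fun
      by (simp add: power_mult_distrib powr_squared mult_ac)
    also have "\<dots> \<le> K\<^sup>2 * (2 powr (2 * a + s) * 2 powr (2 * b + s) * sin t powr (- s))"
      using K[of "cis t"] by (intro mult_mono circle_distance_product t s power_mono) auto
    finally show "norm ((norm (jacobi_fun a b E (cis t)))\<^sup>2) \<le> K\<^sup>2 * (2 powr (2 * a + s) * 2 powr (2 * b + s)) * sin t powr (- s)"
      by (simp add: mult.assoc)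
  qed
qed

text \<open>Meant for x = |1 - r e^(it)| and y = |1 - e^(it)|, and for the same pair with a plus
  sign: the quotient of dilated and undilated powers is bounded independently of r.\<close>

lemma powr_ratio_bound:
  fixes x y a :: real
  assumes "0 < x" "0 < y" "y \<le> 2 * x" "x \<le> 2"
  shows "x powr (- a) * y powr a \<le> 2 powr \<bar>a\<bar> * y powr (min a 0)"
proof (cases "a \<ge> 0")
  case True
  have "x powr (- a) * y powr a = (y / x) powr a" using assms by (simp add: powr_divide powr_minus field_simps)
  also have "\<dots> \<le> 2 powr a" using assms True by (intro powr_mono2) (auto simp: field_simps)
  finally show ?thesis using True assms by simp
next
  case False
  then have "x powr (- a) \<le> 2 powr (- a)" using assms by (intro powr_mono2) auto
  then show ?thesis using False by (auto intro!: mult_right_mono)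
qed

text \<open>Dilating the reciprocal \<open>1/D\<close> to \<open>1/D (r z)\<close> and truncating its Taylor series shows that \<open>D\<close> is outer,
  i.e. \<open>1/D\<close> lies in the closure of the polynomials in the weighted space.\<close>

lemma reciprocal_polynomial_approximation:
  assumes R: "1 < R" and E: "E holomorphic_on ball 0 R" and E0: "\<And>z. E z \<noteq> 0"
    and re: "\<And>x. \<bar>x\<bar> < 1 \<Longrightarrow> E (of_real x) \<in> \<real>"
    and ab: "- 1/2 < a" "- 1/2 < b" and \<epsilon>: "\<epsilon> > 0"
  defines "D \<equiv> (\<lambda>t. jacobi_fun a b E (cis t))"
  obtains d and \<rho> :: "nat \<Rightarrow> real" where
    "integral\<^sup>L half_circle (\<lambda>t. (norm (1 / D t - (\<Sum>k\<le>d. of_real (\<rho> k) * cis (real k * t))))\<^sup>2 * (norm (D t))\<^sup>2) < \<epsilon>"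
proof -
  let ?M = "half_circle"
  define E' where "E' z = inverse (E z)" for z
  have E': "E' holomorphic_on ball 0 R" unfolding E'_def using E0 by (intro holomorphic_intros E) auto
  have re': "E' (of_real x) \<in> \<real>" if "\<bar>x\<bar> < 1" for x unfolding E'_def using re[OF that] by simp
  define G where "G = jacobi_fun (- a) (- b) E'"
  have GD: "G (cis t) = inverse (D t)" for t by (simp add: G_def D_def E'_def[abs_def] jacobi_fun_inverse)
  have Dnz: "D t \<noteq> 0" if "0 < t" "t < pi" for t
    using cis_not_pm1[OF that] E0 by (simp add: D_def jacobi_fun_def add_eq_0_iff)
  have contD: "continuous_on {0<..<pi} D" unfolding D_def by (rule continuous_on_jacobi_fun_cis[OF R E])
  have contE: "continuous_on (cball 0 1) E" "continuous_on (cball 0 1) E'"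
    using E E' R by (auto intro!: holomorphic_on_imp_continuous_on elim!: holomorphic_on_subset)
  obtain K where K: "\<And>w. w \<in> cball 0 1 \<Longrightarrow> norm (E w) \<le> K"
    using compact_imp_bounded[OF compact_continuous_image[OF contE(1) compact_cball]] unfolding bounded_iff by (metis image_eqI)
  obtain K' where K': "\<And>w. w \<in> cball 0 1 \<Longrightarrow> norm (E' w) \<le> K'"
    using compact_imp_bounded[OF compact_continuous_image[OF contE(2) compact_cball]] unfolding bounded_iff by (metis image_eqI)
  define s where "s = max 0 (max (- 2 * a) (- 2 * b))"
  have s: "0 \<le> s" "s < 1" "0 \<le> 2 * min a 0 + s" "0 \<le> 2 * min b 0 + s" using ab by (auto simp: s_def)
  define r where "r n = 1 - 1 / real (n + 2)" for n
  have r: "0 \<le> r n" "r n < 1" for n by (auto simp: r_def field_simps)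
  have r_lim: "r \<longlonglongrightarrow> 1" unfolding r_def by real_asymp
  define C where "C = (2 powr \<bar>a\<bar> * 2 powr \<bar>b\<bar> * K * K')\<^sup>2 * (2 powr (2 * min a 0 + s) * 2 powr (2 * min b 0 + s))"
  \<comment> \<open>A majorant free of n, as dominated convergence along r n tending to 1
    requires.\<close>
  have GDb: "(norm (G (of_real (r n) * cis t) * D t))\<^sup>2 \<le> C * sin t powr (- s)" if t: "0 < t" "t < pi" for n t
  proof -
    let ?w = "of_real (r n) * cis t"
    define x y x' y' where "x = norm (1 - ?w)" and "y = norm (1 - cis t)" and "x' = norm (1 + ?w)" and "y' = norm (1 + cis t)"
    have w: "norm ?w = r n" using r[of n] by (simp add: norm_mult)
    have dist: "norm (cis t - ?w) = 1 - r n"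
    proof -
      have "cis t - ?w = of_real (1 - r n) * cis t" by (simp add: algebra_simps)
      then show ?thesis using r[of n] by (simp only: norm_mult norm_cis norm_of_real) simp
    qed
    have x: "1 - r n \<le> x" "x \<le> 2" "1 - r n \<le> x'" "x' \<le> 2"
      using norm_triangle_ineq2[of 1 ?w] norm_triangle_ineq4[of 1 ?w] norm_triangle_ineq[of 1 ?w]
        norm_triangle_ineq2[of 1 "- ?w"] w r[of n] by (auto simp: x_def x'_def)
    have y: "y \<le> 2 * x" "y' \<le> 2 * x'"
    proof -
      have "y \<le> x + norm (cis t - ?w)" unfolding y_def x_def
        using norm_triangle_ineq4[of "1 - ?w" "cis t - ?w"] by simp
      then show "y \<le> 2 * x" using dist x by linarith
      have "y' \<le> x' + norm (cis t - ?w)" unfolding y'_def x'_def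
        using norm_triangle_ineq[of "1 + ?w" "cis t - ?w"] by simp
      then show "y' \<le> 2 * x'" using dist x by linarith
    qed
    have pos: "0 < x" "0 < x'" "0 < y" "0 < y'"
      using x r[of n] cis_not_pm1[OF t] by (auto simp: y_def y'_def add_eq_0_iff)
    have "norm (G ?w * D t) = (x powr (- a) * y powr a) * (x' powr (- b) * y' powr b) * (norm (E' ?w) * norm (E (cis t)))"
      by (simp add: G_def D_def norm_mult norm_jacobi_fun x_def y_def x'_def y'_def mult_ac)
    also have "\<dots> \<le> (2 powr \<bar>a\<bar> * y powr (min a 0)) * (2 powr \<bar>b\<bar> * y' powr (min b 0)) * (K' * K)"
      using K[of "cis t"] K'[of ?w] w r[of n] pos x y
      by (intro mult_mono powr_ratio_bound) (auto intro: order_trans[OF norm_ge_zero])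
    also have "\<dots> = (2 powr \<bar>a\<bar> * 2 powr \<bar>b\<bar> * K * K') * (y powr (min a 0) * y' powr (min b 0))"
      by (simp add: mult_ac)
    finally have "(norm (G ?w * D t))\<^sup>2 \<le> ((2 powr \<bar>a\<bar> * 2 powr \<bar>b\<bar> * K * K') * (y powr (min a 0) * y' powr (min b 0)))\<^sup>2"
      by (rule power_mono) auto
    also have "\<dots> = (2 powr \<bar>a\<bar> * 2 powr \<bar>b\<bar> * K * K')\<^sup>2 * (y powr (2 * min a 0) * y' powr (2 * min b 0))"
      using pos by (simp add: power_mult_distrib powr_squared mult_ac)
    also have "\<dots> \<le> (2 powr \<bar>a\<bar> * 2 powr \<bar>b\<bar> * K * K')\<^sup>2 * (2 powr (2 * min a 0 + s) * 2 powr (2 * min b 0 + s) * sin t powr (- s))"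
      unfolding y_def y'_def by (intro mult_left_mono circle_distance_product t s) auto
    finally show ?thesis by (simp add: C_def mult.assoc)
  qed
  have contG: "continuous_on (ball 0 1) G"
    unfolding G_def by (rule holomorphic_on_imp_continuous_on[OF jacobi_fun_holomorphic[OF R E']])
  have contGr: "continuous_on {0<..<pi} (\<lambda>t. G (of_real (r n) * cis t))" for n
    by (rule continuous_on_compose2[OF contG]) (use r[of n] in \<open>auto intro!: continuous_intros simp: norm_mult\<close>)
  define X where "X n t = (norm (1 - G (of_real (r n) * cis t) * D t))\<^sup>2" for n t
  have contX: "continuous_on {0<..<pi} (X n)" for n
    unfolding X_def by (intro continuous_intros contGr contD)
  have Xb: "X n t \<le> 2 + 2 * (C * sin t powr (- s))" if t: "0 < t" "t < pi" for n t
  proof -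
    let ?g = "G (of_real (r n) * cis t) * D t"
    have "X n t \<le> (1 + norm ?g)\<^sup>2"
      unfolding X_def using norm_triangle_ineq4[of 1 ?g] by (intro power_mono) auto
    also have "\<dots> \<le> 2 + 2 * (norm ?g)\<^sup>2"
      using sum_squares_bound[of 1 "norm ?g"] by (simp add: power2_eq_square algebra_simps)
    finally show ?thesis using GDb[OF t, of n] by linarith
  qed
  have X0: "X n t \<ge> 0" for n t by (simp add: X_def)
  have Bi: "integrable ?M (\<lambda>t. 2 + 2 * (C * sin t powr (- s)))"
    by (intro Bochner_Integration.integrable_add integrable_mult_right integrable_sin_powr s integrable_half_circle_const)
  have Xi: "integrable ?M (X n)" for n
    by (rule integrable_half_circle_dominated[OF contX Bi]) (use Xb X0 in auto)
  have Xlim: "(\<lambda>n. X n t) \<longlonglongrightarrow> 0" if t: "0 < t" "t < pi" for t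
  proof -
    have "isCont G (cis t)" unfolding G_def
      using cis_not_pm1[OF t] by (intro isCont_jacobi_fun[OF R E']) auto
    moreover have "(\<lambda>n. of_real (r n) * cis t) \<longlonglongrightarrow> cis t"
      using tendsto_mult_right[OF tendsto_of_real[OF r_lim], of "cis t"] by simp
    ultimately have "(\<lambda>n. G (of_real (r n) * cis t)) \<longlonglongrightarrow> G (cis t)" by (rule isCont_tendsto_compose)
    then have "(\<lambda>n. X n t) \<longlonglongrightarrow> (norm (1 - G (cis t) * D t))\<^sup>2" unfolding X_def by (intro tendsto_intros)
    then show ?thesis using Dnz[OF t] by (simp add: GD)
  qed
  have "(\<lambda>n. integral\<^sup>L ?M (X n)) \<longlonglongrightarrow> integral\<^sup>L ?M (\<lambda>t. 0)"
    by (rule integral_dominated_convergence[OF _ _ Bi])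
      (use Xb X0 Xlim Xi in \<open>auto intro!: AE_I2 simp: space_restrict_space\<close>)
  then have "(\<lambda>n. integral\<^sup>L ?M (X n)) \<longlonglongrightarrow> 0" by simp
  then obtain n where n: "integral\<^sup>L ?M (X n) < \<epsilon> / 4"
  proof -
    assume lim: "(\<lambda>n. integral\<^sup>L ?M (X n)) \<longlonglongrightarrow> 0"
    have "0 < \<epsilon> / 4" using \<epsilon> by simp
    from order_tendstoD(2)[OF lim this] show thesis
      using that by (auto simp: eventually_sequentially)
  qed
  define c where "c k = Re ((deriv ^^ k) G 0 / fact k)" for k
  have Gs: "(\<lambda>k. of_real (c k) * z ^ k) sums G z" if "norm z < 1" for z
    unfolding c_def G_def
    by (rule real_taylor[OF jacobi_fun_holomorphic[OF R E'] jacobi_fun_real[where E=E', OF re'] that]) auto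
  define \<rho> where "\<rho> k = c k * r n ^ k" for k
  have summ: "summable (\<lambda>k. \<bar>\<rho> k\<bar>)"
  proof -
    obtain q where q: "r n < q" "q < 1" using dense r by blast
    have "summable (\<lambda>k. of_real (c k) * (of_real q :: complex) ^ k)"
      using Gs[of "of_real q"] q r[of n] by (auto simp: sums_iff)
    then have "summable (\<lambda>k. norm (of_real (c k) * (of_real (r n) :: complex) ^ k))"
      by (rule powser_insidea) (use q r[of n] in auto)
    then show ?thesis using r[of n] by (simp add: norm_mult norm_power \<rho>_def abs_mult)
  qed
  have rs: "(\<lambda>k. of_real (\<rho> k) * cis (real k * t)) sums G (of_real (r n) * cis t)" for t
    using Gs[of "of_real (r n) * cis t"] r[of n]
    by (simp add: \<rho>_def norm_mult power_mult_distrib Complex.DeMoivre mult_ac)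
  define F where "F = integral\<^sup>L ?M (\<lambda>t. (norm (D t))\<^sup>2)"
  have Fi: "integrable ?M (\<lambda>t. (norm (D t))\<^sup>2)" unfolding D_def by (rule jacobi_fun_sq_integrable[OF R E ab])
  have F0: "F \<ge> 0" unfolding F_def by (intro integral_nonneg_AE) auto
  \<comment> \<open>Chosen so that 2 \<eta>^2 F is at most \<epsilon>/2; F + 1 avoids division by 0.
    The other half of \<epsilon> is twice the integral of \<open>X n\<close>, already below
    \<epsilon>/4.\<close>
  define \<eta> where "\<eta> = sqrt (\<epsilon> / (4 * (F + 1)))"
  have \<eta>: "\<eta> > 0" "\<eta>\<^sup>2 = \<epsilon> / (4 * (F + 1))" using \<epsilon> F0 by (auto simp: \<eta>_def)
  obtain d where d: "(\<Sum>k. \<bar>\<rho> (k + Suc d)\<bar>) < \<eta>"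
  proof -
    have "(\<lambda>i. \<Sum>k. \<bar>\<rho> (k + i)\<bar>) \<longlonglongrightarrow> 0" by (rule suminf_exist_split2[OF summ])
    then obtain i where "\<And>j. j \<ge> i \<Longrightarrow> norm ((\<Sum>k. \<bar>\<rho> (k + j)\<bar>) - 0) < \<eta>"
      using LIMSEQ_D \<eta>(1) by blast
    from this[of "Suc i"] show thesis by (intro that[of i]) auto
  qed
  define p where "p t = (\<Sum>k\<le>d. of_real (\<rho> k) * cis (real k * t))" for t
  have tail: "norm (G (of_real (r n) * cis t) - p t) \<le> \<eta>" for t
  proof -
    have "(\<lambda>k. of_real (\<rho> (k + Suc d)) * cis (real (k + Suc d) * t)) sums (G (of_real (r n) * cis t) - p t)"
      using sums_split_initial_segment[OF rs[of t], of "Suc d"] by (simp add: p_def lessThan_Suc_atMost)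
    then have "G (of_real (r n) * cis t) - p t = (\<Sum>k. of_real (\<rho> (k + Suc d)) * cis (real (k + Suc d) * t))"
      by (rule sums_unique)
    also have "norm \<dots> \<le> (\<Sum>k. \<bar>\<rho> (k + Suc d)\<bar>)"
      by (rule norm_suminf_le) (use summ in \<open>auto simp: norm_mult simp del: of_nat_Suc of_nat_add intro!: summable_ignore_initial_segment[of _ "Suc d", simplified]\<close>)
    finally show ?thesis using d by linarith
  qed
  \<comment> \<open>(1/D - p) D = (1 - G D) + (G - p) D with G evaluated at the dilated point: the
    first term is the dilation error, the second the truncation error.\<close>
  have bd: "(norm (1 / D t - p t))\<^sup>2 * (norm (D t))\<^sup>2 \<le> 2 * X n t + 2 * \<eta>\<^sup>2 * (norm (D t))\<^sup>2" if t: "0 < t" "t < pi" for t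
  proof -
    let ?g = "G (of_real (r n) * cis t)"
    have "norm (1 / D t - p t) * norm (D t) = norm ((1 - ?g * D t) + (?g - p t) * D t)"
      using Dnz[OF t] by (simp add: norm_mult[symmetric] algebra_simps)
    also have "\<dots> \<le> norm (1 - ?g * D t) + \<eta> * norm (D t)"
      using tail[of t] by (intro order_trans[OF norm_triangle_ineq] add_left_mono) (simp add: norm_mult mult_right_mono)
    finally have "(norm (1 / D t - p t) * norm (D t))\<^sup>2 \<le> (norm (1 - ?g * D t) + \<eta> * norm (D t))\<^sup>2"
      by (intro power_mono) auto
    also have "\<dots> \<le> 2 * (norm (1 - ?g * D t))\<^sup>2 + 2 * (\<eta> * norm (D t))\<^sup>2"
      using sum_squares_bound[of "norm (1 - ?g * D t)" "\<eta> * norm (D t)"] by (simp add: power2_eq_square algebra_simps)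
    finally show ?thesis by (simp add: X_def power_mult_distrib)
  qed
  have Bi2: "integrable ?M (\<lambda>t. 2 * X n t + 2 * \<eta>\<^sup>2 * (norm (D t))\<^sup>2)"
    by (intro Bochner_Integration.integrable_add integrable_mult_right Xi Fi)
  have "integral\<^sup>L ?M (\<lambda>t. (norm (1 / D t - p t))\<^sup>2 * (norm (D t))\<^sup>2) \<le> integral\<^sup>L ?M (\<lambda>t. 2 * X n t + 2 * \<eta>\<^sup>2 * (norm (D t))\<^sup>2)"
  proof (rule integral_mono[OF _ Bi2])
    show "integrable ?M (\<lambda>t. (norm (1 / D t - p t))\<^sup>2 * (norm (D t))\<^sup>2)"
      by (rule integrable_half_circle_dominated[OF _ Bi2])
        (use bd Dnz in \<open>auto intro!: continuous_intros contD simp: p_def\<close>)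
  qed (use bd in \<open>auto simp: space_restrict_space\<close>)
  also have "\<dots> = 2 * integral\<^sup>L ?M (X n) + 2 * \<eta>\<^sup>2 * F"
    unfolding F_def by (subst Bochner_Integration.integral_add) (use Xi Fi in auto)
  also have "\<dots> < \<epsilon> / 2 + \<epsilon> / 2"
  proof -
    have "F / (F + 1) \<le> 1" using F0 by simp
    then have "\<epsilon> / 2 * (F / (F + 1)) \<le> \<epsilon> / 2 * 1" using \<epsilon> by (intro mult_left_mono) auto
    moreover have "2 * \<eta>\<^sup>2 * F = \<epsilon> / 2 * (F / (F + 1))" unfolding \<eta>(2) using F0 by (simp add: field_simps)
    ultimately show ?thesis using n by linarith
  qed
  finally show thesis using that[of \<rho> d] by (simp add: p_def)
qed

subsection \<open>Asymptotics of the orthonormal polynomials\<close>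

text \<open>In \<open>cis_diff_product\<close> the factor |e^(it) - e^(-i\<theta>)| is at least sin
  \<theta>, since both sines are positive. This converts Lipschitz bounds in e^(it) into bounds in
  cos t.\<close>

lemma norm_cis_diff_le:
  assumes "0 < \<theta>" "\<theta> < pi" "0 < t" "t < pi"
  shows "norm (cis t - cis \<theta>) \<le> 2 / sin \<theta> * \<bar>cos t - cos \<theta>\<bar>"
proof -
  have s: "sin \<theta> > 0" "sin t > 0" using assms by (auto intro: sin_gt_zero)
  have "norm (cis t - cis \<theta>) * norm (cis t - cnj (cis \<theta>)) = 2 * \<bar>cos t - cos \<theta>\<bar>"
    unfolding norm_mult[symmetric] cis_diff_product by (simp add: norm_mult del: of_real_diff)
  moreover have "sin \<theta> \<le> norm (cis t - cnj (cis \<theta>))"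
    using abs_Im_le_cmod[of "cis t - cnj (cis \<theta>)"] s by simp
  then have "norm (cis t - cis \<theta>) * sin \<theta> \<le> norm (cis t - cis \<theta>) * norm (cis t - cnj (cis \<theta>))"
    by (intro mult_left_mono) auto
  ultimately show ?thesis using s by (simp add: field_simps)
qed

lemma LIMSEQ_Bseq_times_null:
  fixes u v :: "nat \<Rightarrow> real"
  assumes "Bseq u" "v \<longlonglongrightarrow> 0"
  shows "(\<lambda>n. u n * v n) \<longlonglongrightarrow> 0"
proof -
  obtain K where K: "\<And>n. norm (u n) \<le> K" using assms(1) by (auto simp: Bseq_def)
  show ?thesis
  proof (rule LIMSEQ_null_abs_le)
    show "\<bar>u n * v n\<bar> \<le> K * \<bar>v n\<bar>" for n
      using K[of n] by (simp add: abs_mult mult_right_mono)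
    show "(\<lambda>n. K * \<bar>v n\<bar>) \<longlonglongrightarrow> 0"
      using tendsto_mult_left[OF tendsto_rabs_zero[OF assms(2)], of K] by simp
  qed
qed

text \<open>Cosines and sines are each orthogonal on (0, pi), though not to one another, so Bessel
  is applied to the two families separately. Starting at index 1 gives the common squared norm pi/2;
  the even frequencies form a subsequence.\<close>

lemma half_circle_riemann_lebesgue:
  assumes u: "continuous_on {0<..<pi} u" "\<And>t. 0 < t \<Longrightarrow> t < pi \<Longrightarrow> \<bar>u t\<bar> \<le> B"
  shows "(\<lambda>n. integral\<^sup>L half_circle (\<lambda>t. u t * cos (2 * real n * t))) \<longlonglongrightarrow> 0"
    and "(\<lambda>n. integral\<^sup>L half_circle (\<lambda>t. u t * sin (2 * real n * t))) \<longlonglongrightarrow> 0"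
proof -
  interpret half_circle_weight "\<lambda>_. 1" by unfold_locales auto
  have L2u: "L2 u" by (rule L2_bounded[OF u])
  have i: "integrable half_circle (\<lambda>t. cos (real j * t) * cos (real k * t))" for j k
    using L2_prod[OF L2_cos[of j] L2_cos[of k]] by simp
  have ic: "integrable half_circle (\<lambda>t. cos (real j * t))" for j
    by (rule integrable_half_circle_bounded[where B=1]) (auto intro!: continuous_intros)
  have "(\<lambda>k. ip u (\<lambda>t. cos (real (Suc k) * t))) \<longlonglongrightarrow> 0"
    by (rule bessel_tendsto_zero[OF L2u L2_cos, of "pi / 2"]) (auto simp: ip_def integral_half_circle_cos_cos simp del: of_nat_Suc)
  then have "(\<lambda>k. ip u (\<lambda>t. cos (real k * t))) \<longlonglongrightarrow> 0" by (rule LIMSEQ_imp_Suc)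
  moreover have "filterlim (\<lambda>n::nat. 2 * n) sequentially sequentially"
    by (rule filterlim_subseq) (auto simp: strict_mono_def)
  ultimately have "(\<lambda>n. ip u (\<lambda>t. cos (real (2 * n) * t))) \<longlonglongrightarrow> 0" by (rule filterlim_compose)
  then show "(\<lambda>n. integral\<^sup>L half_circle (\<lambda>t. u t * cos (2 * real n * t))) \<longlonglongrightarrow> 0"
    by (simp add: ip_def)
  have L2s: "L2 (\<lambda>t. sin (real (Suc k) * t))" for k
    by (rule L2_bounded[where B=1]) (auto intro!: continuous_intros)
  have eq: "sin (real (Suc j) * t) * sin (real (Suc k) * t) = cos (real (Suc j) * t) * cos (real (Suc k) * t) - cos (real (Suc j + Suc k) * t)" for j k t
    using cos_add[of "real (Suc j) * t" "real (Suc k) * t"] by (simp add: algebra_simps)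
  have "ip (\<lambda>t. sin (real (Suc j) * t)) (\<lambda>t. sin (real (Suc k) * t)) = (if j = k then pi / 2 else 0)" for j k
    unfolding ip_def mult_1_right eq
    by (subst Bochner_Integration.integral_diff[OF i ic]) (simp only: integral_half_circle_cos_cos integral_half_circle_cos, simp)
  then have "(\<lambda>k. ip u (\<lambda>t. sin (real (Suc k) * t))) \<longlonglongrightarrow> 0"
    by (intro bessel_tendsto_zero[OF L2u L2s, of "pi / 2"]) auto
  then have "(\<lambda>k. ip u (\<lambda>t. sin (real k * t))) \<longlonglongrightarrow> 0" by (rule LIMSEQ_imp_Suc)
  from filterlim_compose[OF this \<open>filterlim (\<lambda>n::nat. 2 * n) sequentially sequentially\<close>]
  show "(\<lambda>n. integral\<^sup>L half_circle (\<lambda>t. u t * sin (2 * real n * t))) \<longlonglongrightarrow> 0"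
    by (simp add: ip_def)
qed

text \<open>\<open>E\<close> carries the factor of D that comes from h and never vanishes. The bound
  -1/2 on the exponents corresponds to \<alpha>, \<beta> > -1.\<close>

locale szego_function =
  fixes a b R :: real and E :: "complex \<Rightarrow> complex"
  assumes R: "1 < R" and E: "E holomorphic_on ball 0 R" and E_nz: "\<And>z. E z \<noteq> 0"
    and E_real: "\<And>x. \<bar>x\<bar> < 1 \<Longrightarrow> E (of_real x) \<in> \<real>"
    and ab: "- 1/2 < a" "- 1/2 < b"
begin

definition D :: "real \<Rightarrow> complex" where "D t = jacobi_fun a b E (cis t)"
definition f :: "real \<Rightarrow> real" where "f t = (norm (D t))\<^sup>2"
definition S :: "nat \<Rightarrow> real \<Rightarrow> real" where "S n t = Re (cis (- real n * t) / D t)"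

lemma D_nz: "0 < t \<Longrightarrow> t < pi \<Longrightarrow> D t \<noteq> 0"
  using cis_not_pm1[of t] E_nz by (simp add: D_def jacobi_fun_def add_eq_0_iff)

lemma continuous_D: "continuous_on {0<..<pi} D"
  unfolding D_def by (rule continuous_on_jacobi_fun_cis[OF R E])

sublocale half_circle_weight f
proof
  show "continuous_on {0<..<pi} f" unfolding f_def by (intro continuous_intros continuous_D)
  show "integrable half_circle f"
    unfolding f_def[abs_def] D_def by (rule jacobi_fun_sq_integrable[OF R E ab])
qed (simp add: f_def D_nz)

lemma continuous_S: "continuous_on {0<..<pi} (S n)"
  unfolding S_def by (intro continuous_intros continuous_D) (simp add: D_nz)

text \<open>With w = e^(-int) / D one has |w|^2 f = 1 and (Re w)^2 = (|w|^2 + Re (w^2)) / 2, while f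
  w^2 is e^(-2int) times the unimodular cnj D / D. So the oscillating part has bounded amplitude and
  frequency 2n.\<close>

lemma S_sq_f: "0 < t \<Longrightarrow> t < pi \<Longrightarrow> (S n t)\<^sup>2 * f t = 1 / 2 + (cos (2 * real n * t) * Re (cnj (D t) / D t) + sin (2 * real n * t) * Im (cnj (D t) / D t)) / 2"
proof -
  assume t: "0 < t" "t < pi"
  define w where "w = cis (- real n * t) / D t"
  have Sw: "S n t = Re w" by (simp add: S_def w_def)
  have nw: "(norm w)\<^sup>2 * f t = 1" using D_nz[OF t] by (simp add: w_def f_def norm_divide power_divide)
  have rw: "(Re w)\<^sup>2 = ((norm w)\<^sup>2 + Re (w\<^sup>2)) / 2" using cmod_power2[of w] by (simp add: power2_eq_square field_simps)
  have "(S n t)\<^sup>2 * f t = 1 / 2 + f t * Re (w\<^sup>2) / 2"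
    unfolding Sw rw using nw by (simp add: field_simps)
  also have "f t * Re (w\<^sup>2) = Re (of_real (f t) * w\<^sup>2)" by simp
  also have "of_real (f t) * w\<^sup>2 = cis (- (2 * real n * t)) * (cnj (D t) / D t)"
  proof -
    have "of_real (f t) = D t * cnj (D t)" unfolding f_def by (rule complex_norm_square)
    moreover have "(cis (- real n * t))\<^sup>2 = cis (- (2 * real n * t))" by (simp add: power2_eq_square cis_mult mult_ac)
    ultimately show ?thesis using D_nz[OF t] by (simp add: w_def power_divide power2_eq_square[of "D t"])
  qed
  also have "Re \<dots> = cos (2 * real n * t) * Re (cnj (D t) / D t) + sin (2 * real n * t) * Im (cnj (D t) / D t)"
    by (simp only: times_complex.sel cis.sel cos_minus sin_minus mult_minus_left diff_minus_eq_add)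
  finally show ?thesis .
qed

lemma S_sq_f_le: "0 < t \<Longrightarrow> t < pi \<Longrightarrow> (S n t)\<^sup>2 * f t \<le> 1"
proof -
  assume t: "0 < t" "t < pi"
  have "\<bar>S n t\<bar> \<le> 1 / norm (D t)"
    unfolding S_def using abs_Re_le_cmod[of "cis (- real n * t) / D t"] by (simp add: norm_divide)
  then have "\<bar>S n t\<bar> * norm (D t) \<le> 1" using D_nz[OF t] by (simp add: field_simps)
  then have "(\<bar>S n t\<bar> * norm (D t))\<^sup>2 \<le> 1" by (intro power_le_one) auto
  then show ?thesis by (simp add: f_def power_mult_distrib)
qed

lemma L2_S: "L2 (S n)"
proof -
  have "S n \<in> borel_measurable half_circle"
    by (intro continuous_imp_measurable_on_sets_lebesgue continuous_S) auto
  moreover have "integrable half_circle (\<lambda>t. (S n t)\<^sup>2 * f t)"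
    by (rule integrable_half_circle_bounded[where B=1])
      (use S_sq_f_le f_pos in \<open>auto intro!: continuous_intros continuous_S f_cont simp: less_imp_le\<close>)
  ultimately show ?thesis by (simp add: L2_def)
qed

text \<open>Because f = D cnj D, the product S_n f is Re (z^n D) at z = e^(it). The factor cos (m t)
  turns it into the mean of Re (z^(n+m) D) and Re (z^(n-m) D). Both exponents are positive, so these
  functions vanish at 0 and the mean value property gives 0.\<close>

lemma S_orthogonal:
  assumes "m < n"
  shows "ip (S n) (\<lambda>t. cos (real m * t)) = 0"
proof -
  have J: "integrable half_circle (\<lambda>t. Re (cis (real j * t) * D t))"
    "integral\<^sup>L half_circle (\<lambda>t. Re (cis (real j * t) * D t)) = 0" if "j > 0" for j
  proof -
    have E': "(\<lambda>z. z ^ j * E z) holomorphic_on ball 0 R" by (intro holomorphic_intros E)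
    have re': "of_real x ^ j * E (of_real x) \<in> \<real>" if "\<bar>x\<bar> < 1" for x
      using E_real[OF that] by (intro Reals_mult Reals_power) auto
    have eq: "jacobi_fun a b (\<lambda>z. z ^ j * E z) (cis t) = cis (real j * t) * D t" for t
      by (simp add: jacobi_fun_def D_def Complex.DeMoivre mult_ac)
    show "integrable half_circle (\<lambda>t. Re (cis (real j * t) * D t))"
      "integral\<^sup>L half_circle (\<lambda>t. Re (cis (real j * t) * D t)) = 0"
      using jacobi_fun_mean_value[OF R E' re' ab] that unfolding eq by auto
  qed
  have pt: "S n t * cos (real m * t) * f t = Re (cis (real (n + m) * t) * D t) / 2 + Re (cis (real (n - m) * t) * D t) / 2"
    if t: "0 < t" "t < pi" for t
  proof -
    have "S n t * f t = Re (cis (- real n * t) / D t * of_real (f t))"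
      by (simp only: S_def times_complex.sel Re_complex_of_real Im_complex_of_real mult_zero_right diff_0_right)
    also have "cis (- real n * t) / D t * of_real (f t) = cis (- real n * t) * cnj (D t)"
      using D_nz[OF t] unfolding f_def complex_norm_square by simp
    also have "Re \<dots> = Re (cnj \<dots>)" by (simp only: cnj.sel)
    also have "cnj (cis (- real n * t) * cnj (D t)) = cis (real n * t) * D t" by (simp add: cis_cnj)
    finally have "S n t * f t * cos (real m * t) = Re (cis (real n * t) * D t) * cos (real m * t)" by simp
    then have "S n t * cos (real m * t) * f t = Re (cis (real n * t) * D t * of_real (cos (real m * t)))"
      by (simp only: times_complex.sel(1)[of _ "of_real _"] Re_complex_of_real Im_complex_of_real mult_zero_right diff_0_right) (simp add: mult_ac)
    also have "cis (real n * t) * D t * of_real (cos (real m * t)) = (cis (real (n + m) * t) * D t) / 2 + (cis (real (n - m) * t) * D t) / 2"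
    proof -
      have "cis (real n * t) * of_real (cos (real m * t)) = cis (real (n + m) * t) / 2 + cis (real (n - m) * t) / 2"
        using assms by (simp add: complex_eq_iff of_nat_diff algebra_simps cos_add sin_add cos_diff sin_diff) (simp add: field_simps)
      then have "cis (real n * t) * of_real (cos (real m * t)) * D t = (cis (real (n + m) * t) / 2 + cis (real (n - m) * t) / 2) * D t"
        by (simp only:)
      then show ?thesis by (simp only: mult.assoc mult.commute[of "D t"] distrib_right times_divide_eq_left)
    qed
    finally show ?thesis by simp
  qed
  have "ip (S n) (\<lambda>t. cos (real m * t)) = integral\<^sup>L half_circle (\<lambda>t. Re (cis (real (n + m) * t) * D t) / 2 + Re (cis (real (n - m) * t) * D t) / 2)"
    unfolding ip_def by (rule Bochner_Integration.integral_cong) (use pt in \<open>auto simp: space_restrict_space\<close>)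
  also have "\<dots> = 0"
    using J[of "n + m"] J[of "n - m"] assms by (subst Bochner_Integration.integral_add) auto
  finally show ?thesis .
qed

text \<open>The constant 1/2 in \<open>S_sq_f\<close> contributes pi/2, and the oscillating part
  vanishes in the limit by Riemann-Lebesgue.\<close>

lemma S_norm_limit: "(\<lambda>n. ip (S n) (S n)) \<longlonglongrightarrow> pi / 2"
proof -
  let ?M = "half_circle"
  define G where "G t = cnj (D t) / D t" for t
  have cG: "continuous_on {0<..<pi} G" unfolding G_def by (intro continuous_intros continuous_D) (simp add: D_nz)
  have nG: "norm (G t) = 1" if "0 < t" "t < pi" for t using D_nz[OF that] by (simp add: G_def norm_divide)
  have bd: "\<bar>Re (G t)\<bar> \<le> 1" "\<bar>Im (G t)\<bar> \<le> 1" if "0 < t" "t < pi" for t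
    using abs_Re_le_cmod[of "G t"] abs_Im_le_cmod[of "G t"] nG[OF that] by auto
  have i1: "integrable ?M (\<lambda>t. Re (G t) * cos (2 * real n * t))" "integrable ?M (\<lambda>t. Im (G t) * sin (2 * real n * t))" for n
    by (rule integrable_half_circle_bounded[where B=1];
      use bd in \<open>auto intro!: continuous_intros cG mult_le_one simp: abs_mult\<close>)+
  have "ip (S n) (S n) = pi / 2 + (integral\<^sup>L ?M (\<lambda>t. Re (G t) * cos (2 * real n * t)) + integral\<^sup>L ?M (\<lambda>t. Im (G t) * sin (2 * real n * t))) / 2" for n
  proof -
    have "ip (S n) (S n) = integral\<^sup>L ?M (\<lambda>t. 1 / 2 + (Re (G t) * cos (2 * real n * t) + Im (G t) * sin (2 * real n * t)) / 2)"
      unfolding ip_def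
      by (rule Bochner_Integration.integral_cong)
        (use S_sq_f in \<open>auto simp: space_restrict_space G_def power2_eq_square mult_ac\<close>)
    also have "\<dots> = pi / 2 + (integral\<^sup>L ?M (\<lambda>t. Re (G t) * cos (2 * real n * t)) + integral\<^sup>L ?M (\<lambda>t. Im (G t) * sin (2 * real n * t))) / 2"
      using i1 by (subst Bochner_Integration.integral_add) (auto simp: measure_restrict_space)
    finally show ?thesis .
  qed
  moreover have "(\<lambda>n. pi / 2 + (integral\<^sup>L ?M (\<lambda>t. Re (G t) * cos (2 * real n * t)) + integral\<^sup>L ?M (\<lambda>t. Im (G t) * sin (2 * real n * t))) / 2) \<longlonglongrightarrow> pi / 2 + (0 + 0) / 2"
    using bd by (intro tendsto_intros half_circle_riemann_lebesgue continuous_intros cG) auto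
  ultimately show ?thesis by simp
qed

text \<open>One polynomial p of degree d close to 1/D serves every n at least d: at z = e^(it), Re
  (z^(-n) p(z)) is a cosine sum of degree at most n, and the factor z^(-n) does not change the
  modulus of the error.\<close>

lemma S_approximation:
  assumes "\<epsilon> > 0"
  shows "\<forall>\<^sub>F n in sequentially. \<exists>Q. degree Q \<le> n \<and> ip (\<lambda>t. S n t - poly Q (cos t)) (\<lambda>t. S n t - poly Q (cos t)) < \<epsilon>"
proof -
  obtain \<rho> d where \<rho>: "integral\<^sup>L half_circle (\<lambda>t. (norm (1 / D t - (\<Sum>k\<le>d. of_real (\<rho> k) * cis (real k * t))))\<^sup>2 * (norm (D t))\<^sup>2) < \<epsilon>"
    using reciprocal_polynomial_approximation[OF R E E_nz E_real ab assms] unfolding D_def by blast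
  obtain T :: "nat \<Rightarrow> real poly" where T: "\<And>k. degree (T k) \<le> k" "\<And>k t. poly (T k) (cos t) = cos (real k * t)"
    using chebyshev_poly_exists by metis
  show ?thesis
    using eventually_ge_at_top[of d]
  proof eventually_elim
    case (elim n)
    \<comment> \<open>The frequency |k - n|; the indices k at most d used below do not exceed
      n.\<close>
    define j where "j k = (if k \<le> n then n - k else k - n)" for k
    define Q where "Q = (\<Sum>k\<le>d. smult (\<rho> k) (T (j k)))"
    define \<Phi> where "\<Phi> t = 1 / D t - (\<Sum>k\<le>d. of_real (\<rho> k) * cis (real k * t))" for t
    have "degree Q \<le> n" unfolding Q_def
    proof (intro degree_sum_le)
      fix k assume "k \<in> {..d}"
      then have "j k \<le> n" using elim by (auto simp: j_def)
      then show "degree (smult (\<rho> k) (T (j k))) \<le> n"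
        using degree_smult_le[of "\<rho> k" "T (j k)"] T(1)[of "j k"] by linarith
    qed auto
    have Qc: "poly Q (cos t) = Re (cis (- real n * t) * (\<Sum>k\<le>d. of_real (\<rho> k) * cis (real k * t)))" for t
    proof -
      have "cos (real (j k) * t) = Re (cis (- real n * t) * cis (real k * t))" for k
        using cos_minus[of "(real k - real n) * t"] by (auto simp: j_def of_nat_diff cis_mult algebra_simps)
      then show ?thesis unfolding Q_def sum_distrib_left Re_sum poly_sum
        by (intro sum.cong refl) (simp only: poly_smult T, simp add: algebra_simps)
    qed
    have diff: "S n t - poly Q (cos t) = Re (cis (- real n * t) * \<Phi> t)" for t
      unfolding Qc S_def \<Phi>_def by (simp add: right_diff_distrib)
    have le: "(S n t - poly Q (cos t)) * (S n t - poly Q (cos t)) * f t \<le> (norm (\<Phi> t))\<^sup>2 * (norm (D t))\<^sup>2" for t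
    proof -
      have "\<bar>S n t - poly Q (cos t)\<bar> \<le> norm (\<Phi> t)"
        unfolding diff using abs_Re_le_cmod[of "cis (- real n * t) * \<Phi> t"] by (simp add: norm_mult)
      then have "(S n t - poly Q (cos t))\<^sup>2 \<le> (norm (\<Phi> t))\<^sup>2"
        by (metis abs_le_square_iff abs_norm_cancel)
      then show ?thesis unfolding f_def power2_eq_square[symmetric] by (intro mult_right_mono) auto
    qed
    have c\<Phi>: "continuous_on {0<..<pi} (\<lambda>t. (norm (\<Phi> t))\<^sup>2 * (norm (D t))\<^sup>2)"
      unfolding \<Phi>_def using D_nz by (intro continuous_intros continuous_D) auto
    have i\<Phi>: "integrable half_circle (\<lambda>t. (norm (\<Phi> t))\<^sup>2 * (norm (D t))\<^sup>2)"
    proof (rule integrable_half_circle_dominated[OF c\<Phi>])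
      define K where "K = (\<Sum>k\<le>d. \<bar>\<rho> k\<bar>)"
      show "integrable half_circle (\<lambda>t. 2 + 2 * K\<^sup>2 * f t)"
        by (intro Bochner_Integration.integrable_add integrable_mult_right f_int integrable_half_circle_const)
      fix t assume t: "0 < t" "t < pi"
      have "norm (\<Sum>k\<le>d. of_real (\<rho> k) * cis (real k * t)) \<le> K" unfolding K_def
        by (rule order_trans[OF norm_sum sum_mono]) (simp add: norm_mult)
      then have "norm (\<Phi> t) \<le> norm (1 / D t) + K"
        unfolding \<Phi>_def using norm_triangle_ineq4 order_trans add_left_mono by blast
      then have "(norm (\<Phi> t) * norm (D t))\<^sup>2 \<le> ((norm (1 / D t) + K) * norm (D t))\<^sup>2"
        by (intro power_mono mult_right_mono) auto
      also have "(norm (1 / D t) + K) * norm (D t) = 1 + K * norm (D t)"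
        using D_nz[OF t] by (simp add: norm_divide field_simps)
      also have "\<dots>\<^sup>2 \<le> 2 + 2 * (K * norm (D t))\<^sup>2"
        using sum_squares_bound[of 1 "K * norm (D t)"] by (simp add: power2_eq_square algebra_simps)
      finally show "norm ((norm (\<Phi> t))\<^sup>2 * (norm (D t))\<^sup>2) \<le> 2 + 2 * K\<^sup>2 * f t"
        by (simp add: f_def power_mult_distrib)
    qed
    have "ip (\<lambda>t. S n t - poly Q (cos t)) (\<lambda>t. S n t - poly Q (cos t)) \<le> integral\<^sup>L half_circle (\<lambda>t. (norm (\<Phi> t))\<^sup>2 * (norm (D t))\<^sup>2)"
      unfolding ip_def
      by (rule integral_mono[OF _ i\<Phi> le]) (intro L2_prod L2_diff L2_S L2_poly_cos)
    then have "ip (\<lambda>t. S n t - poly Q (cos t)) (\<lambda>t. S n t - poly Q (cos t)) < \<epsilon>" using \<rho> by (simp add: \<Phi>_def)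
    with \<open>degree Q \<le> n\<close> show ?case by blast
  qed
qed

text \<open>At z = e^(it) one has (1 - z^2)^(2m) = (-4)^m sin(t)^(2m) z^(2m). Hence sin^(2m) z^(2m)
  / D is a \<open>jacobi_fun\<close> with exponents 2m - a and 2m - b, at least 2, and has an
  absolutely convergent series. Multiplying by z^(-(n+2m)) gives the shift in the frequencies, with
  coefficients \<open>w\<close> that do not depend on n.\<close>

lemma S_series:
  assumes m: "2 + a \<le> 2 * real m" "2 + b \<le> 2 * real m"
  obtains w :: "nat \<Rightarrow> real" where "summable (\<lambda>k. \<bar>w k\<bar>)"
    "\<And>n t. 0 < t \<Longrightarrow> t < pi \<Longrightarrow> (\<lambda>k. w k * cos ((real k - real (n + 2 * m)) * t)) sums (sin t ^ (2 * m) * S n t)"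
    "\<And>t. 0 < t \<Longrightarrow> t < pi \<Longrightarrow> (sin t ^ (2 * m))\<^sup>2 / f t \<le> (\<Sum>k. \<bar>w k\<bar>)\<^sup>2"
proof -
  define E' where "E' z = inverse ((-4) ^ m * E z)" for z
  have E': "E' holomorphic_on ball 0 R" unfolding E'_def by (intro holomorphic_intros E) (auto simp: E_nz)
  have re': "E' (of_real x) \<in> \<real>" if "\<bar>x\<bar> < 1" for x
    unfolding E'_def using E_real[OF that] by (intro Reals_inverse Reals_mult Reals_power Reals_minus Reals_numeral)
  obtain w where w: "summable (\<lambda>k. \<bar>w k\<bar>)"
    "\<And>t. 0 < t \<Longrightarrow> t < pi \<Longrightarrow> (\<lambda>k. of_real (w k) * cis (real k * t)) sums jacobi_fun (real (2 * m) - a) (real (2 * m) - b) E' (cis t)"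
    using jacobi_fun_boundary_series[OF R E' re', of "real (2 * m) - a" "real (2 * m) - b"] m by auto
  have W: "jacobi_fun (real (2 * m) - a) (real (2 * m) - b) E' (cis t) = of_real (sin t ^ (2 * m)) * cis (real (2 * m) * t) / D t"
    if t: "0 < t" "t < pi" for t
  proof -
    note ne = cis_not_pm1[OF t]
    have n0: "1 - cis t \<noteq> 0" "1 + cis t \<noteq> 0" using ne by (auto simp: add_eq_0_iff)
    have pr: "(1 - cis t) * (1 + cis t) = - 2 * \<i> * of_real (sin t) * cis t"
      using sin_cos_squared_add[of t] by (simp add: complex_eq_iff power2_eq_square algebra_simps)
    have p: "x powr of_real (real (2 * m) - c) = x ^ (2 * m) / x powr of_real c" if "x \<noteq> 0" for x :: complex and c
      using that by (simp add: powr_diff powr_nat del: of_nat_mult)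
    have "jacobi_fun (real (2 * m) - a) (real (2 * m) - b) E' (cis t) = ((1 - cis t) * (1 + cis t)) ^ (2 * m) / (-4) ^ m / D t"
      unfolding jacobi_fun_def p[OF n0(1)] p[OF n0(2)] D_def E'_def power_mult_distrib
      using E_nz[of "cis t"] by (simp add: field_simps)
    also have "((1 - cis t) * (1 + cis t)) ^ (2 * m) = (-4) ^ m * of_real (sin t ^ (2 * m)) * cis (real (2 * m) * t)"
    proof -
      have "(- 2 * \<i>) ^ (2 * m) = (-4 :: complex) ^ m" by (simp add: power_mult power_mult_distrib)
      then show ?thesis unfolding pr power_mult_distrib Complex.DeMoivre by simp
    qed
    finally show ?thesis by simp
  qed
  show thesis
  proof (rule that[OF w(1)])
    fix n :: nat and t :: real assume t: "0 < t" "t < pi"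
    have "(\<lambda>k. cis (- real (n + 2 * m) * t) * (of_real (w k) * cis (real k * t))) sums
      (cis (- real (n + 2 * m) * t) * (of_real (sin t ^ (2 * m)) * cis (real (2 * m) * t) / D t))"
      using w(2)[OF t] unfolding W[OF t] by (rule sums_mult)
    then have "(\<lambda>k. Re (cis (- real (n + 2 * m) * t) * (of_real (w k) * cis (real k * t)))) sums
      Re (cis (- real (n + 2 * m) * t) * (of_real (sin t ^ (2 * m)) * cis (real (2 * m) * t) / D t))"
      by (rule sums_Re)
    moreover have "Re (cis (- real (n + 2 * m) * t) * (of_real (w k) * cis (real k * t))) = w k * cos ((real k - real (n + 2 * m)) * t)" for k
    proof -
      have eq: "cis (- real (n + 2 * m) * t) * (of_real (w k) * cis (real k * t)) = of_real (w k) * cis ((real k - real (n + 2 * m)) * t)"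
        by (simp add: cis_mult algebra_simps)
      show ?thesis unfolding eq by simp
    qed
    moreover have "Re (cis (- real (n + 2 * m) * t) * (of_real (sin t ^ (2 * m)) * cis (real (2 * m) * t) / D t)) = sin t ^ (2 * m) * S n t"
    proof -
      have "cis (- real (n + 2 * m) * t) * cis (real (2 * m) * t) = cis (- real n * t)"
        by (simp add: cis_mult algebra_simps)
      then have eq: "cis (- real (n + 2 * m) * t) * (of_real (sin t ^ (2 * m)) * cis (real (2 * m) * t) / D t) = of_real (sin t ^ (2 * m)) * (cis (- real n * t) / D t)"
        by (metis (no_types, lifting) mult.commute mult.left_commute times_divide_eq_right)
      show ?thesis unfolding eq S_def
        by (simp only: times_complex.sel Re_complex_of_real Im_complex_of_real mult_zero_left diff_0_right)
    qed
    ultimately show "(\<lambda>k. w k * cos ((real k - real (n + 2 * m)) * t)) sums (sin t ^ (2 * m) * S n t)" by simp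
  next
    fix t :: real assume t: "0 < t" "t < pi"
    have "of_real (sin t ^ (2 * m)) * cis (real (2 * m) * t) / D t = (\<Sum>k. of_real (w k) * cis (real k * t))"
      using w(2)[OF t] unfolding W[OF t] by (rule sums_unique)
    also have "norm \<dots> \<le> (\<Sum>k. \<bar>w k\<bar>)"
      by (rule norm_suminf_le) (use w(1) in \<open>auto simp: norm_mult\<close>)
    finally have "norm (of_real (sin t ^ (2 * m)) * cis (real (2 * m) * t) / D t) \<le> (\<Sum>k. \<bar>w k\<bar>)" .
    then have "\<bar>sin t ^ (2 * m)\<bar> / norm (D t) \<le> (\<Sum>k. \<bar>w k\<bar>)"
      by (simp only: norm_divide norm_mult norm_of_real norm_cis mult_1_right)
    then have "(\<bar>sin t ^ (2 * m)\<bar> / norm (D t))\<^sup>2 \<le> (\<Sum>k. \<bar>w k\<bar>)\<^sup>2" by (intro power_mono) auto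
    then show "(sin t ^ (2 * m))\<^sup>2 / f t \<le> (\<Sum>k. \<bar>w k\<bar>)\<^sup>2" by (simp only: power_divide power2_abs f_def)
  qed
qed

text \<open>D extends to a function complex differentiable at e^(i\<theta>), which bounds its
  increments near that point; factoring |D|^2 - |D(\<theta>)|^2 and using
  \<open>norm_cis_diff_le\<close> expresses the bound through cos.\<close>

lemma f_locally_lipschitz:
  assumes th: "0 < \<theta>" "\<theta> < pi"
  obtains C \<delta> where "\<delta> > 0" "C \<ge> 0"
    "\<And>t. 0 < t \<Longrightarrow> t < pi \<Longrightarrow> \<bar>cos t - cos \<theta>\<bar> < \<delta> \<Longrightarrow> \<bar>f t - f \<theta>\<bar> \<le> C * \<bar>cos t - cos \<theta>\<bar>"
proof -
  let ?J = "jacobi_fun a b E" and ?z0 = "cis \<theta>"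
  have s: "sin \<theta> > 0" using th by (rule sin_gt_zero)
  obtain J' where J': "(?J has_field_derivative J') (at ?z0)"
    using jacobi_fun_deriv[OF R E _ cis_not_pm1[OF th], of a b] by auto
  then have "((\<lambda>z. (?J z - ?J ?z0) / (z - ?z0)) \<longlongrightarrow> J') (at ?z0)"
    by (simp add: has_field_derivative_iff)
  then obtain d where d: "d > 0" "\<And>z. z \<noteq> ?z0 \<Longrightarrow> dist z ?z0 < d \<Longrightarrow> dist ((?J z - ?J ?z0) / (z - ?z0)) J' < 1"
    unfolding tendsto_iff eventually_at by (metis UNIV_I zero_less_one)
  define K where "K = norm J' + 1"
  have K: "norm (?J z - ?J ?z0) \<le> K * norm (z - ?z0)" if "dist z ?z0 < d" for z
  proof (cases "z = ?z0")
    case False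
    have "norm ((?J z - ?J ?z0) / (z - ?z0)) \<le> K"
      using d(2)[OF False that] norm_triangle_ineq2[of "(?J z - ?J ?z0) / (z - ?z0)" J'] by (simp add: K_def dist_norm)
    then show ?thesis using False by (simp add: norm_divide field_simps)
  qed simp
  have K0: "K \<ge> 0" by (simp add: K_def add_nonneg_nonneg)
  \<comment> \<open>Small enough that \<open>norm_cis_diff_le\<close> places e^(it) within d of
    e^(i\<theta>).\<close>
  define \<delta> where "\<delta> = d * sin \<theta> / 2"
  define C where "C = K * (2 / sin \<theta>) * (2 * norm (?J ?z0) + K * d)"
  show thesis
  proof (rule that[of \<delta> C])
    show "\<delta> > 0" using d s by (simp add: \<delta>_def)
    show "C \<ge> 0" using K0 s d by (simp add: C_def)
    fix t assume t: "0 < t" "t < pi" and lt: "\<bar>cos t - cos \<theta>\<bar> < \<delta>"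
    have n1: "norm (cis t - ?z0) \<le> 2 / sin \<theta> * \<bar>cos t - cos \<theta>\<bar>" by (rule norm_cis_diff_le[OF th t])
    also have "\<dots> < 2 / sin \<theta> * \<delta>" using lt s by (intro mult_strict_left_mono) auto
    finally have n2: "norm (cis t - ?z0) < d" using s by (simp add: \<delta>_def)
    then have k1: "norm (?J (cis t) - ?J ?z0) \<le> K * norm (cis t - ?z0)" by (intro K) (simp add: dist_norm)
    have k2: "norm (?J (cis t)) \<le> norm (?J ?z0) + K * d"
    proof -
      have "norm (?J (cis t)) \<le> norm (?J ?z0) + norm (?J (cis t) - ?J ?z0)"
        using norm_triangle_ineq[of "?J ?z0" "?J (cis t) - ?J ?z0"] by simp
      also have "norm (?J (cis t) - ?J ?z0) \<le> K * d" using k1 n2 K0 by (meson less_imp_le mult_left_mono order_trans)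
      finally show ?thesis by simp
    qed
    have "f t - f \<theta> = (norm (?J (cis t)) - norm (?J ?z0)) * (norm (?J (cis t)) + norm (?J ?z0))"
      by (simp add: f_def D_def power2_eq_square algebra_simps)
    then have "\<bar>f t - f \<theta>\<bar> = \<bar>norm (?J (cis t)) - norm (?J ?z0)\<bar> * (norm (?J (cis t)) + norm (?J ?z0))"
      by (simp add: abs_mult)
    also have "\<dots> \<le> (K * (2 / sin \<theta> * \<bar>cos t - cos \<theta>\<bar>)) * (2 * norm (?J ?z0) + K * d)"
    proof (intro mult_mono)
      show "\<bar>norm (?J (cis t)) - norm (?J ?z0)\<bar> \<le> K * (2 / sin \<theta> * \<bar>cos t - cos \<theta>\<bar>)"
        using norm_triangle_ineq3[of "?J (cis t)" "?J ?z0"] k1 mult_left_mono[OF n1 K0] by linarith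
    qed (use k2 K0 s in auto)
    finally show "\<bar>f t - f \<theta>\<bar> \<le> C * \<bar>cos t - cos \<theta>\<bar>" unfolding C_def by (simp only: mult_ac)
  qed
qed

text \<open>Near \<theta> the quotient is bounded by the Lipschitz constant. Away from \<theta> the
  denominator is at least \<delta>, and (f t - f \<theta>)^2 / f t is at most 2 f t + 2 (f
  \<theta>)^2 / f t; the sine power tames the last term, where 1/f may fail to be
  integrable.\<close>

lemma difference_quotient_integrable:
  assumes th: "0 < \<theta>" "\<theta> < pi" and B: "\<And>t. 0 < t \<Longrightarrow> t < pi \<Longrightarrow> (sin t ^ (2 * m))\<^sup>2 / f t \<le> B"
  shows "integrable half_circle (\<lambda>t. (sin t ^ (2 * m) * ((f t - f \<theta>) / (cos t - cos \<theta>)))\<^sup>2 / f t)"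
proof -
  let ?M = "half_circle"
  obtain C \<delta> where \<delta>: "\<delta> > 0" "C \<ge> 0"
    and C: "\<And>t. 0 < t \<Longrightarrow> t < pi \<Longrightarrow> \<bar>cos t - cos \<theta>\<bar> < \<delta> \<Longrightarrow> \<bar>f t - f \<theta>\<bar> \<le> C * \<bar>cos t - cos \<theta>\<bar>"
    by (rule f_locally_lipschitz[OF th]) (rule that; assumption)
  define q where "q t = sin t ^ (2 * m)" for t :: real
  have q1: "(q t)\<^sup>2 \<le> 1" for t
  proof -
    have "\<bar>q t\<bar> \<le> 1" unfolding q_def power_abs by (rule power_le_one) auto
    then show ?thesis by (simp add: abs_square_le_1)
  qed
  have B0: "B \<ge> 0"
  proof -
    have "0 \<le> (sin \<theta> ^ (2 * m))\<^sup>2 / f \<theta>" by (simp add: f_def)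
    then show ?thesis using B[OF th] by linarith
  qed
  have cosm [measurable]: "(\<lambda>t. cos t) \<in> borel_measurable ?M" "q \<in> borel_measurable ?M"
    unfolding q_def[abs_def] by (auto intro!: continuous_imp_measurable_on_sets_lebesgue continuous_intros)
  have "integrable ?M (\<lambda>t. (q t * ((f t - f \<theta>) / (cos t - cos \<theta>)))\<^sup>2 / f t)"
  proof (rule Bochner_Integration.integrable_bound)
    show "integrable ?M (\<lambda>t. C\<^sup>2 * B + (2 * f t + 2 * (f \<theta>)\<^sup>2 * B) / \<delta>\<^sup>2)"
      by (intro Bochner_Integration.integrable_add integrable_mult_right integrable_divide_zero f_int integrable_half_circle_const)
    show "(\<lambda>t. (q t * ((f t - f \<theta>) / (cos t - cos \<theta>)))\<^sup>2 / f t) \<in> borel_measurable ?M" by measurable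
    have "norm ((q t * ((f t - f \<theta>) / (cos t - cos \<theta>)))\<^sup>2 / f t) \<le> norm (C\<^sup>2 * B + (2 * f t + 2 * (f \<theta>)\<^sup>2 * B) / \<delta>\<^sup>2)"
      if t: "0 < t" "t < pi" for t
    proof -
      have ft: "f t > 0" using f_pos[OF t] .
      define r where "r = (f t - f \<theta>) / (cos t - cos \<theta>)"
      have Bt: "(q t)\<^sup>2 / f t \<le> B" using B[OF t] by (simp add: q_def)
      have e1: "C\<^sup>2 * B \<ge> 0" "(2 * f t + 2 * (f \<theta>)\<^sup>2 * B) / \<delta>\<^sup>2 \<ge> 0" using B0 ft by auto
      have "(q t * r)\<^sup>2 / f t \<le> C\<^sup>2 * B + (2 * f t + 2 * (f \<theta>)\<^sup>2 * B) / \<delta>\<^sup>2"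
      proof (cases "\<bar>cos t - cos \<theta>\<bar> < \<delta>")
        case True
        have "\<bar>r\<bar> \<le> C"
        proof (cases "cos t = cos \<theta>")
          case False
          then show ?thesis using C[OF t True] by (simp add: r_def abs_divide field_simps)
        qed (use \<delta> in \<open>simp add: r_def\<close>)
        then have "r\<^sup>2 \<le> C\<^sup>2" using \<delta> by (metis abs_le_square_iff abs_of_nonneg)
        then have "r\<^sup>2 * ((q t)\<^sup>2 / f t) \<le> C\<^sup>2 * B" using Bt ft by (intro mult_mono) auto
        then show ?thesis using e1 by (simp add: power_mult_distrib mult_ac)
      next
        case False
        have d2: "\<delta>\<^sup>2 \<le> (cos t - cos \<theta>)\<^sup>2" using False \<delta> by (metis abs_le_square_iff abs_of_pos linorder_not_less)
        have "0 < \<delta>\<^sup>2" using \<delta> by simp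
        with d2 have "0 < (cos t - cos \<theta>)\<^sup>2 * \<delta>\<^sup>2" by (intro mult_pos_pos) linarith+
        then have "r\<^sup>2 \<le> (f t - f \<theta>)\<^sup>2 / \<delta>\<^sup>2"
          unfolding r_def power_divide using d2 by (intro divide_left_mono) auto
        then have "r\<^sup>2 * ((q t)\<^sup>2 / f t) \<le> (f t - f \<theta>)\<^sup>2 / \<delta>\<^sup>2 * ((q t)\<^sup>2 / f t)" using ft by (intro mult_right_mono) auto
        also have "\<dots> = (f t - f \<theta>)\<^sup>2 * ((q t)\<^sup>2 / f t) / \<delta>\<^sup>2" by simp
        also have "\<dots> \<le> (2 * f t + 2 * (f \<theta>)\<^sup>2 * B) / \<delta>\<^sup>2"
        proof (rule divide_right_mono)
          have "0 \<le> (f t + f \<theta>)\<^sup>2" by simp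
          then have "(f t - f \<theta>)\<^sup>2 \<le> 2 * (f t)\<^sup>2 + 2 * (f \<theta>)\<^sup>2" by (simp add: power2_eq_square algebra_simps)
          then have "(f t - f \<theta>)\<^sup>2 * ((q t)\<^sup>2 / f t) \<le> (2 * (f t)\<^sup>2 + 2 * (f \<theta>)\<^sup>2) * ((q t)\<^sup>2 / f t)"
            using ft by (intro mult_right_mono) auto
          also have "\<dots> = 2 * f t * (q t)\<^sup>2 + 2 * (f \<theta>)\<^sup>2 * ((q t)\<^sup>2 / f t)"
            using ft by (simp add: field_simps power2_eq_square)
          also have "\<dots> \<le> 2 * f t * 1 + 2 * (f \<theta>)\<^sup>2 * B"
            using ft q1[of t] Bt by (intro add_mono mult_left_mono) auto
          finally show "(f t - f \<theta>)\<^sup>2 * ((q t)\<^sup>2 / f t) \<le> 2 * f t + 2 * (f \<theta>)\<^sup>2 * B" by simp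
        qed simp
        finally show ?thesis using e1 by (simp add: power_mult_distrib mult_ac)
      qed
      moreover have "(q t * r)\<^sup>2 / f t \<ge> 0" using ft by simp
      ultimately show ?thesis unfolding r_def[symmetric] by simp
    qed
    then show "AE t in ?M. norm ((q t * ((f t - f \<theta>) / (cos t - cos \<theta>)))\<^sup>2 / f t) \<le> norm (C\<^sup>2 * B + (2 * f t + 2 * (f \<theta>)\<^sup>2 * B) / \<delta>\<^sup>2)"
      by (intro AE_I2) (auto simp: space_restrict_space)
  qed
  then show ?thesis by (simp add: q_def)
qed

text \<open>Passing to squares removes the unknown sign of c_n. Boundedness of S_n(\<theta>) turns
  the null sequence c_n p_n - S_n into one for the squares.\<close>

theorem szego_asymptotics:
  fixes P :: "nat \<Rightarrow> real poly"
  assumes P: "\<And>n. degree (P n) = n" "\<And>n. P n \<noteq> 0"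
    and orth: "\<And>m n. ip (\<lambda>t. poly (P m) (cos t)) (\<lambda>t. poly (P n) (cos t)) = (if m = n then 1 else 0)"
    and th: "0 < \<theta>" "\<theta> < pi"
  shows "(\<lambda>n. pi / 2 * (poly (P n) (cos \<theta>))\<^sup>2 - (S n \<theta>)\<^sup>2) \<longlonglongrightarrow> 0"
proof -
  \<comment> \<open>Large enough for both exponents 2m - a and 2m - b in \<open>S_series\<close> to
    be at least 2.\<close>
  obtain m :: nat where m: "real m > 2 + \<bar>a\<bar> + \<bar>b\<bar>" using reals_Archimedean2 by blast
  obtain w :: "nat \<Rightarrow> real" where w: "summable (\<lambda>k. \<bar>w k\<bar>)"
    "\<And>n t. 0 < t \<Longrightarrow> t < pi \<Longrightarrow> (\<lambda>k. w k * cos ((real k - real (n + 2 * m)) * t)) sums (sin t ^ (2 * m) * S n t)"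
    "\<And>t. 0 < t \<Longrightarrow> t < pi \<Longrightarrow> (sin t ^ (2 * m))\<^sup>2 / f t \<le> (\<Sum>k. \<bar>w k\<bar>)\<^sup>2"
    by (rule S_series[of m]) (use m in auto)
  define c where "c n = ip (S n) (\<lambda>t. poly (P n) (cos t))" for n
  define p where "p n = poly (P n) (cos \<theta>)" for n
  note A = pointwise_asymptotics[OF P orth L2_S S_orthogonal S_norm_limit S_approximation th w(1,2)
      difference_quotient_integrable[OF th w(3)], folded c_def p_def]
  have S2: "(S n \<theta>)\<^sup>2 \<le> 1 / f \<theta>" for n
    using S_sq_f_le[OF th, of n] f_pos[OF th] by (simp add: field_simps)
  have Sb: "\<bar>S n \<theta>\<bar> \<le> sqrt (1 / f \<theta>)" for n using real_sqrt_le_mono[OF S2[of n]] by simp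
  define e where "e n = c n * p n - S n \<theta>" for n
  have e: "e \<longlonglongrightarrow> 0" unfolding e_def using A(2) by simp
  define X where "X n = (c n * p n)\<^sup>2" for n
  have XS: "(\<lambda>n. X n - (S n \<theta>)\<^sup>2) \<longlonglongrightarrow> 0"
  proof -
    have eq: "X n - (S n \<theta>)\<^sup>2 = e n * e n + 2 * S n \<theta> * e n" for n
      by (simp add: X_def e_def power2_eq_square algebra_simps)
    have "Bseq (\<lambda>n. 2 * S n \<theta>)"
      by (rule BseqI'[of _ "2 * sqrt (1 / f \<theta>)"]) (use Sb in \<open>auto simp: abs_mult simp del: real_sqrt_divide\<close>)
    from tendsto_add[OF tendsto_mult[OF e e] LIMSEQ_Bseq_times_null[OF this e]] show ?thesis
      unfolding eq by simp
  qed
  have XB: "Bseq X"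
  proof -
    obtain K where K: "\<And>n. norm (X n - (S n \<theta>)\<^sup>2) \<le> K"
      using convergent_imp_Bseq[OF convergentI[OF XS]] by (auto simp: Bseq_def)
    have "norm (X n) \<le> K + 1 / f \<theta>" for n
      using K[of n] S2[of n] by (simp add: X_def abs_le_iff)
    then show ?thesis by (rule BseqI')
  qed
  have c0: "\<forall>\<^sub>F n in sequentially. 0 < (c n)\<^sup>2"
    using A(1) pi_half_gt_zero by (rule order_tendstoD(1))
  have "(\<lambda>n. (pi / 2) / (c n)\<^sup>2 - 1) \<longlonglongrightarrow> (pi / 2) / (pi / 2) - 1"
    by (intro tendsto_intros A(1)) auto
  then have "(\<lambda>n. (pi / 2) / (c n)\<^sup>2 - 1) \<longlonglongrightarrow> 0" by simp
  \<comment> \<open>Replaces c_n^2 by its limit: (pi/2) p_n^2 is X_n times (pi/2) / c_n^2 once c_n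
    is nonzero, and X_n is bounded.\<close>
  from LIMSEQ_Bseq_times_null[OF XB this] have "(\<lambda>n. X n * ((pi / 2) / (c n)\<^sup>2 - 1)) \<longlonglongrightarrow> 0" .
  from tendsto_add[OF this XS] have "(\<lambda>n. X n * ((pi / 2) / (c n)\<^sup>2 - 1) + (X n - (S n \<theta>)\<^sup>2)) \<longlonglongrightarrow> 0" by simp
  then show ?thesis
  proof (rule Lim_transform_eventually)
    show "\<forall>\<^sub>F n in sequentially. X n * ((pi / 2) / (c n)\<^sup>2 - 1) + (X n - (S n \<theta>)\<^sup>2) = pi / 2 * (poly (P n) (cos \<theta>))\<^sup>2 - (S n \<theta>)\<^sup>2"
      using c0 by eventually_elim (simp add: X_def p_def power_mult_distrib field_simps)
  qed
qed

end

text \<open>Substitution x = cos t. Orthonormality is given through gauge integrals, while the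
  change of variables is for absolutely integrable functions, so integrability on the half circle is
  assumed and supplied later by \<open>L2_prod\<close>.\<close>

lemma orthonormal_polys_half_circle:
  assumes "orthonormal_polys w p"
    and i: "integrable half_circle (\<lambda>t. poly (p m) (cos t) * poly (p n) (cos t) * (w (cos t) * sin t))"
  shows "integral\<^sup>L half_circle (\<lambda>t. poly (p m) (cos t) * poly (p n) (cos t) * (w (cos t) * sin t)) = (if m = n then 1 else 0)"
proof -
  let ?g = "\<lambda>t. poly (p m) (cos t) * poly (p n) (cos t) * (w (cos t) * sin t)"
  let ?u = "\<lambda>x. poly (p m) x * poly (p n) x * w x"
  have eq: "\<bar>- sin t\<bar> * ?u (cos t) = ?g t" if "t \<in> {0<..<pi}" for t
    using sin_gt_zero[of t] that by simp
  have "?g absolutely_integrable_on {0<..<pi}"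
    using i by (simp add: integrable_restrict_space set_integrable_def)
  then have ai: "(\<lambda>t. \<bar>- sin t\<bar> * ?u (cos t)) absolutely_integrable_on {0<..<pi}"
    by (rule absolutely_integrable_spike[of _ _ "{}"]) (use eq in auto)
  have ui: "integral {0<..<pi} (\<lambda>t. \<bar>- sin t\<bar> * ?u (cos t)) = integral {0<..<pi} ?g"
    by (rule integral_cong) (rule eq)
  note im = cos_image_half_circle
  have inj: "inj_on cos {0<..<pi}" by (rule inj_onI) (auto intro: cos_inj_pi)
  have "integral (cos ` {0<..<pi}) ?u = integral {0<..<pi} ?g"
    using has_absolute_integral_change_of_variables_1'[OF _ has_field_derivative_at_within[OF DERIV_cos] inj, of ?u "integral {0<..<pi} ?g"] ai ui
    by auto
  moreover have "(?u has_integral (if m = n then 1 else 0)) {-1..1}"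
    using assms(1) by (auto simp: orthonormal_polys_def)
  then have "integral {-1<..<1} ?u = (if m = n then 1 else 0)"
    by (simp only: integral_open_interval_real[symmetric] integral_unique)
  ultimately have "integral {0<..<pi} ?g = (if m = n then 1 else 0)" unfolding im by simp
  then show ?thesis using lebesgue_integral_eq_integral[OF i] by simp
qed

theorem theorem1:
  fixes \<alpha> \<beta> :: real and h :: "real \<Rightarrow> real" and p :: "nat \<Rightarrow> real poly"
  assumes "\<alpha> > -1" and "\<beta> > -1"
    and "analytic_near_interval h"
    and "\<forall>t\<in>{-1..1}. h t > 0"
    and "orthonormal_polys (jacobi_weight \<alpha> \<beta> h) p"
    and "0 < \<theta>" and "\<theta> < pi"
  shows "(\<theta> / pi \<notin> \<rat> \<longrightarrow>
           (\<lambda>n. entropy_defect p n (cos \<theta>)) \<longlonglongrightarrow> 1 - ln 2)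
       \<and> (\<forall>s k :: nat. \<theta> / pi = real s / real k \<and> s < k \<and> gcd s k = 1 \<longrightarrow>
           (\<lambda>n. entropy_defect p n (cos \<theta>)) \<longlonglongrightarrow> ln 2 + 2 * S_hat \<alpha> \<beta> h k s)"
proof -
  note th = assms(6,7)
  obtain R L where R: "1 < R" and L: "L holomorphic_on ball 0 R" and Lcnj: "\<And>z. L (cnj z) = cnj (L z)"
    and Lh: "\<And>t. 2 * Re (L (cis t)) = ln (h (cos t))"
    using szego_logarithm[OF assms(3,4)] by blast
  \<comment> \<open>The additional 1/2 in each exponent comes from the Jacobian: sin t = 2 sin (t/2)
    cos (t/2) contributes one power of each half-angle function to |D|^2.\<close>
  define a b where "a = \<alpha> + 1/2" and "b = \<beta> + 1/2"
  \<comment> \<open>Normalises |D|^2: the half-angle factors (2 sin (t/2))^(2a) (2 cos (t/2))^(2b)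
    exceed (1 - cos t)^\<alpha> (1 + cos t)^\<beta> sin t by the factor 2^(\<alpha>+\<beta>+1),
    which exp (2 \<kappa>) removes.\<close>
  define \<kappa> where "\<kappa> = - (\<alpha> + \<beta> + 1) * ln 2 / 2"
  define E where "E z = exp (L z + of_real \<kappa>)" for z
  interpret sz: szego_function a b R E
  proof
    show "E holomorphic_on ball 0 R" unfolding E_def by (intro holomorphic_intros L)
    show "E (of_real x) \<in> \<real>" for x
    proof -
      have "cnj (L (of_real x)) = L (of_real x)" using Lcnj[of "of_real x"] by simp
      then have "cnj (E (of_real x)) = E (of_real x)" by (simp add: E_def exp_cnj)
      then show ?thesis by (metis Reals_cnj_iff)
    qed
  qed (use R assms(1,2) in \<open>auto simp: E_def a_def b_def\<close>)
  define \<omega> where "\<omega> t = a * ((t - pi) / 2) + b * (t / 2) + Im (L (cis t))" for t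
  have E_polar: "E z = of_real (exp (Re (L z) + \<kappa>)) * cis (Im (L z))" for z
    unfolding E_def by (simp add: exp_eq_polar)
  have D_polar: "sz.D t = of_real (norm (sz.D t)) * cis (\<omega> t)" "sz.f t = jacobi_weight \<alpha> \<beta> h (cos t) * sin t"
    if t: "0 < t" "t < pi" for t
  proof -
    define \<sigma> \<gamma> where "\<sigma> = 2 * sin (t / 2)" and "\<gamma> = 2 * cos (t / 2)"
    have pos: "\<sigma> > 0" "\<gamma> > 0" using t by (auto simp: \<sigma>_def \<gamma>_def intro: sin_gt_zero cos_gt_zero_pi)
    define r where "r = \<sigma> powr a * \<gamma> powr b * exp (Re (L (cis t)) + \<kappa>)"
    have r0: "r > 0" using pos by (simp add: r_def)
    have D: "sz.D t = of_real r * cis (\<omega> t)"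
      unfolding sz.D_def jacobi_fun_cis[OF t] E_polar r_def \<omega>_def \<sigma>_def \<gamma>_def
      by (simp add: mult_ac flip: cis_mult)
    then have nD: "norm (sz.D t) = r" using r0 by (simp add: norm_mult)
    with D show "sz.D t = of_real (norm (sz.D t)) * cis (\<omega> t)" by simp
    have hp: "h (cos t) > 0" using assms(4) by simp
    have "sz.f t = \<sigma> powr (2 * a) * \<gamma> powr (2 * b) * (exp (2 * Re (L (cis t))) * exp (2 * \<kappa>))"
      unfolding sz.f_def nD r_def by (simp add: power_mult_distrib powr_squared exp_add[symmetric] exp_double[symmetric] distrib_left)
    also have "exp (2 * Re (L (cis t))) = h (cos t)" using hp by (simp add: Lh)
    also have "exp (2 * \<kappa>) = 2 powr (- (\<alpha> + \<beta> + 1))" by (simp add: \<kappa>_def powr_def)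
    also have "\<sigma> powr (2 * a) * \<gamma> powr (2 * b) * (h (cos t) * 2 powr (- (\<alpha> + \<beta> + 1))) =
       (\<sigma>\<^sup>2 / 2) powr \<alpha> * (\<gamma>\<^sup>2 / 2) powr \<beta> * h (cos t) * (\<sigma> * \<gamma> / 2)"
    proof -
      have pw: "x powr (2 * (c + 1/2)) = (x\<^sup>2) powr c * x" if "x > 0" for x c :: real
      proof -
        have "x powr (2 * (c + 1/2)) = x powr (2 * c) * x powr 1"
          unfolding powr_add[symmetric] by (simp add: distrib_left)
        moreover have "(x\<^sup>2) powr c = x powr (2 * c)"
          using powr_powr[of x 2 c] powr_numeral[of x num.One] that by simp
        ultimately show ?thesis using that by simp
      qed
      have two: "2 powr (- (\<alpha> + \<beta> + 1)) = inverse (2 powr \<alpha> * 2 powr \<beta> * 2)"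
        unfolding powr_minus powr_add by simp
      have d: "(x\<^sup>2 / 2) powr c = (x\<^sup>2) powr c * inverse (2 powr c)" for x c :: real
      proof -
        have "(x\<^sup>2 / 2) powr c = (x\<^sup>2) powr c / 2 powr c" by (rule powr_divide; simp)
        then show ?thesis by (simp only: divide_inverse)
      qed
      show ?thesis
        unfolding a_def b_def pw[OF pos(1)] pw[OF pos(2)] two d
        unfolding divide_inverse inverse_mult_distrib
        by (simp only: mult_ac)
    qed
    also have "\<sigma>\<^sup>2 / 2 = 1 - cos t" using cos_double_sin[of "t / 2"] by (simp add: \<sigma>_def power_mult_distrib)
    also have "\<gamma>\<^sup>2 / 2 = 1 + cos t" using cos_double_cos[of "t / 2"] by (simp add: \<gamma>_def power_mult_distrib)
    also have "\<sigma> * \<gamma> / 2 = sin t" using sin_double[of "t / 2"] by (simp add: \<sigma>_def \<gamma>_def)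
    finally show "sz.f t = jacobi_weight \<alpha> \<beta> h (cos t) * sin t" by (simp add: jacobi_weight_def)
  qed
  have deg: "degree (p n) = n" "p n \<noteq> 0" for n
  proof -
    have d: "degree (p n) = n \<and> lead_coeff (p n) > 0"
      using assms(5) unfolding orthonormal_polys_def by blast
    then show "degree (p n) = n" by blast
    show "p n \<noteq> 0" using d leading_coeff_0_iff[of "p n"] by linarith
  qed
  have orth: "sz.ip (\<lambda>t. poly (p m) (cos t)) (\<lambda>t. poly (p n) (cos t)) = (if m = n then 1 else 0)" for m n
  proof -
    let ?M = "half_circle"
    have cong: "poly (p m) (cos t) * poly (p n) (cos t) * sz.f t =
        poly (p m) (cos t) * poly (p n) (cos t) * (jacobi_weight \<alpha> \<beta> h (cos t) * sin t)" if "t \<in> space ?M" for t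
      using that D_polar(2)[of t] by (simp add: space_restrict_space)
    have "integrable ?M (\<lambda>t. poly (p m) (cos t) * poly (p n) (cos t) * sz.f t)"
      by (rule sz.L2_prod[OF sz.L2_poly_cos sz.L2_poly_cos])
    then have "integrable ?M (\<lambda>t. poly (p m) (cos t) * poly (p n) (cos t) * (jacobi_weight \<alpha> \<beta> h (cos t) * sin t))"
      by (subst (asm) Bochner_Integration.integrable_cong[OF refl cong]) auto
    from orthonormal_polys_half_circle[OF assms(5) this]
    have "integral\<^sup>L ?M (\<lambda>t. poly (p m) (cos t) * poly (p n) (cos t) * (jacobi_weight \<alpha> \<beta> h (cos t) * sin t)) = (if m = n then 1 else 0)" .
    moreover have "sz.ip (\<lambda>t. poly (p m) (cos t)) (\<lambda>t. poly (p n) (cos t)) =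
       integral\<^sup>L ?M (\<lambda>t. poly (p m) (cos t) * poly (p n) (cos t) * (jacobi_weight \<alpha> \<beta> h (cos t) * sin t))"
      unfolding sz.ip_def by (rule Bochner_Integration.integral_cong[OF refl cong])
    ultimately show ?thesis by simp
  qed
  define \<delta> where "\<delta> = phi \<alpha> \<beta> h (cos \<theta>) - pi / 4"
  \<comment> \<open>The 1/2 added to \<alpha> and \<beta> splits off from a (\<theta> - pi)/2 + b
    \<theta>/2 as \<theta>/2 - pi/4: this is the half step in n + 1/2 and the constant - pi/4. The
    rest, with the argument Im L, is \<open>phi\<close>.\<close>
  have phase: "real n * \<theta> + \<omega> \<theta> = (real n + 1/2) * \<theta> + \<delta>" for n
  proof -
    have s: "sin \<theta> > 0" using th by (rule sin_gt_zero)
    then have sq: "sqrt (1 - (cos \<theta>)\<^sup>2) = sin \<theta>" by (simp add: sin_squared_eq[symmetric])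
    have "phi \<alpha> \<beta> h (cos \<theta>) = ((\<alpha> + \<beta>) * \<theta> - \<alpha> * pi) / 2 + Im (L (cis \<theta>))"
      unfolding phi_def phase_pv_integral[OF R L Lcnj Lh th] sq using s th by (simp add: arccos_cos)
    then show ?thesis by (simp add: \<delta>_def \<omega>_def a_def b_def field_simps)
  qed
  have f0: "sz.f \<theta> > 0" by (rule sz.f_pos[OF th])
  \<comment> \<open>The common factor of the squared polynomials: (pi/2) p_n^2 approaches S_n^2,
    which is the squared cosine divided by f \<theta>.\<close>
  define A where "A = 2 / (pi * sz.f \<theta>)"
  have A: "A > 0" using f0 by (simp add: A_def)
  have Ssq: "sz.f \<theta> * (sz.S n \<theta>)\<^sup>2 = (cos ((real n + 1/2) * \<theta> + \<delta>))\<^sup>2" for n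
  proof -
    define r where "r = norm (sz.D \<theta>)"
    have r: "r > 0" using sz.D_nz[OF th] by (simp add: r_def)
    have D: "sz.D \<theta> = of_real r * cis (\<omega> \<theta>)" unfolding r_def by (rule D_polar(1)[OF th])
    have "cis (- real n * \<theta>) / (of_real r * cis (\<omega> \<theta>)) = cis (- (real n * \<theta> + \<omega> \<theta>)) / of_real r"
    proof -
      have "cis (- real n * \<theta>) = cis (- (real n * \<theta> + \<omega> \<theta>)) * cis (\<omega> \<theta>)" by (simp add: cis_mult)
      then show ?thesis by simp
    qed
    then have "sz.S n \<theta> = cos (real n * \<theta> + \<omega> \<theta>) / r"
      unfolding sz.S_def D using cos_minus[of "real n * \<theta> + \<omega> \<theta>"] by (simp only: Re_divide_of_real cis.sel)
    then show ?thesis using r unfolding phase by (simp add: sz.f_def r_def[symmetric] power_divide)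
  qed
  have "(\<lambda>n. sz.f \<theta> * (pi / 2 * (poly (p n) (cos \<theta>))\<^sup>2 - (sz.S n \<theta>)\<^sup>2)) \<longlonglongrightarrow> sz.f \<theta> * 0"
    by (intro tendsto_intros sz.szego_asymptotics deg orth th)
  moreover have "sz.f \<theta> * (pi / 2 * (poly (p n) (cos \<theta>))\<^sup>2 - (sz.S n \<theta>)\<^sup>2) =
      (poly (p n) (cos \<theta>))\<^sup>2 / A - (cos ((real n + 1/2) * \<theta> + \<delta>))\<^sup>2" for n
    unfolding Ssq[symmetric] A_def using f0 by (simp add: field_simps)
  ultimately have asym: "(\<lambda>n. (poly (p n) (cos \<theta>))\<^sup>2 / A - (cos ((real n + 1/2) * \<theta> + \<delta>))\<^sup>2) \<longlonglongrightarrow> 0" by simp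
  have p0: "poly (p 0) (cos \<theta>) \<noteq> 0"
  proof -
    obtain c where "p 0 = [:c:]" using deg(1)[of 0] degree_eq_zeroE by blast
    then show ?thesis using deg(2)[of 0] by simp
  qed
  note limit = entropy_defect_limit[OF A th asym p0]
  show ?thesis
  proof (intro conjI impI allI)
    assume "\<theta> / pi \<notin> \<rat>"
    from limit[OF FF_mean_irrational[OF this]]
    show "(\<lambda>n. entropy_defect p n (cos \<theta>)) \<longlonglongrightarrow> 1 - ln 2" by simp
  next
    fix s k :: nat assume sk: "\<theta> / pi = real s / real k \<and> s < k \<and> gcd s k = 1"
    then have \<theta>: "\<theta> = pi * real s / real k" by (simp add: field_simps)
    have "(1 / real k) * (\<Sum>i<k. FF (cos ((real i + 1/2) * \<theta> + \<delta>))) = S_hat \<alpha> \<beta> h k s"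
      unfolding S_hat_def \<delta>_def \<theta> by (simp only: add_diff_eq)
    then show "(\<lambda>n. entropy_defect p n (cos \<theta>)) \<longlonglongrightarrow> ln 2 + 2 * S_hat \<alpha> \<beta> h k s"
      using limit[OF FF_mean_rational[OF _ \<theta>, of \<delta>]] sk by simp
  qed
qed

end
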